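(* Let $\{X_1,\dots,X_n\}$ be a sequence of independent random variables in a sub-linear expectation space $(\Omega,\mathscr H,\widehat{\mathbb E})$, and let $\mathbb V$ be a sub-additive capacity on $\mathcal F$ satisfying the compatibility property (C), with $\mathcal V(A)=1-\mathbb V(A^c)$. Set $S_k=\sum_{i=1}^kX_i$, $B_n^2=\sum_{i=1}^n\widehat{\mathbb E}[X_i^2]$, $b_n^2=\sum_{i=1}^n\widehat{\mathcal E}[X_i^2]$, $A_n(p,y)=\sum_{i=1}^n\widehat{\mathbb E}[(X_i^+\wedge y)^p]$ for $p\ge2$, and $$B_{n,y}^2=\sum_{i=1}^n\widehat{\mathbb E}[(X_i\wedge y)^2],\qquad b_{n,y}^2=\sum_{i=1}^n\widehat{\mathcal E}[(X_i\wedge y)^2],\qquad y>0.$$ (I) Each of the two quantities $$\mathbb V\Big(\max_{k\le n}(S_k-\widehat{\mathbb E}[S_k])\ge x\Big)\quad\text{and}\quad\mathcal V\Big(\max_{k\le n}(S_k-\widehat{\mathcal E}[S_k])\ge x\Big)$$ is, for all $x,y>0$, at most $$\mathbb V\big(\max_{k\le n}X_k>y\big)+\exp\left\{-\frac{x^2}{2(xy+B_{n,y}^2)}\Big(1+\frac23\ln\big(1+\frac{xy}{B_{n,y}^2}\big)\Big)\right\},$$ and, for all $p\ge2$, $x,y>0$ and $0<\delta\le1$, at most $$\mathbb V\big(\max_{i\le n}X_i>y\big)+2\exp\{p^p\}\Big\{\frac{A_n(p,y)}{y^p}\Big\}^{\frac{\delta x}{10y}}+\exp\left\{-\frac{x^2}{2(1+\delta)B_{n,y}^2}\right\}.\tag{1}$$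 (II) The quantity $$\mathcal V\Big(\max_{k\le n}(S_k-\widehat{\mathbb E}[S_k])\ge x\Big)$$ is, for all $x,y>0$, at most $$\mathbb V\big(\max_{k\le n}X_k>y\big)+\exp\left\{-\frac{x^2}{2(xy+b_{n,y}^2)}\Big(1+\frac23\ln\big(1+\frac{xy}{b_{n,y}^2}\big)\Big)\right\},$$ and, for all $p\ge2$, $x,y>0$ and $0<\delta\le1$, at most $$\mathbb V\big(\max_{i\le n}X_i>y\big)+2\exp\{p^p\}\Big\{\frac{A_n(p,y)}{y^p}\Big\}^{\frac{\delta x}{10y}}+\exp\left\{-\frac{x^2}{2(1+\delta)b_{n,y}^2}\right\}.\tag{2}$$ Further, the upper bounds (1) and (2) can be replaced, respectively, by $$C_p\delta^{-p}\frac1{x^p}\sum_{i=1}^n\widehat{\mathbb E}[(X_i^+)^p]+\exp\left\{-\frac{x^2}{2(1+\delta)B_n^2}\right\}\quad\text{and}\quad C_p\delta^{-p}\frac1{x^p}\sum_{i=1}^n\widehat{\mathbb E}[(X_i^+)^p]+\exp\left\{-\frac{x^2}{2(1+\delta)b_n^2}\right\},$$ where $C_p$ is a constant depending only on $p$.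
   Context: Sub-linear expectation space: $(\Omega,\mathcal F)$ is a measurable space and $\mathscr H$ is a linear space of real measurable functions on it such that $\varphi(X_1,\dots,X_n)\in\mathscr H$ whenever $X_1,\dots,X_n\in\mathscr H$ and $\varphi\in C_{l,Lip}(\mathbb R^n)$, where $C_{l,Lip}(\mathbb R^n)$ is the set of $\varphi$ with $|\varphi(x)-\varphi(y)|\le C(1+|x|^m+|y|^m)|x-y|$ for some $C>0$, $m\in\mathbb N$ depending on $\varphi$. A sub-linear expectation is a map $\widehat{\mathbb E}:\mathscr H\to[-\infty,\infty]$ such that: $X\ge Y$ implies $\widehat{\mathbb E}[X]\ge\widehat{\mathbb E}[Y]$; $\widehat{\mathbb E}[c]=c$ for constants $c$; $\widehat{\mathbb E}[X+Y]\le\widehat{\mathbb E}[X]+\widehat{\mathbb E}[Y]$ whenever the right side is not of the form $\infty-\infty$; $\widehat{\mathbb E}[\lambda X]=\lambda\widehat{\mathbb E}[X]$ for $\lambda\ge0$ (with $0\cdot\infty=0$). The conjugate expectation is $\widehat{\mathcal E}[X]=-\widehat{\mathbb E}[-X]$. Elements of $\mathscr H$ are called random variables. Independence: a random vector $\bm Y\in\mathscr H^n$ is independent to $\bm X\in\mathscr H^m$ if $\widehat{\mathbb E}[\varphi(\bm X,\bm Y)]=\widehat{\mathbb E}\big[\widehat{\mathbb E}[\varphi(\bm x,\bm Y)]|_{\bm x=\bm X}\big]$ for each $\varphi\in C_{l,Lip}(\mathbb R^m\times\mathbb R^n)$ with $\overline\varphi(\bm x):=\widehat{\mathbb E}[|\varphi(\bm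 x,\bm Y)|]<\infty$ for all $\bm x$ and $\widehat{\mathbb E}[|\overline\varphi(\bm X)|]<\infty$. The sequence $X_1,\dots,X_n$ is independent if $X_{i+1}$ is independent to $(X_1,\dots,X_i)$ for each $1\le i<n$. Capacities: a capacity is a monotone set function $V:\mathcal F\to[0,1]$ with $V(\emptyset)=0$, $V(\Omega)=1$; it is sub-additive if $V(A\cup B)\le V(A)+V(B)$. Property (C) for $\mathbb V$: $\widehat{\mathbb E}[f]\le\mathbb V(A)\le\widehat{\mathbb E}[g]$ whenever $f\le I_A\le g$, $f,g\in\mathscr H$, $A\in\mathcal F$. Conventions: $x\wedge y=\min(x,y)$; $x^+=\max(x,0)$.
   Formalization: Part (II) and its replacement bound additionally assume that the upper expectation of each negative part X_i^- is finite; without this (II) fails. The constant C_p is stated for sample spaces over one arbitrary type; pushing forward to R^n gives a common one. *)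

theory Defs
  imports "HOL-Analysis.Analysis"
begin

text \<open>
  Points of \<open>\<real>\<^sup>n\<close> are maps \<^typ>\<open>nat \<Rightarrow> real\<close> read at the coordinates \<open>0, \<dots>, n - 1\<close>; the dimension
  has to vary inside statements (independence of a sequence). The Lipschitz condition forces
  \<open>\<phi>\<close> to ignore all other coordinates, so \<open>Cl_Lip n\<close> is exactly \<open>C\<^sub>l\<^sub>,\<^sub>L\<^sub>i\<^sub>p(\<real>\<^sup>n)\<close>.
\<close>

definition Cl_Lip :: "nat \<Rightarrow> ((nat \<Rightarrow> real) \<Rightarrow> real) set" where
  "Cl_Lip n = {\<phi>. \<exists>C>0. \<exists>m::nat. \<forall>x y.
     \<bar>\<phi> x - \<phi> y\<bar> \<le> C * (1 + L2_set x {..<n} ^ m + L2_set y {..<n} ^ m)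
                     * L2_set (\<lambda>i. x i - y i) {..<n}}"

definition join :: "nat \<Rightarrow> (nat \<Rightarrow> real) \<Rightarrow> (nat \<Rightarrow> real) \<Rightarrow> nat \<Rightarrow> real" where
  "join m x y = (\<lambda>i. if i < m then x i else y (i - m))"

text \<open>
  The measure \<open>M\<close> only supplies the measurable space \<open>(space M, sets M)\<close>. The map \<open>E\<close> is a total
  HOL function, constrained on \<open>H\<close> only.
\<close>

locale sublinear_expectation_space =
  fixes M :: "'a measure" and H :: "('a \<Rightarrow> real) set" and E :: "('a \<Rightarrow> real) \<Rightarrow> ereal"
  assumes H_measurable: "X \<in> H \<Longrightarrow> X \<in> borel_measurable M"
    and H_zero: "(\<lambda>_. 0) \<in> H"
    and H_add: "X \<in> H \<Longrightarrow> Y \<in> H \<Longrightarrow> (\<lambda>\<omega>. X \<omega> + Y \<omega>) \<in> H"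
    and H_scale: "X \<in> H \<Longrightarrow> (\<lambda>\<omega>. c * X \<omega>) \<in> H"
    and H_closed: "\<phi> \<in> Cl_Lip n \<Longrightarrow> (\<And>i. i < n \<Longrightarrow> Z i \<in> H) \<Longrightarrow> (\<lambda>\<omega>. \<phi> (\<lambda>i. Z i \<omega>)) \<in> H"
    and E_mono: "X \<in> H \<Longrightarrow> Y \<in> H \<Longrightarrow> (\<And>\<omega>. \<omega> \<in> space M \<Longrightarrow> Y \<omega> \<le> X \<omega>) \<Longrightarrow> E Y \<le> E X"
    and E_const: "E (\<lambda>_. c) = ereal c"
    and E_subadd: "X \<in> H \<Longrightarrow> Y \<in> H \<Longrightarrow>
          \<not> (E X = \<infinity> \<and> E Y = -\<infinity>) \<Longrightarrow> \<not> (E X = -\<infinity> \<and> E Y = \<infinity>) \<Longrightarrow>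
          E (\<lambda>\<omega>. X \<omega> + Y \<omega>) \<le> E X + E Y"
    and E_pos_homog: "X \<in> H \<Longrightarrow> 0 \<le> c \<Longrightarrow> E (\<lambda>\<omega>. c * X \<omega>) = ereal c * E X"

definition conj_exp :: "(('a \<Rightarrow> real) \<Rightarrow> ereal) \<Rightarrow> ('a \<Rightarrow> real) \<Rightarrow> ereal" where
  "conj_exp E X = - E (\<lambda>\<omega>. - X \<omega>)"

text \<open>
  \<open>indep_to H E n Y m X\<close>: the vector \<open>(Y 0, \<dots>, Y (n - 1))\<close> is independent to
  \<open>(X 0, \<dots>, X (m - 1))\<close>. The two functions of \<open>X\<close> to which the outer expectation is applied are
  required to be random variables, since \<open>E\<close> is meaningful on \<open>H\<close> only. Once \<open>\<phi>bar\<close> is finite,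
  both inner expectations are finite for every \<open>x\<close>, so no value \<open>\<plusminus>\<infinity>\<close> is lost by
  \<^const>\<open>real_of_ereal\<close>.
\<close>

definition indep_to ::
    "('a \<Rightarrow> real) set \<Rightarrow> (('a \<Rightarrow> real) \<Rightarrow> ereal) \<Rightarrow> nat \<Rightarrow> (nat \<Rightarrow> 'a \<Rightarrow> real) \<Rightarrow>
     nat \<Rightarrow> (nat \<Rightarrow> 'a \<Rightarrow> real) \<Rightarrow> bool" where
  "indep_to H E n Y m X \<longleftrightarrow>
     (\<forall>i<m. X i \<in> H) \<and> (\<forall>i<n. Y i \<in> H) \<and>
     (\<forall>\<phi> \<in> Cl_Lip (m + n).
        let \<phi>bar = (\<lambda>x. E (\<lambda>\<omega>. \<bar>\<phi> (join m x (\<lambda>j. Y j \<omega>))\<bar>));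
            \<phi>bar_X = (\<lambda>\<omega>. real_of_ereal (\<phi>bar (\<lambda>i. X i \<omega>)));
            inner_X = (\<lambda>\<omega>. real_of_ereal (E (\<lambda>\<omega>'. \<phi> (join m (\<lambda>i. X i \<omega>) (\<lambda>j. Y j \<omega>')))))
        in (\<forall>x. \<phi>bar x < \<infinity>) \<longrightarrow> \<phi>bar_X \<in> H \<longrightarrow> inner_X \<in> H \<longrightarrow>
           E (\<lambda>\<omega>. \<bar>\<phi>bar_X \<omega>\<bar>) < \<infinity> \<longrightarrow>
           E (\<lambda>\<omega>. \<phi> (join m (\<lambda>i. X i \<omega>) (\<lambda>j. Y j \<omega>))) = E inner_X)"

text \<open>The sequence is \<open>X 1, \<dots>, X n\<close>; the value \<open>X 0\<close> is not used.\<close>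

definition indep_seq ::
    "('a \<Rightarrow> real) set \<Rightarrow> (('a \<Rightarrow> real) \<Rightarrow> ereal) \<Rightarrow> nat \<Rightarrow> (nat \<Rightarrow> 'a \<Rightarrow> real) \<Rightarrow> bool" where
  "indep_seq H E n X \<longleftrightarrow>
     (\<forall>i\<in>{1..n}. X i \<in> H) \<and>
     (\<forall>i\<in>{1..<n}. indep_to H E 1 (\<lambda>_. X (Suc i)) i (\<lambda>j. X (Suc j)))"

definition capacity :: "'a measure \<Rightarrow> ('a set \<Rightarrow> real) \<Rightarrow> bool" where
  "capacity M V \<longleftrightarrow>
     (\<forall>A\<in>sets M. 0 \<le> V A \<and> V A \<le> 1) \<and>
     V {} = 0 \<and> V (space M) = 1 \<and>
     (\<forall>A\<in>sets M. \<forall>B\<in>sets M. A \<subseteq> B \<longrightarrow> V A \<le> V B)"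

definition subadditive_capacity :: "'a measure \<Rightarrow> ('a set \<Rightarrow> real) \<Rightarrow> bool" where
  "subadditive_capacity M V \<longleftrightarrow>
     capacity M V \<and> (\<forall>A\<in>sets M. \<forall>B\<in>sets M. V (A \<union> B) \<le> V A + V B)"

definition conj_cap :: "'a measure \<Rightarrow> ('a set \<Rightarrow> real) \<Rightarrow> 'a set \<Rightarrow> real" where
  "conj_cap M V A = 1 - V (space M - A)"

definition property_C ::
    "'a measure \<Rightarrow> ('a \<Rightarrow> real) set \<Rightarrow> (('a \<Rightarrow> real) \<Rightarrow> ereal) \<Rightarrow> ('a set \<Rightarrow> real) \<Rightarrow> bool" where
  "property_C M H E V \<longleftrightarrow>
     (\<forall>f\<in>H. \<forall>g\<in>H. \<forall>A\<in>sets M.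
        (\<forall>\<omega>\<in>space M. f \<omega> \<le> indicat_real A \<omega> \<and> indicat_real A \<omega> \<le> g \<omega>) \<longrightarrow>
        E f \<le> ereal (V A) \<and> ereal (V A) \<le> E g)"

definition psum :: "(nat \<Rightarrow> 'a \<Rightarrow> real) \<Rightarrow> nat \<Rightarrow> 'a \<Rightarrow> real" where
  "psum X k \<omega> = (\<Sum>i=1..k. X i \<omega>)"

text \<open>
  The event that \<open>max {S k - F (S k) | k \<le> n} \<ge> x\<close>, for \<open>F\<close> either \<open>E\<close> or \<^term>\<open>conj_exp E\<close>.
  The difference is extended-real: \<open>F (S k) = \<infinity>\<close> makes it \<open>-\<infinity>\<close>, and vice versa.
\<close>

definition dev_event ::
    "'a measure \<Rightarrow> (('a \<Rightarrow> real) \<Rightarrow> ereal) \<Rightarrow> nat \<Rightarrow> (nat \<Rightarrow> 'a \<Rightarrow> real) \<Rightarrow> real \<Rightarrow> 'a set" where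
  "dev_event M F n X x =
     {\<omega>\<in>space M. ereal x \<le> (MAX k\<in>{1..n}. ereal (psum X k \<omega>) - F (psum X k))}"

definition large_event :: "'a measure \<Rightarrow> nat \<Rightarrow> (nat \<Rightarrow> 'a \<Rightarrow> real) \<Rightarrow> real \<Rightarrow> 'a set" where
  "large_event M n X y = {\<omega>\<in>space M. (MAX k\<in>{1..n}. X k \<omega>) > y}"

text \<open>
  With \<open>F = E\<close> the next two are \<open>B\<^sub>n\<^sup>2\<close> and \<open>B\<^sub>n\<^sub>,\<^sub>y\<^sup>2\<close>; with \<open>F = conj_exp E\<close> they are
  \<open>b\<^sub>n\<^sup>2\<close> and \<open>b\<^sub>n\<^sub>,\<^sub>y\<^sup>2\<close>.
\<close>

definition sqsum ::
    "(('a \<Rightarrow> real) \<Rightarrow> ereal) \<Rightarrow> nat \<Rightarrow> (nat \<Rightarrow> 'a \<Rightarrow> real) \<Rightarrow> ereal" where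
  "sqsum F n X = (\<Sum>i=1..n. F (\<lambda>\<omega>. (X i \<omega>)\<^sup>2))"

definition sqsum_trunc ::
    "(('a \<Rightarrow> real) \<Rightarrow> ereal) \<Rightarrow> nat \<Rightarrow> (nat \<Rightarrow> 'a \<Rightarrow> real) \<Rightarrow> real \<Rightarrow> ereal" where
  "sqsum_trunc F n X y = (\<Sum>i=1..n. F (\<lambda>\<omega>. (min (X i \<omega>) y)\<^sup>2))"

definition A_trunc ::
    "(('a \<Rightarrow> real) \<Rightarrow> ereal) \<Rightarrow> nat \<Rightarrow> (nat \<Rightarrow> 'a \<Rightarrow> real) \<Rightarrow> real \<Rightarrow> real \<Rightarrow> ereal" where
  "A_trunc E n X p y = (\<Sum>i=1..n. E (\<lambda>\<omega>. (min (max (X i \<omega>) 0) y) powr p))"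

definition pos_moment_sum ::
    "(('a \<Rightarrow> real) \<Rightarrow> ereal) \<Rightarrow> nat \<Rightarrow> (nat \<Rightarrow> 'a \<Rightarrow> real) \<Rightarrow> real \<Rightarrow> ereal" where
  "pos_moment_sum E n X p = (\<Sum>i=1..n. E (\<lambda>\<omega>. (max (X i \<omega>) 0) powr p))"

text \<open>
  The sums of second moments may be \<open>0\<close> or \<open>\<infinity>\<close>. The exponential terms are therefore formed in
  the extended reals, where \<open>x / 0 = \<infinity>\<close> and \<open>x / \<infinity> = 0\<close> for \<open>0 < x < \<infinity>\<close>, with \<open>exp\<close> and
  \<open>ln\<close> extended by \<open>exp (-\<infinity>) = 0\<close>, \<open>exp \<infinity> = \<infinity>\<close>, \<open>ln \<infinity> = \<infinity>\<close>. Thus both terms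
  below are \<open>0\<close> for \<open>B2 = 0\<close> and \<open>1\<close> for \<open>B2 = \<infinity>\<close>, which are their limits.
\<close>

definition exp_ereal :: "ereal \<Rightarrow> ereal" where
  "exp_ereal z = (if z = \<infinity> then \<infinity> else if z = -\<infinity> then 0 else ereal (exp (real_of_ereal z)))"

text \<open>Only used for arguments \<open>\<ge> 1\<close>.\<close>

definition ln_ereal :: "ereal \<Rightarrow> ereal" where
  "ln_ereal z = (if z = \<infinity> then \<infinity> else ereal (ln (real_of_ereal z)))"

definition bennett_term :: "real \<Rightarrow> real \<Rightarrow> ereal \<Rightarrow> ereal" where
  "bennett_term x y B2 =
     exp_ereal (- (ereal (x\<^sup>2) / (2 * (ereal (x * y) + B2))
                   * (1 + ereal (2 / 3) * ln_ereal (1 + ereal (x * y) / B2))))"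

definition gauss_term :: "real \<Rightarrow> real \<Rightarrow> ereal \<Rightarrow> ereal" where
  "gauss_term \<delta> x B2 = exp_ereal (- (ereal (x\<^sup>2) / (ereal (2 * (1 + \<delta>)) * B2)))"

text \<open>
  The conversion to \<^typ>\<open>real\<close> is harmless because
  \<open>A_trunc E n X p y\<close> lies between \<open>0\<close> and \<open>n y\<^sup>p\<close>.
\<close>

definition moment_term ::
    "(('a \<Rightarrow> real) \<Rightarrow> ereal) \<Rightarrow> nat \<Rightarrow> (nat \<Rightarrow> 'a \<Rightarrow> real) \<Rightarrow> real \<Rightarrow> real \<Rightarrow> real \<Rightarrow> real \<Rightarrow> real" where
  "moment_term E n X p \<delta> x y =
     2 * exp (p powr p) *
     (real_of_ereal (A_trunc E n X p y) / y powr p) powr (\<delta> * x / (10 * y))"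

end

(* After truncation, Y = min X y, a Chernoff bound for the partial sums of Y - m(Y) is needed under
   F, where F is E or its conjugate and m the corresponding mean. If the functions g_i of X_i are
   bounded and Lipschitz with F (g_i) <= 1, the products U_k = g_1 ... g_k form a supermartingale
   for F. Stopping is smoothed: with a Lipschitz cutoff f vanishing below c and equal to 1 above a,
   the process 1 + sum_k eta_k U_k (g_{k+1} - 1), eta_k = prod_{i<=k} (1 - f(U_i)), has expectation
   at most 1 and dominates c times the indicator of {max U_k >= a}. This gives Ville's inequality
   for V and for its conjugate.

   The moment generating function is bounded through e^v <= 1 + v + d v^2 + e (v^+)^p, applied to
   v = t Y. Subadditivity turns it into a bound by the mean, the second moment and the p-th moment,
   and for the conjugate expectation exactly one of the first two terms may be a conjugate one,
   which is where the variants with lower mean or lower variance come from. The choice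
   d = (e^s - 1 - s) / s^2, e = 0 gives the Bennett term. The choice d = (1 + delta/2) / 2 gives
   the Gaussian term, the slack between delta/2 and delta absorbing the contribution of the p-th
   moment. Taking y = delta x / 10 gives the last bound. *)
theory Submission
  imports Defs
begin

text \<open>\<open>E\<close> is meaningful on \<open>H\<close> only, and independence applies only
  to Lipschitz-type functions whose partial expectations are finite and lie in \<open>H\<close>.
  Indicators and genuine stopping times are therefore out of reach. Truncation from above makes the
  exponentials bounded and Lipschitz, and integrating out one coordinate keeps the Lipschitz
  constant, so the side conditions of \<open>indep_to\<close> can be verified at every step.

  The second obstacle is the centring. The exponential argument centres by the sum of the truncated
  means, the theorem by the mean of the whole sum. For \<open>E\<close>, subadditivity compares the
  two in the wrong direction; independence turns it into an equality. For the conjugate,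
  superadditivity already has the right direction.

  After rescaling to y = 1 the probabilistic half delivers one family of real inequalities, P <= exp
  (-tau x + d tau^2 b + e tau^p a), for all admissible tau, d and e. What remains is calculus,
  shared by all three combinations of capacity, mean and variance.\<close>

section \<open>Elementary inequalities for exp and ln\<close>

lemma exp_le_quadratic_neg:
  fixes u :: real assumes "u \<le> 0" shows "exp u \<le> 1 + u + u\<^sup>2 / 2"
proof -
  define v where "v = - u"
  have v: "v \<ge> 0" using assms v_def by simp
  have q: "0 < 1 + v + v\<^sup>2 / 2" using v by (simp add: add_pos_nonneg)
  have "1 \<le> (1 - v + v\<^sup>2 / 2) * (1 + v + v\<^sup>2 / 2)"
  proof -
    have "(1 - v + v\<^sup>2 / 2) * (1 + v + v\<^sup>2 / 2) = 1 + (v\<^sup>2)\<^sup>2 / 4"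
      by (simp add: power2_eq_square field_simps)
    then show ?thesis by simp
  qed
  then have "1 / (1 + v + v\<^sup>2 / 2) \<le> 1 - v + v\<^sup>2 / 2" using q by (simp add: divide_le_eq)
  moreover have "exp (- v) \<le> 1 / (1 + v + v\<^sup>2 / 2)"
    using exp_lower_Taylor_quadratic[OF v] q by (simp add: exp_minus field_simps)
  ultimately show ?thesis by (simp add: v_def)
qed

text \<open>Behind this is the monotonicity of (e^u - 1 - u) / u^2, of which only the comparison
  with the value at \<open>w\<close> is needed. For u <= 0 the quotient is at most 1/2, and at
  \<open>w > 0\<close> it is at least 1/2; for 0 < u <= w the power series are compared term by
  term.\<close>

lemma exp_quadratic_bound:
  fixes u w :: real assumes "u \<le> w" "0 < w"
  shows "exp u \<le> 1 + u + (exp w - 1 - w) / w\<^sup>2 * u\<^sup>2"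
proof (cases "u \<le> 0")
  case True
  have "1 / 2 \<le> (exp w - 1 - w) / w\<^sup>2"
    using exp_lower_Taylor_quadratic[of w] assms by (simp add: field_simps)
  then have "1 / 2 * u\<^sup>2 \<le> (exp w - 1 - w) / w\<^sup>2 * u\<^sup>2" by (rule mult_right_mono) simp
  then show ?thesis using exp_le_quadratic_neg[OF True] by linarith
next
  case False
  define a where "a n = inverse (fact (n + 2) :: real)" for n :: nat
  have s: "summable (\<lambda>n. a n * v ^ (n + 2))" for v :: real
    using summable_ignore_initial_segment[OF summable_exp, of 2 v] unfolding a_def by simp
  have e: "exp v - 1 - v = (\<Sum>n. a n * v ^ (n + 2))" for v :: real
    using exp_first_two_terms[of v] unfolding a_def by simp
  have "exp u - 1 - u = (\<Sum>n. a n * u ^ (n + 2))" by (rule e)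
  also have "\<dots> \<le> (\<Sum>n. u\<^sup>2 / w\<^sup>2 * (a n * w ^ (n + 2)))"
  proof (rule suminf_le[OF _ s summable_mult[OF s]])
    fix n
    have "a n * u ^ (n + 2) = a n * u ^ n * u\<^sup>2" by (simp add: power_add power2_eq_square)
    also have "\<dots> \<le> a n * w ^ n * u\<^sup>2"
      using False assms by (intro mult_right_mono mult_left_mono power_mono) (auto simp: a_def)
    also have "\<dots> = u\<^sup>2 / w\<^sup>2 * (a n * w ^ (n + 2))"
      using assms by (simp add: power_add power2_eq_square)
    finally show "a n * u ^ (n + 2) \<le> u\<^sup>2 / w\<^sup>2 * (a n * w ^ (n + 2))" .
  qed
  also have "\<dots> = u\<^sup>2 / w\<^sup>2 * (exp w - 1 - w)"
    using suminf_mult[OF s, of "u\<^sup>2 / w\<^sup>2" w] e[of w] by simp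
  finally show ?thesis by (simp add: field_simps)
qed

text \<open>The rational function is dictated by \<open>bennett_function_bound\<close>: it equals (4
  u + 2 u^2 / (3 (1 + u))) / (4 + 8 u / 3), exactly what makes the derivative there nonnegative.
  Both sides vanish at 0, and comparing derivatives leaves 18 v^2 + 16 v^3 >= 0.\<close>

lemma ln_ge_rational:
  fixes u :: real assumes "0 \<le> u"
  shows "(6 * u + 7 * u\<^sup>2) / ((1 + u) * (6 + 4 * u)) \<le> ln (1 + u)"
proof -
  define f where "f u = ln (1 + u) - (6 * u + 7 * u\<^sup>2) / ((1 + u) * (6 + 4 * u))" for u :: real
  have "f 0 \<le> f u"
  proof (rule DERIV_nonneg_imp_nondecreasing[OF assms])
    fix v :: real assume v: "0 \<le> v" "v \<le> u"
    define d where "d = 1 / (1 + v) - ((6 + 14 * v) * ((1 + v) * (6 + 4 * v)) - (6 * v + 7 * v\<^sup>2) * (10 + 8 * v))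
      / ((1 + v) * (6 + 4 * v))\<^sup>2"
    have "(f has_real_derivative d) (at v)"
    proof -
      have "1 + v \<noteq> 0" "(1 + v) * (6 + 4 * v) \<noteq> 0" "0 < 1 + v" using v by auto
      then show ?thesis unfolding f_def d_def
        by (auto intro!: derivative_eq_intros simp: power2_eq_square)
    qed
    moreover have "0 \<le> d"
    proof -
      have "(6 + 14 * v) * ((1 + v) * (6 + 4 * v)) - (6 * v + 7 * v\<^sup>2) * (10 + 8 * v) = 36 + 84 * v + 46 * v\<^sup>2"
        by (simp add: power2_eq_square algebra_simps)
      also have "\<dots> \<le> (1 + v) * (6 + 4 * v)\<^sup>2"
      proof -
        have "(1 + v) * (6 + 4 * v)\<^sup>2 = 36 + 84 * v + 64 * v\<^sup>2 + 16 * (v * v\<^sup>2)"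
          by (simp add: power2_eq_square algebra_simps)
        moreover have "0 \<le> v * v\<^sup>2" using v by simp
        ultimately show ?thesis by simp
      qed
      finally have "((6 + 14 * v) * ((1 + v) * (6 + 4 * v)) - (6 * v + 7 * v\<^sup>2) * (10 + 8 * v))
          / ((1 + v) * (6 + 4 * v))\<^sup>2 \<le> ((1 + v) * (6 + 4 * v)\<^sup>2) / ((1 + v) * (6 + 4 * v))\<^sup>2"
        by (rule divide_right_mono) simp
      also have "\<dots> = 1 / (1 + v)" using v by (simp add: power2_eq_square)
      finally show ?thesis by (simp add: d_def)
    qed
    ultimately show "\<exists>y. (f has_real_derivative y) (at v) \<and> 0 \<le> y" by blast
  qed
  then show ?thesis by (simp add: f_def)
qed

text \<open>The right side is the Bennett function, the Legendre transform of e^s - 1 - s; the left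
  side is the form it takes in the theorem, with u = x y / B. Multiplied by 2 (1 + u), the
  difference vanishes at 0 and has a nonnegative derivative by
  \<open>ln_ge_rational\<close>.\<close>

lemma bennett_function_bound:
  fixes u :: real assumes "0 \<le> u"
  shows "u\<^sup>2 / (2 * (1 + u)) * (1 + 2 / 3 * ln (1 + u)) \<le> (1 + u) * ln (1 + u) - u"
proof -
  define f where "f u = 2 * (1 + u)\<^sup>2 * ln (1 + u) - 2 * u * (1 + u) - u\<^sup>2 * (1 + 2 / 3 * ln (1 + u))" for u :: real
  have "f 0 \<le> f u"
  proof (rule DERIV_nonneg_imp_nondecreasing[OF assms])
    fix v :: real assume v: "0 \<le> v" "v \<le> u"
    define d where "d = (4 + 8 / 3 * v) * ln (1 + v) - 4 * v - 2 / 3 * v\<^sup>2 / (1 + v)"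
    have "(f has_real_derivative d) (at v)"
      unfolding f_def d_def using v
      by (auto intro!: derivative_eq_intros simp: divide_simps) (simp add: power2_eq_square algebra_simps)
    moreover have "0 \<le> d"
    proof -
      have "4 * v + 2 / 3 * v\<^sup>2 / (1 + v) = (4 + 8 / 3 * v) * ((6 * v + 7 * v\<^sup>2) / ((1 + v) * (6 + 4 * v)))"
      proof -
        have "1 + v \<noteq> 0" "6 + 4 * v \<noteq> 0" using v by auto
        then have "4 * v + 2 / 3 * v\<^sup>2 / (1 + v) = (2 / 3) * ((6 * v + 7 * v\<^sup>2) / (1 + v))"
          by (simp add: field_simps power2_eq_square)
        also have "\<dots> = (2 / 3) * (6 + 4 * v) * ((6 * v + 7 * v\<^sup>2) / ((1 + v) * (6 + 4 * v)))"
        proof -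
          define q where "q = (6 * v + 7 * v\<^sup>2) / (1 + v)"
          have "(2 / 3) * q = (2 / 3) * (6 + 4 * v) * (q / (6 + 4 * v))"
            using \<open>6 + 4 * v \<noteq> 0\<close> by (metis mult.assoc nonzero_mult_div_cancel_left times_divide_eq_right)
          then show ?thesis by (simp only: q_def divide_divide_eq_left)
        qed
        also have "(2 / 3) * (6 + 4 * v) = 4 + 8 / 3 * v" by simp
        finally show ?thesis .
      qed
      also have "\<dots> \<le> (4 + 8 / 3 * v) * ln (1 + v)"
        using ln_ge_rational[of v] v by (intro mult_left_mono) auto
      finally show ?thesis by (simp add: d_def)
    qed
    ultimately show "\<exists>y. (f has_real_derivative y) (at v) \<and> 0 \<le> y" by blast
  qed
  then have "u\<^sup>2 * (1 + 2 / 3 * ln (1 + u)) \<le> ((1 + u) * ln (1 + u) - u) * (2 * (1 + u))"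
    by (simp add: f_def power2_eq_square algebra_simps)
  then show ?thesis using assms by (simp add: divide_le_eq)
qed

section \<open>Choice of the exponential parameter, in variables rescaled to y = 1\<close>

text \<open>The variable \<open>v\<close> stands for \<open>t * Y\<close> with \<open>Y \<le> y\<close> and \<open>\<tau> = t * y\<close>.\<close>

definition mgf_majorant :: "real \<Rightarrow> real \<Rightarrow> real \<Rightarrow> real \<Rightarrow> bool" where
  "mgf_majorant p \<tau> d e \<longleftrightarrow> 0 < \<tau> \<and> 0 \<le> d \<and> 0 \<le> e \<and>
     (\<forall>v\<le>\<tau>. exp v \<le> 1 + v + d * v\<^sup>2 + e * (max v 0) powr p)"

lemma mgf_majorant_quadratic:
  assumes "0 < \<tau>" shows "mgf_majorant p \<tau> ((exp \<tau> - 1 - \<tau>) / \<tau>\<^sup>2) 0"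
  unfolding mgf_majorant_def using assms exp_quadratic_bound exp_ge_add_one_self[of \<tau>]
  by (auto intro!: divide_nonneg_nonneg simp del: exp_ge_add_one_self)

text \<open>The split is at \<open>v = \<delta> / 2\<close>. Below it the quadratic bound with w =
  \<delta> / 2 applies, and a third-order Taylor expansion with e <= 3 keeps its coefficient under
  (1 + \<delta> / 2) / 2. Above it 2 v / \<delta> > 1, so v^2 is at most (2 / \<delta>)^(p - 2) v^p
  and the p-th power absorbs the whole second-order remainder.\<close>

lemma mgf_majorant_mixed:
  assumes t: "0 < \<tau>" and d: "0 < \<delta>" "\<delta> \<le> 1" and p: "2 \<le> p"
  shows "mgf_majorant p \<tau> ((1 + \<delta> / 2) / 2) (exp \<tau> / 2 * (2 / \<delta>) powr (p - 2))"
  unfolding mgf_majorant_def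
proof (intro conjI allI impI t)
  show "0 \<le> (1 + \<delta> / 2) / 2" "0 \<le> exp \<tau> / 2 * (2 / \<delta>) powr (p - 2)" using d by auto
  fix v assume v: "v \<le> \<tau>"
  show "exp v \<le> 1 + v + (1 + \<delta> / 2) / 2 * v\<^sup>2 + exp \<tau> / 2 * (2 / \<delta>) powr (p - 2) * max v 0 powr p"
  proof (cases "v \<le> \<delta> / 2")
    case True
    obtain r where r: "\<bar>r\<bar> \<le> \<bar>\<delta> / 2\<bar>" "exp (\<delta> / 2) = (\<Sum>m<3. (\<delta> / 2) ^ m / fact m) + exp r / fact 3 * (\<delta> / 2) ^ 3"
      using Maclaurin_exp_le[of "\<delta> / 2" 3] by blast
    have "exp r \<le> exp 1" using r(1) d by simp
    then have "exp r \<le> 3" using exp_le by linarith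
    then have "exp r / 6 * (\<delta> / 2) ^ 3 \<le> 1 / 2 * (\<delta> / 2) ^ 3"
      using d by (intro mult_right_mono) auto
    moreover have "exp (\<delta> / 2) = 1 + \<delta> / 2 + (\<delta> / 2)\<^sup>2 / 2 + exp r / 6 * (\<delta> / 2) ^ 3"
      using r(2) by (simp add: eval_nat_numeral)
    ultimately have "exp (\<delta> / 2) - 1 - \<delta> / 2 \<le> (1 + \<delta> / 2) / 2 * (\<delta> / 2)\<^sup>2"
      by (simp add: power2_eq_square power3_eq_cube field_simps)
    then have "(exp (\<delta> / 2) - 1 - \<delta> / 2) / (\<delta> / 2)\<^sup>2 \<le> (1 + \<delta> / 2) / 2"
      using d by (simp only: pos_divide_le_eq zero_less_power half_gt_zero)
    then have "(exp (\<delta> / 2) - 1 - \<delta> / 2) / (\<delta> / 2)\<^sup>2 * v\<^sup>2 \<le> (1 + \<delta> / 2) / 2 * v\<^sup>2"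
      by (rule mult_right_mono) simp
    moreover have "exp v \<le> 1 + v + (exp (\<delta> / 2) - 1 - \<delta> / 2) / (\<delta> / 2)\<^sup>2 * v\<^sup>2"
      using True d by (intro exp_quadratic_bound) auto
    moreover have "0 \<le> exp \<tau> / 2 * (2 / \<delta>) powr (p - 2) * max v 0 powr p" by simp
    ultimately show ?thesis by linarith
  next
    case False
    then have v0: "0 < v" using d by linarith
    obtain r where r: "\<bar>r\<bar> \<le> \<bar>v\<bar>" "exp v = (\<Sum>m<2. v ^ m / fact m) + exp r / fact 2 * v ^ 2"
      using Maclaurin_exp_le[of v 2] by blast
    then have e: "exp v = 1 + v + exp r / 2 * v\<^sup>2" by (simp add: eval_nat_numeral)
    have "exp r / 2 * v\<^sup>2 \<le> exp \<tau> / 2 * v\<^sup>2"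
      using r(1) v v0 by (intro mult_right_mono) auto
    also have "\<dots> \<le> exp \<tau> / 2 * ((2 * v / \<delta>) powr (p - 2) * v\<^sup>2)"
    proof -
      have "1 \<le> 2 * v / \<delta>" using False d by (simp add: field_simps)
      then have "1 \<le> (2 * v / \<delta>) powr (p - 2)" using p by (intro ge_one_powr_ge_zero) auto
      then have "1 * v\<^sup>2 \<le> (2 * v / \<delta>) powr (p - 2) * v\<^sup>2" by (rule mult_right_mono) simp
      then show ?thesis by (intro mult_left_mono) auto
    qed
    also have "(2 * v / \<delta>) powr (p - 2) * v\<^sup>2 = (2 / \<delta>) powr (p - 2) * v powr p"
    proof -
      have "v powr p = v powr (p - 2) * v powr 2" by (simp flip: powr_add)
      moreover have "v powr 2 = v\<^sup>2" using v0 by (simp add: powr_realpow flip: powr_numeral)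
      moreover have "(2 * v / \<delta>) powr (p - 2) = (2 / \<delta>) powr (p - 2) * v powr (p - 2)"
        using powr_mult[of "2 / \<delta>" v "p - 2"] v0 d by simp
      ultimately show ?thesis by simp
    qed
    finally have "exp r / 2 * v\<^sup>2 \<le> exp \<tau> / 2 * (2 / \<delta>) powr (p - 2) * v powr p" by simp
    moreover have "0 \<le> (1 + \<delta> / 2) / 2 * v\<^sup>2" using d by simp
    moreover have "max v 0 = v" using v0 by simp
    ultimately show ?thesis using e by simp
  qed
qed

text \<open>The value \<open>\<tau> = ln (1 + x / b)\<close> is the minimiser of - \<tau> x +
  (e^\<tau> - 1 - \<tau>) b, and the minimum is - b times the Bennett function at x / b.\<close>

lemma bennett_from_majorant:
  fixes P x b a p :: real
  assumes P: "\<And>\<tau> d e. mgf_majorant p \<tau> d e \<Longrightarrow> P \<le> exp (- \<tau> * x + d * \<tau>\<^sup>2 * b + e * \<tau> powr p * a)"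
    and x: "0 < x" and b: "0 < b"
  shows "P \<le> exp (- (x\<^sup>2 / (2 * (x + b)) * (1 + 2 / 3 * ln (1 + x / b))))"
proof -
  define u where "u = x / b"
  have u: "0 < u" using x b u_def by simp
  define \<tau> where "\<tau> = ln (1 + u)"
  have t: "0 < \<tau>" using u \<tau>_def by simp
  have et: "exp \<tau> = 1 + u" using u by (simp add: \<tau>_def)
  have "P \<le> exp (- \<tau> * x + (exp \<tau> - 1 - \<tau>) * b)"
    using P[OF mgf_majorant_quadratic[OF t]] t by simp
  also have "- \<tau> * x + (exp \<tau> - 1 - \<tau>) * b = - (b * ((1 + u) * ln (1 + u) - u))"
    using b unfolding et by (simp add: u_def \<tau>_def field_simps)
  also have "exp \<dots> \<le> exp (- (b * (u\<^sup>2 / (2 * (1 + u)) * (1 + 2 / 3 * ln (1 + u)))))"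
    using bennett_function_bound[of u] u b by (simp only: exp_le_cancel_iff neg_le_iff_le mult_left_mono less_imp_le)
  also have "b * (u\<^sup>2 / (2 * (1 + u)) * (1 + 2 / 3 * ln (1 + u))) = x\<^sup>2 / (2 * (x + b)) * (1 + 2 / 3 * ln (1 + x / b))"
  proof -
    have "b * (u\<^sup>2 / (2 * (1 + u))) = x\<^sup>2 / (2 * (x + b))"
    proof -
      have "1 + u = (x + b) / b" using b by (simp add: u_def field_simps)
      then show ?thesis using b by (simp add: u_def power2_eq_square)
    qed
    then show ?thesis by (simp only: u_def mult.assoc[symmetric])
  qed
  finally show ?thesis .
qed

text \<open>Without variance the quadratic majorant leaves P <= e^(- \<tau> x) for every positive
  \<tau>, and \<tau> tends to infinity. This matches the value 0 of both exponential terms at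
  \<open>B2 = 0\<close>.\<close>

lemma degenerate_from_majorant:
  fixes P x a p :: real
  assumes P: "\<And>\<tau> d e. mgf_majorant p \<tau> d e \<Longrightarrow> P \<le> exp (- \<tau> * x + d * \<tau>\<^sup>2 * 0 + e * \<tau> powr p * a)"
    and x: "0 < x"
  shows "P \<le> 0"
proof (rule tendsto_lowerbound)
  show "((\<lambda>\<tau>. exp (- \<tau> * x)) \<longlongrightarrow> 0) at_top"
    using x by (intro filterlim_compose[OF exp_at_bot])
      (auto intro!: filterlim_at_top_mult_tendsto_pos[OF tendsto_const] filterlim_ident
        simp: filterlim_uminus_at_bot mult.commute)
  have "P \<le> exp (- \<tau> * x)" if "0 < \<tau>" for \<tau>
    using P[OF mgf_majorant_quadratic[OF that]] by simp
  then show "\<forall>\<^sub>F \<tau> in at_top. P \<le> exp (- \<tau> * x)"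
    by (intro eventually_mono[OF eventually_gt_at_top[of 0]])
qed simp

text \<open>Source of the p^p in the factor \<open>exp (p powr p)\<close> of the moment term. It is
  w <= e^w at w = z / p, raised to the power p.\<close>

lemma powr_exp_bound:
  fixes z p :: real assumes "0 < z" "0 < p" shows "z powr p * exp (- z) \<le> p powr p"
proof -
  have "z / p \<le> exp (z / p)" using exp_ge_add_one_self[of "z / p"] by linarith
  then have "(z / p) powr p \<le> exp (z / p) powr p" using assms by (intro powr_mono2) auto
  also have "\<dots> = exp z" using assms by (simp add: powr_def)
  finally show ?thesis using assms by (simp add: powr_divide exp_minus field_simps)
qed

text \<open>
  With \<open>L = - ln a\<close>, the optimal Gaussian parameter \<open>t = x / ((1 + \<delta>) b)\<close> is used as long as it is at
  most \<open>t1 = \<delta> L / 5\<close>, and \<open>t1\<close> beyond. The case \<open>x \<le> \<delta> b\<close> is covered by the Bennett bound, and for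
  \<open>\<delta> x L / 10 \<le> p\<^sup>p\<close> the moment term exceeds 1.
\<close>

lemma moment_from_majorant_pos:
  fixes P x b a p \<delta> :: real
  assumes P: "\<And>\<tau> d e. mgf_majorant p \<tau> d e \<Longrightarrow> P \<le> exp (- \<tau> * x + d * \<tau>\<^sup>2 * b + e * \<tau> powr p * a)"
    and P1: "P \<le> 1" and x: "0 < x" and b: "0 < b" and a: "0 < a" and p: "2 \<le> p" and d: "0 < \<delta>" "\<delta> \<le> 1"
  shows "P \<le> 2 * exp (p powr p) * a powr (\<delta> * x / 10) + exp (- (x\<^sup>2 / (2 * (1 + \<delta>) * b)))"
proof -
  define L where "L = - ln a"
  define pp where "pp = p powr p"
  define G where "G = x\<^sup>2 / (2 * (1 + \<delta>) * b)"
  have pp: "0 < pp" using p by (simp add: pp_def)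
  have aL: "a = exp (- L)" using a by (simp add: L_def)
  have apow: "a powr (\<delta> * x / 10) = exp (- (\<delta> * x * L / 10))"
    using a by (simp add: powr_def L_def)
  consider (A) "x \<le> \<delta> * b" | (B) "\<delta> * x * L / 10 \<le> pp" | (C) "x > \<delta> * b" "\<delta> * x * L / 10 > pp" by linarith
  then have "P \<le> exp (- G) \<or> P \<le> 2 * exp pp * exp (- (\<delta> * x * L / 10))"
  proof cases
    \<comment> \<open>Here x + b <= (1 + \<delta>) b, and the logarithmic factor of the Bennett
      bound is at least 1.\<close>
    case A
    have "P \<le> exp (- (x\<^sup>2 / (2 * (x + b)) * (1 + 2 / 3 * ln (1 + x / b))))"
      by (rule bennett_from_majorant[OF P x b])
    also have "\<dots> \<le> exp (- G)"
    proof -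
      have "G \<le> x\<^sup>2 / (2 * (x + b))"
        unfolding G_def using A x b d
        by (intro divide_left_mono mult_pos_pos add_pos_pos) (auto simp: algebra_simps)
      also have "\<dots> = x\<^sup>2 / (2 * (x + b)) * 1" by simp
      also have "\<dots> \<le> x\<^sup>2 / (2 * (x + b)) * (1 + 2 / 3 * ln (1 + x / b))"
        using x b by (intro mult_left_mono) auto
      finally show ?thesis by simp
    qed
    finally show ?thesis by simp
  next
    case B
    then have "1 \<le> exp (pp - \<delta> * x * L / 10)" by simp
    then have "1 \<le> exp pp * exp (- (\<delta> * x * L / 10))" by (simp add: exp_diff exp_minus field_simps)
    then show ?thesis using P1 by linarith
  next
    case C
    have L: "0 < L"
    proof -
      have "0 < \<delta> * x * L" using C(2) pp by linarith
      then show ?thesis using d x by (metis mult_pos_pos zero_less_mult_pos)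
    qed
    \<comment> \<open>At this scale the cap \<delta> L / 5 on \<tau> is
      \<open>\<delta> / 2 * z\<close>, which cancels the large powers of 1 / \<delta> in
      \<open>(2 / \<delta>) powr (p - 2) * \<tau> powr p\<close>. Also \<tau> <= L / 5 gives
      \<open>exp \<tau> * a <= exp (- (2 * z))\<close>: one factor exp (- z) pays for z^p, the other
      is kept.\<close>
    define z where "z = 2 * L / 5"
    have z: "0 < z" using L z_def by simp
    define s where "s \<tau> = exp \<tau> / 2 * (2 / \<delta>) powr (p - 2) * \<tau> powr p * a" for \<tau>
    have Ps: "P \<le> exp (- \<tau> * x + (1 + \<delta> / 2) / 2 * \<tau>\<^sup>2 * b + s \<tau>)" if "0 < \<tau>" for \<tau>
      unfolding s_def by (rule P[OF mgf_majorant_mixed[OF that d p]])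
    have s: "s \<tau> \<le> \<delta>\<^sup>2 / 8 * (pp * exp (- z))" if \<tau>: "0 < \<tau>" "\<tau> \<le> \<delta> * L / 5" for \<tau>
    proof -
      have \<tau>z: "\<tau> \<le> \<delta> / 2 * z" using \<tau> by (simp add: z_def)
      have "\<tau> - L \<le> - (2 * z)"
      proof -
        have "\<delta> * L \<le> 1 * L" using d L by (intro mult_right_mono) auto
        then show ?thesis using \<tau>(2) by (simp add: z_def)
      qed
      then have 1: "exp \<tau> * a \<le> exp (- (2 * z))" by (simp add: aL flip: exp_add)
      have "(2 / \<delta>) powr (p - 2) * \<tau> powr p \<le> (2 / \<delta>) powr (p - 2) * (\<delta> / 2 * z) powr p"
        using \<tau>z \<tau> p by (intro mult_left_mono powr_mono2) auto
      also have "\<dots> = (\<delta> / 2) powr (2 - p) * (\<delta> / 2) powr p * z powr p"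
      proof -
        have "(2 / \<delta>) powr (p - 2) = (\<delta> / 2) powr (2 - p)"
          using d by (simp add: powr_def ln_div algebra_simps)
        moreover have "(\<delta> / 2 * z) powr p = (\<delta> / 2) powr p * z powr p" by (rule powr_mult)
        ultimately show ?thesis by simp
      qed
      also have "(\<delta> / 2) powr (2 - p) * (\<delta> / 2) powr p = (\<delta> / 2)\<^sup>2"
        using d by (simp flip: powr_add)
      finally have 2: "(2 / \<delta>) powr (p - 2) * \<tau> powr p \<le> (\<delta> / 2)\<^sup>2 * z powr p" .
      have "s \<tau> = 1 / 2 * ((exp \<tau> * a) * ((2 / \<delta>) powr (p - 2) * \<tau> powr p))" by (simp add: s_def)
      also have "\<dots> \<le> 1 / 2 * (exp (- (2 * z)) * ((\<delta> / 2)\<^sup>2 * z powr p))"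
        using a by (intro mult_left_mono[OF mult_mono[OF 1 2]]) auto
      also have "\<dots> = \<delta>\<^sup>2 / 8 * ((z powr p * exp (- z)) * exp (- z))"
        by (simp add: power_divide flip: exp_add)
      also have "\<dots> \<le> \<delta>\<^sup>2 / 8 * (pp * exp (- z))"
        unfolding pp_def using powr_exp_bound[OF z, of p] p by (intro mult_left_mono mult_right_mono) auto
      finally show ?thesis .
    qed
    define t1 where "t1 = \<delta> * L / 5"
    define t where "t = x / ((1 + \<delta>) * b)"
    have t1: "0 < t1" using d L by (simp add: t1_def)
    have t: "0 < t" using d x b by (simp add: t_def)
    show ?thesis
    proof (cases "t \<le> t1")
      case True
      have tb: "t * b = x / (1 + \<delta>)" using b d by (simp add: t_def)
      \<comment> \<open>The parameter \<open>t\<close> is optimal for the coefficient (1 + \<delta>)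
        / 2, while the majorant has (1 + \<delta> / 2) / 2. The difference, \<delta> / 4 times t^2
        b, is the reserve that has to pay for \<open>s t\<close>.\<close>
      have "- t * x + (1 + \<delta> / 2) / 2 * t\<^sup>2 * b = - G - \<delta> / 4 * (t * (t * b))"
      proof -
        have "G = t * x / 2" using b d by (simp add: G_def t_def field_simps power2_eq_square)
        moreover have "(1 + \<delta>) * (t * (t * b)) = t * x" using d tb by simp
        then have "t * (t * b) + \<delta> * (t * (t * b)) = t * x" by (simp add: algebra_simps)
        moreover have "(1 + \<delta> / 2) / 2 * t\<^sup>2 * b = t * (t * b) / 2 + \<delta> * (t * (t * b)) / 4"
          by (simp add: power2_eq_square field_simps)
        moreover have "- t * x = - (t * x)" "\<delta> / 4 * (t * (t * b)) = \<delta> * (t * (t * b)) / 4" by simp_all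
        ultimately show ?thesis using \<open>G = t * x / 2\<close> by linarith
      qed
      \<comment> \<open>Both conditions of case C enter here: pp < \<delta> x z / 4, combined with
        exp (- z) <= 1 / z, bounds \<open>s t\<close>, and x > \<delta> b gives t >= \<delta> / 2,
        which bounds the reserve from below.\<close>
      moreover have "s t \<le> \<delta> / 4 * (t * (t * b))"
      proof -
        have "z * exp (- z) \<le> 1" using exp_ge_add_one_self[of z] z
          by (simp add: exp_minus field_simps del: exp_ge_add_one_self)
        then have ez: "exp (- z) \<le> 1 / z" using z by (simp add: field_simps)
        have "s t \<le> \<delta>\<^sup>2 / 8 * (pp * exp (- z))" using s t True t1_def by simp
        also have "\<dots> \<le> \<delta>\<^sup>2 / 8 * (pp * (1 / z))" using ez pp by (intro mult_left_mono) auto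
        also have "\<dots> \<le> \<delta>\<^sup>2 / 8 * (\<delta> * x / 4)"
          using C(2) z L by (intro mult_left_mono) (auto simp: z_def field_simps)
        also have "\<dots> = \<delta> / 4 * (\<delta> * \<delta> * x / 8)" by (simp add: power2_eq_square)
        also have "\<dots> \<le> \<delta> / 4 * (t * (t * b))"
        proof (rule mult_left_mono)
          have "\<delta> / 2 \<le> \<delta> / (1 + \<delta>)" using d by (intro divide_left_mono) auto
          also have "\<dots> \<le> t"
          proof -
            have "\<delta> \<le> x / b" using C(1) b by (simp add: pos_le_divide_eq)
            then have "\<delta> / (1 + \<delta>) \<le> x / b / (1 + \<delta>)" using d by (intro divide_right_mono) auto
            then show ?thesis by (simp add: t_def mult.commute)
          qed
          finally have 1: "\<delta> / 2 \<le> t" .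
          have 2: "x / 2 \<le> t * b" unfolding tb using x d by (intro divide_left_mono) auto
          have "\<delta> * \<delta> * x / 8 \<le> \<delta> * x / 8" using d x by simp
          also have "\<dots> \<le> \<delta> / 2 * (x / 2)" using d x by simp
          also have "\<dots> \<le> t * (t * b)" using 1 2 d x by (intro mult_mono) auto
          finally show "\<delta> * \<delta> * x / 8 \<le> t * (t * b)" .
        qed (use d in auto)
        finally show ?thesis .
      qed
      ultimately have "exp (- t * x + (1 + \<delta> / 2) / 2 * t\<^sup>2 * b + s t) \<le> exp (- G)" by simp
      then show ?thesis using Ps[OF t] by linarith
    next
      case False
      \<comment> \<open>Below the optimal parameter the quadratic term costs at most half of t1 x.
        What is left is - t1 x / 2 = - \<delta> x L / 10, the origin of the 10 in the exponent of
        the moment term.\<close>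
      have "(1 + \<delta>) * (t1 * b) \<le> x"
      proof -
        have "t1 * ((1 + \<delta>) * b) \<le> t * ((1 + \<delta>) * b)" using False b d by (intro mult_right_mono) auto
        also have "\<dots> = x" using b d by (simp add: t_def)
        finally show ?thesis by (simp add: algebra_simps)
      qed
      then have "(1 + \<delta> / 2) * (t1 * b) \<le> x" 
      proof (rule order_trans[rotated])
        show "(1 + \<delta> / 2) * (t1 * b) \<le> (1 + \<delta>) * (t1 * b)"
          using d t1 b by (intro mult_right_mono) auto
      qed
      then have "(1 + \<delta> / 2) * (t1 * b) * (t1 / 2) \<le> x * (t1 / 2)" using t1 by (intro mult_right_mono) auto
      then have "- t1 * x + (1 + \<delta> / 2) / 2 * t1\<^sup>2 * b \<le> - (\<delta> * x * L / 10)"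
        by (simp add: power2_eq_square t1_def algebra_simps)
      moreover have "s t1 \<le> pp"
      proof -
        have "s t1 \<le> \<delta>\<^sup>2 / 8 * (pp * exp (- z))" using s t1 t1_def by simp
        also have "\<dots> \<le> 1 * (pp * 1)"
          using d z pp power_le_one[of \<delta> 2] by (intro mult_mono) auto
        finally show ?thesis by simp
      qed
      ultimately have "P \<le> exp (pp - \<delta> * x * L / 10)" using Ps[OF t1] by (smt (verit) exp_le_cancel_iff)
      also have "\<dots> = exp pp * exp (- (\<delta> * x * L / 10))" by (simp flip: exp_add)
      also have "\<dots> \<le> 2 * exp pp * exp (- (\<delta> * x * L / 10))" by simp
      finally show ?thesis by simp
    qed
  qed
  moreover have "0 \<le> 2 * exp pp * exp (- (\<delta> * x * L / 10))" by simp
  moreover have "0 \<le> exp (- G)" by simp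
  ultimately show ?thesis unfolding apow G_def[symmetric] pp_def[symmetric] by linarith
qed

text \<open>At a = 0 there is no L = - ln a, so \<open>a\<close> is approached from the right: the
  hypothesis survives enlarging \<open>a\<close> because e >= 0, and a^q with q > 0 is
  right-continuous even at 0.\<close>

lemma moment_from_majorant:
  fixes P x b a p \<delta> :: real
  assumes P: "\<And>\<tau> d e. mgf_majorant p \<tau> d e \<Longrightarrow> P \<le> exp (- \<tau> * x + d * \<tau>\<^sup>2 * b + e * \<tau> powr p * a)"
    and P1: "P \<le> 1" and x: "0 < x" and b: "0 < b" and a: "0 \<le> a" and p: "2 \<le> p" and d: "0 < \<delta>" "\<delta> \<le> 1"
  shows "P \<le> 2 * exp (p powr p) * a powr (\<delta> * x / 10) + exp (- (x\<^sup>2 / (2 * (1 + \<delta>) * b)))"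
    (is "_ \<le> ?K * a powr ?q + ?G")
proof (rule tendsto_lowerbound)
  have "P \<le> ?K * a' powr ?q + ?G" if a': "a < a'" for a'
  proof (rule moment_from_majorant_pos[OF _ P1 x b _ p d])
    show "0 < a'" using a' a by simp
    fix \<tau> c e assume m: "mgf_majorant p \<tau> c e"
    have "e * \<tau> powr p * a \<le> e * \<tau> powr p * a'"
      using m a' by (intro mult_left_mono) (auto simp: mgf_majorant_def)
    then have "exp (- \<tau> * x + c * \<tau>\<^sup>2 * b + e * \<tau> powr p * a) \<le> exp (- \<tau> * x + c * \<tau>\<^sup>2 * b + e * \<tau> powr p * a')" by simp
    then show "P \<le> exp (- \<tau> * x + c * \<tau>\<^sup>2 * b + e * \<tau> powr p * a')" using P[OF m] by linarith
  qed
  then show "\<forall>\<^sub>F a' in at_right a. P \<le> ?K * a' powr ?q + ?G"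
    by (auto simp: eventually_at_right_less intro: eventually_mono[OF eventually_at_right_less])
  have "((\<lambda>a'. a') \<longlongrightarrow> a) (at_right a)" by (rule tendsto_ident_at)
  then have "((\<lambda>a'. a' powr ?q) \<longlongrightarrow> a powr ?q) (at_right a)"
  proof (rule tendsto_powr'[OF _ tendsto_const])
    have "\<forall>\<^sub>F a' in at_right a. 0 \<le> a'"
      using a by (intro eventually_mono[OF eventually_at_right_less]) linarith
    then show "a \<noteq> 0 \<or> 0 < \<delta> * x / 10 \<and> (\<forall>\<^sub>F a' in at_right a. 0 \<le> a')"
      using x d by simp
  qed
  then show "((\<lambda>a'. ?K * a' powr ?q + ?G) \<longlongrightarrow> ?K * a powr ?q + ?G) (at_right a)"
    by (intro tendsto_add tendsto_mult_left tendsto_const)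
qed simp

section \<open>Lipschitz test functions\<close>

text \<open>The l1 distance and a global constant are chosen so that integrating out the last
  coordinate leaves a function of the others with the same constant, see
  \<open>E_coord_lip_section\<close>. With the growth weights of \<open>Cl_Lip\<close> the constant
  would involve moments of the integrated variable.\<close>

definition coord_lip :: "nat \<Rightarrow> ((nat \<Rightarrow> real) \<Rightarrow> real) set" where
  "coord_lip n = {\<phi>. \<exists>K\<ge>0. \<forall>x y. \<bar>\<phi> x - \<phi> y\<bar> \<le> K * (\<Sum>i<n. \<bar>x i - y i\<bar>)}"

text \<open>Boundedness buys closure under products and automatic finiteness of all expectations.
  The products of truncated exponentials live in this class.\<close>

definition bounded_lip :: "nat \<Rightarrow> ((nat \<Rightarrow> real) \<Rightarrow> real) set" where
  "bounded_lip n = {\<phi> \<in> coord_lip n. \<exists>B. \<forall>x. \<bar>\<phi> x\<bar> \<le> B}"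

lemma coord_lipI:
  "0 \<le> K \<Longrightarrow> (\<And>x y. \<bar>\<phi> x - \<phi> y\<bar> \<le> K * (\<Sum>i<n. \<bar>x i - y i\<bar>)) \<Longrightarrow> \<phi> \<in> coord_lip n"
  unfolding coord_lip_def by blast

lemma coord_lip_subset_Cl_Lip: "coord_lip n \<subseteq> Cl_Lip n"
proof
  fix \<phi> :: "(nat \<Rightarrow> real) \<Rightarrow> real" assume "\<phi> \<in> coord_lip n"
  then obtain K where K: "0 \<le> K" "\<And>x y. \<bar>\<phi> x - \<phi> y\<bar> \<le> K * (\<Sum>i<n. \<bar>x i - y i\<bar>)"
    unfolding coord_lip_def by blast
  show "\<phi> \<in> Cl_Lip n"
    unfolding Cl_Lip_def
  \<comment> \<open>With exponent 0 the growth factor of \<open>Cl_Lip\<close> is the constant 3;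
    the summand 1 only makes the constant strictly positive.\<close>
  proof (intro CollectI exI[of _ "K * n + 1"] exI[of _ 0] conjI allI)
    show "0 < K * n + 1" using K(1) by (simp add: add_nonneg_pos)
    fix x y :: "nat \<Rightarrow> real"
    let ?L = "L2_set (\<lambda>i. x i - y i) {..<n}"
    have "\<bar>x i - y i\<bar> \<le> ?L" if "i < n" for i
      using member_le_L2_set[of "{..<n}" i "\<lambda>i. \<bar>x i - y i\<bar>"] that by (simp add: L2_set_def)
    then have "(\<Sum>i<n. \<bar>x i - y i\<bar>) \<le> n * ?L"
      using sum_bounded_above[of "{..<n}" "\<lambda>i. \<bar>x i - y i\<bar>" ?L] by simp
    then have "K * (\<Sum>i<n. \<bar>x i - y i\<bar>) \<le> K * (n * ?L)" using K(1) by (intro mult_left_mono)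
    also have "\<dots> \<le> ((K * n + 1) * 3) * ?L"
      unfolding mult.assoc[symmetric] using K(1) by (intro mult_right_mono) (auto simp: L2_set_nonneg)
    finally show "\<bar>\<phi> x - \<phi> y\<bar> \<le> (K * n + 1) * (1 + L2_set x {..<n} ^ 0 + L2_set y {..<n} ^ 0) * ?L"
      using K(2)[of x y] by simp
  qed
qed

lemma coord_lip_cong:
  assumes "\<phi> \<in> coord_lip n" "\<And>i. i < n \<Longrightarrow> x i = y i"
  shows "\<phi> x = \<phi> y"
proof -
  obtain K where "0 \<le> K" "\<And>x y. \<bar>\<phi> x - \<phi> y\<bar> \<le> K * (\<Sum>i<n. \<bar>x i - y i\<bar>)"
    using assms(1) unfolding coord_lip_def by blast
  from this(2)[of x y] show ?thesis using assms(2) by simp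
qed

lemma coord_lip_mono:
  assumes "\<phi> \<in> coord_lip m" "m \<le> n" shows "\<phi> \<in> coord_lip n"
proof -
  obtain K where K: "0 \<le> K" "\<And>x y. \<bar>\<phi> x - \<phi> y\<bar> \<le> K * (\<Sum>i<m. \<bar>x i - y i\<bar>)"
    using assms(1) unfolding coord_lip_def by blast
  have "(\<Sum>i<m. \<bar>x i - y i\<bar>) \<le> (\<Sum>i<n. \<bar>x i - y i\<bar>)" for x y :: "nat \<Rightarrow> real"
    using assms(2) by (intro sum_mono2) auto
  then show ?thesis using K by (intro coord_lipI[of K] order_trans[OF K(2) mult_left_mono]) auto
qed

lemma coord_lip_const: "(\<lambda>_. c) \<in> coord_lip n"
  by (rule coord_lipI[of 0]) auto

lemma coord_lip_add:
  assumes "\<phi> \<in> coord_lip n" "\<psi> \<in> coord_lip n" shows "(\<lambda>x. \<phi> x + \<psi> x) \<in> coord_lip n"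
proof -
  obtain K where K: "0 \<le> K" "\<And>x y. \<bar>\<phi> x - \<phi> y\<bar> \<le> K * (\<Sum>i<n. \<bar>x i - y i\<bar>)"
    using assms(1) unfolding coord_lip_def by blast
  obtain L where L: "0 \<le> L" "\<And>x y. \<bar>\<psi> x - \<psi> y\<bar> \<le> L * (\<Sum>i<n. \<bar>x i - y i\<bar>)"
    using assms(2) unfolding coord_lip_def by blast
  show ?thesis
  proof (rule coord_lipI[of "K + L"])
    fix x y show "\<bar>\<phi> x + \<psi> x - (\<phi> y + \<psi> y)\<bar> \<le> (K + L) * (\<Sum>i<n. \<bar>x i - y i\<bar>)"
      using K(2)[of x y] L(2)[of x y] by (simp add: distrib_right)
  qed (use K L in auto)
qed

lemma coord_lip_compose:
  fixes f :: "real \<Rightarrow> real"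
  assumes "\<phi> \<in> coord_lip n" "0 \<le> C" "\<And>x y. \<bar>f (\<phi> x) - f (\<phi> y)\<bar> \<le> C * \<bar>\<phi> x - \<phi> y\<bar>"
  shows "(\<lambda>x. f (\<phi> x)) \<in> coord_lip n"
proof -
  obtain K where K: "0 \<le> K" "\<And>x y. \<bar>\<phi> x - \<phi> y\<bar> \<le> K * (\<Sum>i<n. \<bar>x i - y i\<bar>)"
    using assms(1) unfolding coord_lip_def by blast
  show ?thesis
  proof (rule coord_lipI[of "C * K"])
    fix x y
    have "C * \<bar>\<phi> x - \<phi> y\<bar> \<le> C * (K * (\<Sum>i<n. \<bar>x i - y i\<bar>))"
      using K assms(2) by (intro mult_left_mono) auto
    then show "\<bar>f (\<phi> x) - f (\<phi> y)\<bar> \<le> C * K * (\<Sum>i<n. \<bar>x i - y i\<bar>)"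
      using assms(3)[of x y] by (simp add: mult.assoc)
  qed (use K assms in auto)
qed

lemma coord_lip_coord: "i < n \<Longrightarrow> (\<lambda>x. x i) \<in> coord_lip n"
  by (rule coord_lipI[of 1]) (auto intro: member_le_sum)

lemma coord_lip_abs: "\<phi> \<in> coord_lip n \<Longrightarrow> (\<lambda>x. \<bar>\<phi> x\<bar>) \<in> coord_lip n"
  by (rule coord_lip_compose[of _ _ 1]) auto

lemma coord_lip_sum: "(\<And>i. i \<in> I \<Longrightarrow> \<phi> i \<in> coord_lip n) \<Longrightarrow> (\<lambda>x. \<Sum>i\<in>I. \<phi> i x) \<in> coord_lip n"
proof (induction I rule: infinite_finite_induct)
  case (insert j I)
  have "(\<lambda>x. \<phi> j x + (\<Sum>i\<in>I. \<phi> i x)) \<in> coord_lip n"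
    by (rule coord_lip_add) (use insert in auto)
  then show ?case using insert(1,2) by simp
qed (simp_all add: coord_lip_const)

lemma bounded_lip_coord_lip: "\<phi> \<in> bounded_lip n \<Longrightarrow> \<phi> \<in> coord_lip n"
  by (simp add: bounded_lip_def)

lemma bounded_lipI: "\<phi> \<in> coord_lip n \<Longrightarrow> (\<And>x. \<bar>\<phi> x\<bar> \<le> B) \<Longrightarrow> \<phi> \<in> bounded_lip n"
  unfolding bounded_lip_def by blast

lemma bounded_lipE:
  assumes "\<phi> \<in> bounded_lip n" obtains B where "0 \<le> B" "\<And>x. \<bar>\<phi> x\<bar> \<le> B"
proof -
  obtain B where B: "\<And>x. \<bar>\<phi> x\<bar> \<le> B" using assms unfolding bounded_lip_def by blast
  have "0 \<le> B" by (rule order_trans[OF abs_ge_zero B])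
  then show thesis using that B by blast
qed

lemma bounded_lip_mono: "\<phi> \<in> bounded_lip m \<Longrightarrow> m \<le> n \<Longrightarrow> \<phi> \<in> bounded_lip n"
  unfolding bounded_lip_def using coord_lip_mono by blast

lemma bounded_lip_const: "(\<lambda>_. c) \<in> bounded_lip n"
  by (rule bounded_lipI[OF coord_lip_const, of _ "\<bar>c\<bar>"]) simp

lemma bounded_lip_add:
  assumes "\<phi> \<in> bounded_lip n" "\<psi> \<in> bounded_lip n" shows "(\<lambda>x. \<phi> x + \<psi> x) \<in> bounded_lip n"
proof -
  obtain B where B: "\<And>x. \<bar>\<phi> x\<bar> \<le> B" using assms(1) by (rule bounded_lipE) blast
  obtain D where D: "\<And>x. \<bar>\<psi> x\<bar> \<le> D" using assms(2) by (rule bounded_lipE) blast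
  have "\<bar>\<phi> x + \<psi> x\<bar> \<le> B + D" for x using B[of x] D[of x] by linarith
  then show ?thesis using assms by (intro bounded_lipI[OF coord_lip_add] bounded_lip_coord_lip)
qed

lemma bounded_lip_mult:
  assumes "\<phi> \<in> bounded_lip n" "\<psi> \<in> bounded_lip n" shows "(\<lambda>x. \<phi> x * \<psi> x) \<in> bounded_lip n"
proof -
  obtain B where B: "0 \<le> B" "\<And>x. \<bar>\<phi> x\<bar> \<le> B" using assms(1) by (rule bounded_lipE) blast
  obtain D where D: "0 \<le> D" "\<And>x. \<bar>\<psi> x\<bar> \<le> D" using assms(2) by (rule bounded_lipE) blast
  obtain K where K: "0 \<le> K" "\<And>x y. \<bar>\<phi> x - \<phi> y\<bar> \<le> K * (\<Sum>i<n. \<bar>x i - y i\<bar>)"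
    using bounded_lip_coord_lip[OF assms(1)] unfolding coord_lip_def by blast
  obtain L where L: "0 \<le> L" "\<And>x y. \<bar>\<psi> x - \<psi> y\<bar> \<le> L * (\<Sum>i<n. \<bar>x i - y i\<bar>)"
    using bounded_lip_coord_lip[OF assms(2)] unfolding coord_lip_def by blast
  show ?thesis
  proof (rule bounded_lipI[OF coord_lipI[of "B * L + K * D"]])
    fix x y :: "nat \<Rightarrow> real"
    let ?S = "\<Sum>i<n. \<bar>x i - y i\<bar>"
    have "\<phi> x * \<psi> x - \<phi> y * \<psi> y = \<phi> x * (\<psi> x - \<psi> y) + (\<phi> x - \<phi> y) * \<psi> y" by (simp add: algebra_simps)
    then have "\<bar>\<phi> x * \<psi> x - \<phi> y * \<psi> y\<bar> \<le> \<bar>\<phi> x\<bar> * \<bar>\<psi> x - \<psi> y\<bar> + \<bar>\<phi> x - \<phi> y\<bar> * \<bar>\<psi> y\<bar>"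
      by (metis abs_mult abs_triangle_ineq)
    also have "\<dots> \<le> B * (L * ?S) + (K * ?S) * D"
      using B D K L by (intro add_mono mult_mono) (auto intro!: mult_nonneg_nonneg sum_nonneg)
    finally show "\<bar>\<phi> x * \<psi> x - \<phi> y * \<psi> y\<bar> \<le> (B * L + K * D) * ?S" by (simp add: algebra_simps)
  next
    fix x show "\<bar>\<phi> x * \<psi> x\<bar> \<le> B * D" using B D by (simp add: abs_mult mult_mono)
  qed (use B D K L in auto)
qed

lemma bounded_lip_prod: "(\<And>i. i \<in> I \<Longrightarrow> \<phi> i \<in> bounded_lip n) \<Longrightarrow> (\<lambda>x. \<Prod>i\<in>I. \<phi> i x) \<in> bounded_lip n"
proof (induction I rule: infinite_finite_induct)
  case (insert j I)
  have "(\<lambda>x. \<phi> j x * (\<Prod>i\<in>I. \<phi> i x)) \<in> bounded_lip n"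
    by (rule bounded_lip_mult) (use insert in auto)
  then show ?case using insert(1,2) by simp
qed (simp_all add: bounded_lip_const)

lemma bounded_lip_sum: "(\<And>i. i \<in> I \<Longrightarrow> \<phi> i \<in> bounded_lip n) \<Longrightarrow> (\<lambda>x. \<Sum>i\<in>I. \<phi> i x) \<in> bounded_lip n"
proof (induction I rule: infinite_finite_induct)
  case (insert j I)
  have "(\<lambda>x. \<phi> j x + (\<Sum>i\<in>I. \<phi> i x)) \<in> bounded_lip n"
    by (rule bounded_lip_add) (use insert in auto)
  then show ?case using insert(1,2) by simp
qed (simp_all add: bounded_lip_const)

lemma bounded_lip_compose:
  assumes "\<phi> \<in> coord_lip n" "0 \<le> C" "\<And>x y. \<bar>f (\<phi> x) - f (\<phi> y)\<bar> \<le> C * \<bar>\<phi> x - \<phi> y\<bar>" "\<And>x. \<bar>f (\<phi> x)\<bar> \<le> B"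
  shows "(\<lambda>x. f (\<phi> x)) \<in> bounded_lip n"
  by (rule bounded_lipI[OF coord_lip_compose[of _ _ C]]) (use assms in auto)

lemma bounded_lip_uminus: "\<phi> \<in> bounded_lip n \<Longrightarrow> (\<lambda>x. - \<phi> x) \<in> bounded_lip n"
  using bounded_lip_mult[OF bounded_lip_const[of "-1"]] by simp

text \<open>The cap at \<open>y\<close> keeps the derivative t e^(t u) below t e^(t y), so the
  exponential becomes globally Lipschitz.\<close>

lemma exp_min_lipschitz:
  fixes t y :: real assumes "0 \<le> t"
  shows "\<bar>exp (t * min a y) - exp (t * min b y)\<bar> \<le> t * exp (t * y) * \<bar>a - b\<bar>"
proof -
  have *: "\<bar>exp (t * min a y) - exp (t * min b y)\<bar> \<le> t * exp (t * y) * \<bar>a - b\<bar>" if "b \<le> a" for a b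
  proof -
    let ?a = "t * min a y" and ?b = "t * min b y"
    have ba: "?b \<le> ?a" using that assms by (intro mult_left_mono) auto
    have "1 - exp (?b - ?a) \<le> ?a - ?b" using exp_ge_add_one_self[of "?b - ?a"] by linarith
    then have "exp ?a * (1 - exp (?b - ?a)) \<le> exp ?a * (?a - ?b)" by (rule mult_left_mono) simp
    also have "\<dots> \<le> exp (t * y) * (t * (a - b))"
    proof (intro mult_mono)
      have "t * (min a y - min b y) \<le> t * (a - b)" using that assms by (intro mult_left_mono) auto
      then show "?a - ?b \<le> t * (a - b)" by (simp add: algebra_simps)
      show "exp ?a \<le> exp (t * y)" using assms by (simp add: mult_left_mono)
    qed (use ba in auto)
    finally have "exp ?a - exp ?b \<le> exp (t * y) * (t * (a - b))"
      by (simp add: right_diff_distrib flip: exp_add)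
    moreover have "exp ?b \<le> exp ?a" using ba by simp
    ultimately show ?thesis using that by (simp add: mult_ac)
  qed
  show ?thesis
  proof (cases "b \<le> a")
    case False
    then show ?thesis using *[of a b]
      unfolding abs_minus_commute[of "exp (t * min b y)"] abs_minus_commute[of b a] by simp
  qed (rule *)
qed

text \<open>Needed to place the p-th powers of positive parts in \<open>H\<close>. The mean value
  theorem is applied between the positive parts; its factor z^(p - 1) is at most 1 for z <= 1, and
  beyond that it is raised to a natural exponent, the only kind that \<open>Cl_Lip\<close>
  admits.\<close>

lemma powr_pos_part_lipschitz:
  fixes p a b :: real assumes p: "1 \<le> p"
  shows "\<bar>max a 0 powr p - max b 0 powr p\<bar> \<le> p * (1 + \<bar>a\<bar> ^ nat \<lceil>p\<rceil> + \<bar>b\<bar> ^ nat \<lceil>p\<rceil>) * \<bar>a - b\<bar>"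
proof -
  have *: "\<bar>max a 0 powr p - max b 0 powr p\<bar> \<le> p * (1 + \<bar>a\<bar> ^ nat \<lceil>p\<rceil> + \<bar>b\<bar> ^ nat \<lceil>p\<rceil>) * \<bar>a - b\<bar>"
    if ba: "b \<le> a" for a b
  proof (cases "max b 0 < max a 0")
    case True
    have "continuous_on {max b 0..max a 0} (\<lambda>x. x powr p)"
      using p by (intro continuous_on_powr' continuous_on_id continuous_on_const) auto
    then obtain l z where z: "max b 0 < z" "z < max a 0" "((\<lambda>x. x powr p) has_real_derivative l) (at z)"
        "max a 0 powr p - max b 0 powr p = (max a 0 - max b 0) * l"
    proof -
      have "(\<lambda>x. x powr p) differentiable (at z)" if "max b 0 < z" for z
      proof -
        have "0 < z" using that by simp
        from has_real_derivative_powr[OF this, of p] show ?thesis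
          unfolding real_differentiable_def by blast
      qed
      with MVT[OF True \<open>continuous_on _ _\<close>] show thesis using that by blast
    qed
    have z0: "0 < z" using z(1) by simp
    have "l = p * z powr (p - 1)"
      using DERIV_unique[OF z(3) has_real_derivative_powr[OF z0]] .
    moreover have "z powr (p - 1) \<le> 1 + \<bar>a\<bar> ^ nat \<lceil>p\<rceil>"
    proof (cases "z \<le> 1")
      case True
      then have "z powr (p - 1) \<le> 1" using z0 p by (intro powr_le1) auto
      then show ?thesis by (simp add: add_increasing2)
    next
      case False
      then have "z powr (p - 1) \<le> z powr real (nat \<lceil>p\<rceil>)"
        using real_nat_ceiling_ge[of p] by (intro powr_mono) linarith+
      also have "\<dots> = z ^ nat \<lceil>p\<rceil>" using z0 by (rule powr_realpow)
      also have "\<dots> \<le> \<bar>a\<bar> ^ nat \<lceil>p\<rceil>" using z z0 by (intro power_mono) auto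
      finally show ?thesis by simp
    qed
    ultimately have "l \<le> p * (1 + \<bar>a\<bar> ^ nat \<lceil>p\<rceil> + \<bar>b\<bar> ^ nat \<lceil>p\<rceil>)"
    proof -
      assume l: "l = p * z powr (p - 1)" and "z powr (p - 1) \<le> 1 + \<bar>a\<bar> ^ nat \<lceil>p\<rceil>"
      then have "z powr (p - 1) \<le> 1 + \<bar>a\<bar> ^ nat \<lceil>p\<rceil> + \<bar>b\<bar> ^ nat \<lceil>p\<rceil>" by (simp add: add_increasing2)
      then show ?thesis unfolding l using p by (intro mult_left_mono) auto
    qed
    moreover have "0 \<le> l" using \<open>l = _\<close> p by simp
    ultimately have "(max a 0 - max b 0) * l \<le> \<bar>a - b\<bar> * (p * (1 + \<bar>a\<bar> ^ nat \<lceil>p\<rceil> + \<bar>b\<bar> ^ nat \<lceil>p\<rceil>))"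
      by - (rule mult_mono, use ba True p in auto)
    moreover have "0 \<le> (max a 0 - max b 0) * l" using \<open>0 \<le> l\<close> True by simp
    ultimately show ?thesis
      unfolding z(4) mult.commute[of "p * _" "\<bar>a - b\<bar>"] by linarith
  next
    case False
    then have "max b 0 = max a 0" using ba by linarith
    then show ?thesis using p by simp
  qed
  show ?thesis
  proof (cases "b \<le> a")
    case False
    then have "\<bar>max b 0 powr p - max a 0 powr p\<bar> \<le> p * (1 + \<bar>b\<bar> ^ nat \<lceil>p\<rceil> + \<bar>a\<bar> ^ nat \<lceil>p\<rceil>) * \<bar>b - a\<bar>"
      by (intro *) simp
    then show ?thesis
      unfolding abs_minus_commute[of "max b 0 powr p"] abs_minus_commute[of b a]
      by (simp only: add.commute add.left_commute)
  qed (rule *)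
qed

section \<open>Calculus of sub-linear expectations\<close>

context sublinear_expectation_space
begin

lemma H_coord_lip:
  "\<phi> \<in> coord_lip n \<Longrightarrow> (\<And>i. i < n \<Longrightarrow> Z i \<in> H) \<Longrightarrow> (\<lambda>\<omega>. \<phi> (\<lambda>i. Z i \<omega>)) \<in> H"
  using H_closed coord_lip_subset_Cl_Lip by blast

lemma H_locally_lip:
  assumes "X \<in> H" "0 < C" "\<And>a b. \<bar>f a - f b\<bar> \<le> C * (1 + \<bar>a\<bar> ^ m + \<bar>b\<bar> ^ m) * \<bar>a - b\<bar>"
  shows "(\<lambda>\<omega>. f (X \<omega>)) \<in> H"
proof -
  have L: "L2_set x {..<Suc 0} = \<bar>x 0\<bar>" for x by (simp add: L2_set_def)
  have "(\<lambda>x. f (x 0)) \<in> Cl_Lip (Suc 0)"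
    unfolding Cl_Lip_def L using assms(2,3) by blast
  from H_closed[OF this, of "\<lambda>_. X"] show ?thesis using assms(1) by simp
qed

lemma H_lip:
  assumes "X \<in> H" "0 \<le> C" "\<And>a b. \<bar>f a - f b\<bar> \<le> C * \<bar>a - b\<bar>"
  shows "(\<lambda>\<omega>. f (X \<omega>)) \<in> H"
proof -
  have "(\<lambda>x. f (x 0)) \<in> coord_lip 1"
    using assms(2,3) by (intro coord_lip_compose[OF coord_lip_coord, of _ _ C]) auto
  from H_coord_lip[OF this, of "\<lambda>_. X"] show ?thesis using assms(1) by simp
qed

lemma H_const: "(\<lambda>_. c) \<in> H"
  using H_coord_lip[OF coord_lip_const[of c 0], of "\<lambda>_ _. 0"] by simp

lemma H_uminus: "X \<in> H \<Longrightarrow> (\<lambda>\<omega>. - X \<omega>) \<in> H"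
  using H_scale[of X "-1"] by simp

lemma H_abs: "X \<in> H \<Longrightarrow> (\<lambda>\<omega>. \<bar>X \<omega>\<bar>) \<in> H"
  by (rule H_lip[of _ 1]) auto

lemma H_sum: "(\<And>i. i \<in> I \<Longrightarrow> X i \<in> H) \<Longrightarrow> (\<lambda>\<omega>. \<Sum>i\<in>I. X i \<omega>) \<in> H"
  by (induction I rule: infinite_finite_induct) (auto intro: H_zero H_add)

lemma H_min: "X \<in> H \<Longrightarrow> (\<lambda>\<omega>. min (X \<omega>) c) \<in> H"
  by (rule H_lip[of _ 1]) auto

lemma H_exp_min: "X \<in> H \<Longrightarrow> 0 \<le> t \<Longrightarrow> (\<lambda>\<omega>. exp (t * min (X \<omega>) c)) \<in> H"
  by (rule H_lip[of _ "t * exp (t * c)"]) (auto intro: exp_min_lipschitz)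

lemma H_square:
  assumes "X \<in> H" shows "(\<lambda>\<omega>. (X \<omega>)\<^sup>2) \<in> H"
proof (rule H_locally_lip[of X 1 "\<lambda>a. a\<^sup>2" 1])
  fix a b :: real
  have "\<bar>a\<^sup>2 - b\<^sup>2\<bar> = \<bar>a + b\<bar> * \<bar>a - b\<bar>" by (simp add: power2_eq_square abs_mult[symmetric] algebra_simps)
  also have "\<dots> \<le> (1 + \<bar>a\<bar> + \<bar>b\<bar>) * \<bar>a - b\<bar>" by (intro mult_right_mono) auto
  finally show "\<bar>a\<^sup>2 - b\<^sup>2\<bar> \<le> 1 * (1 + \<bar>a\<bar> ^ 1 + \<bar>b\<bar> ^ 1) * \<bar>a - b\<bar>" by simp
qed (use assms in auto)

lemma H_powr_pos_part: "X \<in> H \<Longrightarrow> 1 \<le> p \<Longrightarrow> (\<lambda>\<omega>. max (X \<omega>) 0 powr p) \<in> H"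
  using powr_pos_part_lipschitz[of p] by (intro H_locally_lip[of X p "\<lambda>a. max a 0 powr p" "nat \<lceil>p\<rceil>"]) auto

lemma E_add_const:
  assumes "X \<in> H" shows "E (\<lambda>\<omega>. X \<omega> + c) = E X + ereal c"
proof (rule antisym)
  show "E (\<lambda>\<omega>. X \<omega> + c) \<le> E X + ereal c"
    using E_subadd[OF assms H_const[of c]] by (simp add: E_const)
  have "E (\<lambda>\<omega>. (X \<omega> + c) + - c) \<le> E (\<lambda>\<omega>. X \<omega> + c) + ereal (- c)"
    using E_subadd[OF H_add[OF assms H_const[of c]] H_const[of "- c"]] by (simp add: E_const)
  then have "E X + ereal c \<le> (E (\<lambda>\<omega>. X \<omega> + c) + ereal (- c)) + ereal c"
    by (intro add_right_mono) simp
  then show "E X + ereal c \<le> E (\<lambda>\<omega>. X \<omega> + c)" by (simp add: add.assoc)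
qed

lemma E_nonneg:
  assumes "X \<in> H" "\<And>\<omega>. \<omega> \<in> space M \<Longrightarrow> 0 \<le> X \<omega>" shows "0 \<le> E X"
  using E_mono[OF assms(1) H_zero assms(2)] E_const[of 0] by (simp add: zero_ereal_def)

text \<open>The upper bound is monotonicity. For the lower one, subadditivity on 0 = |X| + (-|X|)
  excludes E (-|X|) = -\<infinity>.\<close>

lemma E_finite:
  assumes X: "X \<in> H" and f: "E (\<lambda>\<omega>. \<bar>X \<omega>\<bar>) < \<infinity>"
  shows "\<bar>E X\<bar> \<noteq> \<infinity>"
proof -
  have a: "0 \<le> E (\<lambda>\<omega>. \<bar>X \<omega>\<bar>)"
    using X by (intro E_nonneg H_abs) auto
  have u: "E X \<le> E (\<lambda>\<omega>. \<bar>X \<omega>\<bar>)" using X by (intro E_mono H_abs) auto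
  have l: "E (\<lambda>\<omega>. - \<bar>X \<omega>\<bar>) \<le> E X" using X by (intro E_mono H_abs H_uminus) auto
  have "E (\<lambda>\<omega>. \<bar>X \<omega>\<bar> + - \<bar>X \<omega>\<bar>) \<le> E (\<lambda>\<omega>. \<bar>X \<omega>\<bar>) + E (\<lambda>\<omega>. - \<bar>X \<omega>\<bar>)"
    using a f u l X by (intro E_subadd H_abs H_uminus) auto
  then have "0 \<le> E (\<lambda>\<omega>. \<bar>X \<omega>\<bar>) + E (\<lambda>\<omega>. - \<bar>X \<omega>\<bar>)" using E_const[of 0] by (simp add: zero_ereal_def)
  then have "E (\<lambda>\<omega>. - \<bar>X \<omega>\<bar>) \<noteq> - \<infinity>" using f a by (cases "E (\<lambda>\<omega>. \<bar>X \<omega>\<bar>)") auto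
  then show ?thesis using u l f by auto
qed

lemma E_finite_bounded:
  assumes X: "X \<in> H" and f: "\<And>\<omega>. \<omega> \<in> space M \<Longrightarrow> \<bar>X \<omega>\<bar> \<le> B"
  shows "\<bar>E X\<bar> \<noteq> \<infinity>" "\<bar>conj_exp E X\<bar> \<noteq> \<infinity>"
proof -
  have "E (\<lambda>\<omega>. \<bar>X \<omega>\<bar>) \<le> ereal B"
    using E_mono[OF H_const[of B] H_abs[OF X]] f by (simp add: E_const)
  then have f: "E (\<lambda>\<omega>. \<bar>X \<omega>\<bar>) < \<infinity>" by auto
  show "\<bar>E X\<bar> \<noteq> \<infinity>" using E_finite[OF X f] .
  show "\<bar>conj_exp E X\<bar> \<noteq> \<infinity>" using E_finite[OF H_uminus[OF X]] f by (simp add: conj_exp_def)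
qed

lemma E_affine:
  assumes X: "X \<in> H" and f: "\<bar>E X\<bar> \<noteq> \<infinity>" and b: "0 \<le> b"
  shows "E (\<lambda>\<omega>. a + b * X \<omega>) = ereal (a + b * real_of_ereal (E X))"
proof -
  have "E (\<lambda>\<omega>. b * X \<omega> + a) = ereal b * E X + ereal a"
    using X b by (simp add: E_add_const H_scale E_pos_homog)
  moreover have "(\<lambda>\<omega>. b * X \<omega> + a) = (\<lambda>\<omega>. a + b * X \<omega>)" by (simp add: add.commute)
  ultimately show ?thesis using f by (cases "E X") (auto simp: add.commute)
qed

lemma conj_exp_affine:
  assumes X: "X \<in> H" and f: "\<bar>conj_exp E X\<bar> \<noteq> \<infinity>" and b: "0 \<le> b"
  shows "conj_exp E (\<lambda>\<omega>. a + b * X \<omega>) = ereal (a + b * real_of_ereal (conj_exp E X))"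
proof -
  have "E (\<lambda>\<omega>. - a + b * - X \<omega>) = ereal (- a + b * real_of_ereal (E (\<lambda>\<omega>. - X \<omega>)))"
    using f by (intro E_affine H_uminus X b) (simp add: conj_exp_def)
  then show ?thesis using f by (cases "E (\<lambda>\<omega>. - X \<omega>)") (auto simp: conj_exp_def)
qed

lemma conj_exp_mono:
  assumes "X \<in> H" "Y \<in> H" "\<And>\<omega>. \<omega> \<in> space M \<Longrightarrow> Y \<omega> \<le> X \<omega>"
  shows "conj_exp E Y \<le> conj_exp E X"
  unfolding conj_exp_def using assms by (auto intro!: E_mono H_uminus)

section \<open>Independence for Lipschitz test functions\<close>

text \<open>Being monotone and compatible with adding constants, \<open>E\<close> is a contraction
  for the sup norm: moving the parameters by an l1 distance r moves the section, hence its
  expectation, by at most K r. The inner functions required by \<open>indep_to\<close> are therefore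
  in \<open>H\<close>.\<close>

lemma E_coord_lip_section:
  assumes \<phi>: "\<phi> \<in> coord_lip (Suc k)" and Y: "Y \<in> H"
    and fin: "\<And>x. E (\<lambda>\<omega>. \<bar>\<phi> (x(k := Y \<omega>))\<bar>) < \<infinity>"
  shows "(\<lambda>\<omega>. \<phi> (x(k := Y \<omega>))) \<in> H"
    and "\<bar>E (\<lambda>\<omega>. \<phi> (x(k := Y \<omega>)))\<bar> \<noteq> \<infinity>"
    and "(\<lambda>x. real_of_ereal (E (\<lambda>\<omega>. \<phi> (x(k := Y \<omega>))))) \<in> coord_lip k"
proof -
  have H: "(\<lambda>\<omega>. \<phi> (x(k := Y \<omega>))) \<in> H" for x
  proof -
    have "(\<lambda>\<omega>. \<phi> (\<lambda>i. ((\<lambda>i _. x i)(k := Y)) i \<omega>)) \<in> H"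
      using Y by (intro H_coord_lip[OF \<phi>]) (auto intro: H_const)
    moreover have "(\<lambda>i. ((\<lambda>i _. x i)(k := Y)) i \<omega>) = x(k := Y \<omega>)" for \<omega> by auto
    ultimately show ?thesis by simp
  qed
  show "(\<lambda>\<omega>. \<phi> (x(k := Y \<omega>))) \<in> H" by (rule H)
  have f: "\<bar>E (\<lambda>\<omega>. \<phi> (x(k := Y \<omega>)))\<bar> \<noteq> \<infinity>" for x by (rule E_finite[OF H fin])
  show "\<bar>E (\<lambda>\<omega>. \<phi> (x(k := Y \<omega>)))\<bar> \<noteq> \<infinity>" by (rule f)
  obtain K where K: "0 \<le> K" "\<And>x y. \<bar>\<phi> x - \<phi> y\<bar> \<le> K * (\<Sum>i<Suc k. \<bar>x i - y i\<bar>)"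
    using \<phi> unfolding coord_lip_def by blast
  have le: "real_of_ereal (E (\<lambda>\<omega>. \<phi> (x(k := Y \<omega>)))) \<le> real_of_ereal (E (\<lambda>\<omega>. \<phi> (y(k := Y \<omega>)))) + K * (\<Sum>i<k. \<bar>x i - y i\<bar>)" for x y
  proof -
    have "\<phi> (x(k := Y \<omega>)) \<le> \<phi> (y(k := Y \<omega>)) + K * (\<Sum>i<k. \<bar>x i - y i\<bar>)" for \<omega>
      using K(2)[of "x(k := Y \<omega>)" "y(k := Y \<omega>)"] by simp
    then have "E (\<lambda>\<omega>. \<phi> (x(k := Y \<omega>))) \<le> E (\<lambda>\<omega>. \<phi> (y(k := Y \<omega>)) + K * (\<Sum>i<k. \<bar>x i - y i\<bar>))"
      using H by (intro E_mono H_add H_const) auto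
    also have "\<dots> = E (\<lambda>\<omega>. \<phi> (y(k := Y \<omega>))) + ereal (K * (\<Sum>i<k. \<bar>x i - y i\<bar>))" by (rule E_add_const[OF H])
    finally show ?thesis using f[of x] f[of y]
      by (cases "E (\<lambda>\<omega>. \<phi> (x(k := Y \<omega>)))"; cases "E (\<lambda>\<omega>. \<phi> (y(k := Y \<omega>)))") auto
  qed
  show "(\<lambda>x. real_of_ereal (E (\<lambda>\<omega>. \<phi> (x(k := Y \<omega>))))) \<in> coord_lip k"
  proof (rule coord_lipI[OF K(1)])
    fix x y
    show "\<bar>real_of_ereal (E (\<lambda>\<omega>. \<phi> (x(k := Y \<omega>)))) - real_of_ereal (E (\<lambda>\<omega>. \<phi> (y(k := Y \<omega>))))\<bar> \<le> K * (\<Sum>i<k. \<bar>x i - y i\<bar>)"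
      using le[of x y] le[of y x] by (simp add: abs_minus_commute abs_le_iff)
  qed
qed

text \<open>Of the conditions in \<open>indep_to\<close> only the two on finiteness remain as
  premises. Coordinates are shifted by one: index \<open>i\<close> stands for
  \<open>X (Suc i)\<close>.\<close>

lemma indep_seq_coord_lip:
  assumes ind: "indep_seq H E n X" and k: "k < n" and \<phi>: "\<phi> \<in> coord_lip (Suc k)"
    and fin: "\<And>x. E (\<lambda>\<omega>. \<bar>\<phi> (x(k := X (Suc k) \<omega>))\<bar>) < \<infinity>"
    and fin': "E (\<lambda>\<omega>. real_of_ereal (E (\<lambda>\<omega>'. \<bar>\<phi> ((\<lambda>i. X (Suc i) \<omega>)(k := X (Suc k) \<omega>'))\<bar>))) < \<infinity>"
  shows "E (\<lambda>\<omega>. \<phi> (\<lambda>i. X (Suc i) \<omega>)) =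
    E (\<lambda>\<omega>. real_of_ereal (E (\<lambda>\<omega>'. \<phi> ((\<lambda>i. X (Suc i) \<omega>)(k := X (Suc k) \<omega>')))))"
proof -
  have X: "X (Suc i) \<in> H" if "i < n" for i using ind that by (simp add: indep_seq_def)
  note sec = E_coord_lip_section[OF \<phi> X[OF k] fin]
  have abs: "(\<lambda>x. \<bar>\<phi> x\<bar>) \<in> coord_lip (Suc k)" using \<phi> by (rule coord_lip_abs)
  have fin_abs: "E (\<lambda>\<omega>. \<bar>\<bar>\<phi> (x(k := X (Suc k) \<omega>))\<bar>\<bar>) < \<infinity>" for x using fin by simp
  note sec_abs = E_coord_lip_section[OF abs X[OF k] fin_abs]
  have upd: "\<phi> (\<lambda>i. X (Suc i) \<omega>) = \<phi> ((\<lambda>i. X (Suc i) \<omega>)(k := X (Suc k) \<omega>))" for \<omega>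
    by (simp add: fun_upd_idem)
  show ?thesis
  \<comment> \<open>\<open>indep_seq\<close> states no independence for the first variable. For
    \<open>k = 0\<close> no outer coordinate is read, so the inner expectation is a constant and
    \<open>E_const\<close> suffices.\<close>
  proof (cases "k = 0")
    case True
    define e where "e = E (\<lambda>\<omega>'. \<phi> ((\<lambda>_. 0)(k := X (Suc k) \<omega>')))"
    have cong: "\<phi> ((\<lambda>i. X (Suc i) \<omega>)(k := X (Suc k) \<omega>')) = \<phi> ((\<lambda>_. 0)(k := X (Suc k) \<omega>'))" for \<omega> \<omega>'
      by (rule coord_lip_cong[OF \<phi>]) (simp add: True)
    have "E (\<lambda>\<omega>. \<phi> (\<lambda>i. X (Suc i) \<omega>)) = e"
      unfolding upd cong e_def ..
    also have "\<dots> = ereal (real_of_ereal e)"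
      using sec(2)[of "\<lambda>_. 0"] unfolding e_def[symmetric] by (simp add: ereal_real)
    also have "\<dots> = E (\<lambda>\<omega>. real_of_ereal e)" by (simp add: E_const)
    finally show ?thesis unfolding cong e_def .
  next
    case False
    then have "indep_to H E 1 (\<lambda>_. X (Suc k)) k (\<lambda>j. X (Suc j))"
      using ind k by (auto simp: indep_seq_def)
    moreover have "\<phi> \<in> Cl_Lip (k + 1)" using \<phi> coord_lip_subset_Cl_Lip by auto
    moreover have join: "\<phi> (join k x (\<lambda>_. y)) = \<phi> (x(k := y))" for x y
      by (rule coord_lip_cong[OF \<phi>]) (auto simp: join_def)
    ultimately have *: "(\<forall>x. E (\<lambda>\<omega>. \<bar>\<phi> (x(k := X (Suc k) \<omega>))\<bar>) < \<infinity>) \<Longrightarrow>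
       (\<lambda>\<omega>. real_of_ereal (E (\<lambda>\<omega>'. \<bar>\<phi> ((\<lambda>i. X (Suc i) \<omega>)(k := X (Suc k) \<omega>'))\<bar>))) \<in> H \<Longrightarrow>
       (\<lambda>\<omega>. real_of_ereal (E (\<lambda>\<omega>'. \<phi> ((\<lambda>i. X (Suc i) \<omega>)(k := X (Suc k) \<omega>'))))) \<in> H \<Longrightarrow>
       E (\<lambda>\<omega>. \<bar>real_of_ereal (E (\<lambda>\<omega>'. \<bar>\<phi> ((\<lambda>i. X (Suc i) \<omega>)(k := X (Suc k) \<omega>'))\<bar>))\<bar>) < \<infinity> \<Longrightarrow>
       ?thesis"
      unfolding indep_to_def Let_def by (auto simp: upd)
    have nn: "0 \<le> E (\<lambda>\<omega>'. \<bar>\<phi> (x(k := X (Suc k) \<omega>'))\<bar>)" for x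
      by (rule E_nonneg[OF sec_abs(1)]) simp
    show ?thesis
    proof (rule *)
      show "(\<lambda>\<omega>. real_of_ereal (E (\<lambda>\<omega>'. \<bar>\<phi> ((\<lambda>i. X (Suc i) \<omega>)(k := X (Suc k) \<omega>'))\<bar>))) \<in> H"
        by (rule H_coord_lip[OF sec_abs(3), of "\<lambda>i. X (Suc i)"]) (use X k in auto)
      show "(\<lambda>\<omega>. real_of_ereal (E (\<lambda>\<omega>'. \<phi> ((\<lambda>i. X (Suc i) \<omega>)(k := X (Suc k) \<omega>'))))) \<in> H"
        by (rule H_coord_lip[OF sec(3), of "\<lambda>i. X (Suc i)"]) (use X k in auto)
      show "\<forall>x. E (\<lambda>\<omega>. \<bar>\<phi> (x(k := X (Suc k) \<omega>))\<bar>) < \<infinity>" using fin by blast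
      show "E (\<lambda>\<omega>. \<bar>real_of_ereal (E (\<lambda>\<omega>'. \<bar>\<phi> ((\<lambda>i. X (Suc i) \<omega>)(k := X (Suc k) \<omega>'))\<bar>))\<bar>) < \<infinity>"
        unfolding abs_of_nonneg[OF real_of_ereal_pos[OF nn]] by (rule fin')
    qed
  qed
qed

text \<open>Boundedness supplies both finiteness premises, and the conjugate case is the case of
  \<open>E\<close> for \<open>- \<phi>\<close>.\<close>

lemma indep_seq_bounded_lip:
  assumes F: "F = E \<or> F = conj_exp E" and ind: "indep_seq H E n X" and k: "k < n"
    and \<phi>: "\<phi> \<in> bounded_lip (Suc k)"
  shows "F (\<lambda>\<omega>. \<phi> (\<lambda>i. X (Suc i) \<omega>)) =
    F (\<lambda>\<omega>. real_of_ereal (F (\<lambda>\<omega>'. \<phi> ((\<lambda>i. X (Suc i) \<omega>)(k := X (Suc k) \<omega>')))))"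
proof -
  have X: "X (Suc i) \<in> H" if "i < n" for i using ind that by (simp add: indep_seq_def)
  have *: "E (\<lambda>\<omega>. \<phi> (\<lambda>i. X (Suc i) \<omega>)) =
    E (\<lambda>\<omega>. real_of_ereal (E (\<lambda>\<omega>'. \<phi> ((\<lambda>i. X (Suc i) \<omega>)(k := X (Suc k) \<omega>')))))"
    if \<phi>: "\<phi> \<in> bounded_lip (Suc k)" for \<phi>
  proof -
    obtain B where B: "0 \<le> B" "\<And>x. \<bar>\<phi> x\<bar> \<le> B" using \<phi> by (rule bounded_lipE) blast
    have \<phi>a: "(\<lambda>x. \<bar>\<phi> x\<bar>) \<in> coord_lip (Suc k)" using \<phi> by (intro coord_lip_abs bounded_lip_coord_lip)
    have H: "(\<lambda>\<omega>. \<bar>\<phi> (x(k := X (Suc k) \<omega>))\<bar>) \<in> H" for x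
    proof -
      have "(\<lambda>\<omega>. \<bar>\<phi> (\<lambda>i. ((\<lambda>i _. x i)(k := X (Suc k))) i \<omega>)\<bar>) \<in> H"
        using X[OF k] by (intro H_coord_lip[OF \<phi>a]) (auto intro: H_const)
      moreover have "(\<lambda>i. ((\<lambda>i _. x i)(k := X (Suc k))) i \<omega>) = x(k := X (Suc k) \<omega>)" for \<omega> by auto
      ultimately show ?thesis by simp
    qed
    have le: "E (\<lambda>\<omega>. \<bar>\<phi> (x(k := X (Suc k) \<omega>))\<bar>) \<le> ereal B" for x
      using E_mono[OF H_const[of B] H[of x]] B(2) by (simp add: E_const)
    have fin: "E (\<lambda>\<omega>. \<bar>\<phi> (x(k := X (Suc k) \<omega>))\<bar>) < \<infinity>" for x
      using le[of x] by auto
    have fin_abs: "E (\<lambda>\<omega>. \<bar>\<bar>\<phi> (x(k := X (Suc k) \<omega>))\<bar>\<bar>) < \<infinity>" for x using fin by simp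
    note sec = E_coord_lip_section[OF \<phi>a X[OF k] fin_abs]
    let ?h = "\<lambda>\<omega>. real_of_ereal (E (\<lambda>\<omega>'. \<bar>\<phi> ((\<lambda>i. X (Suc i) \<omega>)(k := X (Suc k) \<omega>'))\<bar>))"
    have "?h \<in> H"
      by (rule H_coord_lip[OF sec(3), of "\<lambda>i. X (Suc i)"]) (use X k in auto)
    moreover have "real_of_ereal (E (\<lambda>\<omega>. \<bar>\<phi> (x(k := X (Suc k) \<omega>))\<bar>)) \<le> B" for x
    proof -
      define e where "e = E (\<lambda>\<omega>. \<bar>\<phi> (x(k := X (Suc k) \<omega>))\<bar>)"
      have "e \<le> ereal B" "\<bar>e\<bar> \<noteq> \<infinity>" unfolding e_def by (rule le, rule sec(2))
      then show ?thesis unfolding e_def[symmetric] by (cases e) auto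
    qed
    ultimately have "E ?h \<le> E (\<lambda>_. B)" by (intro E_mono[OF H_const])
    also have "\<dots> < \<infinity>" by (simp add: E_const)
    finally have "E ?h < \<infinity>" by auto
    then show ?thesis by (rule indep_seq_coord_lip[OF ind k bounded_lip_coord_lip[OF \<phi>] fin])
  qed
  from F show ?thesis
  proof
    assume "F = E" then show ?thesis using *[OF \<phi>] by simp
  next
    assume "F = conj_exp E"
    then show ?thesis using *[OF bounded_lip_uminus[OF \<phi>]] by (simp add: conj_exp_def)
  qed
qed

section \<open>Maximal inequality and exponential tail bound\<close>

text \<open>The premise on \<open>W\<close> is all that property (C) has to contribute here. It
  holds for \<open>V\<close> with \<open>E\<close> and for \<open>conj_cap M V\<close> with
  \<open>conj_exp E\<close>, so one argument serves both.\<close>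

lemma maximal_inequality:
  fixes g :: "nat \<Rightarrow> real \<Rightarrow> real"
  assumes F: "F = E \<or> F = conj_exp E" and ind: "indep_seq H E n X"
    and W: "\<And>A h. A \<in> sets M \<Longrightarrow> h \<in> H \<Longrightarrow>
      (\<And>\<omega>. \<omega> \<in> space M \<Longrightarrow> indicat_real A \<omega> \<le> h \<omega>) \<Longrightarrow> ereal (W A) \<le> F h"
    and lip: "\<And>i. i < n \<Longrightarrow> (\<lambda>x. g i (x i)) \<in> bounded_lip (Suc i)"
    and pos: "\<And>i u. 0 \<le> g i u"
    and le1: "\<And>i. i < n \<Longrightarrow> F (\<lambda>\<omega>. g i (X (Suc i) \<omega>)) \<le> 1"
    and a: "0 < a"
  defines "A \<equiv> {\<omega> \<in> space M. \<exists>k\<in>{1..n}. a \<le> (\<Prod>i<k. g i (X (Suc i) \<omega>))}"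
  shows "A \<in> sets M" "W A \<le> 1 / a"
proof -
  have X: "X (Suc i) \<in> H" if "i < n" for i using ind that by (simp add: indep_seq_def)
  define v where "v \<omega> = (\<lambda>i. X (Suc i) \<omega>)" for \<omega>
  have Hv: "(\<lambda>\<omega>. \<phi> (v \<omega>)) \<in> H" if "\<phi> \<in> bounded_lip k" "k \<le> n" for \<phi> k
    unfolding v_def using that X by (intro H_coord_lip[OF bounded_lip_coord_lip[OF that(1)]]) auto
  have fin: "\<bar>F (\<lambda>\<omega>. \<phi> (v \<omega>))\<bar> \<noteq> \<infinity>" if b: "\<phi> \<in> bounded_lip k" "k \<le> n" for \<phi> k
  proof -
    obtain B where "\<And>x. \<bar>\<phi> x\<bar> \<le> B" using bounded_lipE[OF b(1)] by blast
    then show ?thesis using E_finite_bounded[OF Hv[OF b], of B] F by auto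
  qed
  have affine: "F (\<lambda>\<omega>. b + c * Y \<omega>) = ereal (b + c * real_of_ereal (F Y))"
    if "Y \<in> H" "\<bar>F Y\<bar> \<noteq> \<infinity>" "0 \<le> c" for Y b c
    using F E_affine[of Y c b] conj_exp_affine[of Y c b] that by auto
  have Fmono: "F Y \<le> F Z" if "Y \<in> H" "Z \<in> H" "\<And>\<omega>. \<omega> \<in> space M \<Longrightarrow> Y \<omega> \<le> Z \<omega>" for Y Z
    using F E_mono[of Z Y] conj_exp_mono[of Z Y] that by auto
  define U where "U k x = (\<Prod>i<k. g i (x i))" for k and x :: "nat \<Rightarrow> real"
  have U_lip: "U k \<in> bounded_lip k" if "k \<le> n" for k
    unfolding U_def using that by (intro bounded_lip_prod) (auto intro: bounded_lip_mono[OF lip])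
  have U0: "0 \<le> U k x" for k x unfolding U_def using pos by (intro prod_nonneg) auto
  have A: "A = {\<omega> \<in> space M. \<exists>k\<in>{1..n}. a \<le> U k (v \<omega>)}" by (simp add: A_def U_def v_def)
  also have "\<dots> = (\<Union>k\<in>{1..n}. {\<omega> \<in> space M. a \<le> U k (v \<omega>)})" by auto
  also have "\<dots> \<in> sets M"
  proof (intro sets.finite_UN borel_measurable_le borel_measurable_const)
    fix k assume "k \<in> {1..n}"
    then show "(\<lambda>\<omega>. U k (v \<omega>)) \<in> borel_measurable M" using Hv[OF U_lip] by (intro H_measurable) auto
  qed simp
  finally show sets: "A \<in> sets M" .
  \<comment> \<open>A Lipschitz cutoff needs a gap c < a; the gap is closed at the end by letting c
    approach a.\<close>
  have bound: "W A \<le> 1 / c" if c: "0 < c" "c < a" for c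
  proof -
    define f where "f u = max 0 (min 1 ((u - c) / (a - c)))" for u
    have f: "0 \<le> f u" "f u \<le> 1" for u by (auto simp: f_def)
    have f1: "f u = 1" if "a \<le> u" for u using that c by (simp add: f_def)
    have fc: "0 \<le> f u * (u - c)" for u
    proof (cases "u \<le> c")
      case True
      then have "(u - c) / (a - c) \<le> 0" using c by (simp add: divide_le_0_iff)
      then show ?thesis by (simp add: f_def)
    qed (simp add: f)
    have f_lip: "\<bar>(1 - f u) - (1 - f w)\<bar> \<le> 1 / (a - c) * \<bar>u - w\<bar>" for u w
    proof -
      have "\<bar>f u - f w\<bar> \<le> \<bar>(u - c) / (a - c) - (w - c) / (a - c)\<bar>" by (simp add: f_def max_def min_def)
      also have "(u - c) / (a - c) - (w - c) / (a - c) = (u - w) / (a - c)" by (simp add: diff_divide_distrib)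
      also have "\<bar>\<dots>\<bar> = 1 / (a - c) * \<bar>u - w\<bar>" using c by (simp add: abs_divide)
      finally show ?thesis by (simp add: abs_minus_commute)
    qed
    \<comment> \<open>A smoothed indicator that none of U_1, ..., U_k has reached the level. U_0 = 1
      is left out, in accordance with the range of \<open>k\<close> in \<open>A\<close>, so the
      level may lie below 1.\<close>
    define \<eta> where "\<eta> k x = (\<Prod>i<k. 1 - f (U (Suc i) x))" for k x
    have \<eta>_lip: "\<eta> k \<in> bounded_lip k" if "k \<le> n" for k
      unfolding \<eta>_def
    proof (rule bounded_lip_prod)
      fix i assume "i \<in> {..<k}"
      then have i: "Suc i \<le> k" by simp
      have "(\<lambda>x. 1 - f (U (Suc i) x)) \<in> bounded_lip (Suc i)"
      proof (rule bounded_lip_compose[where f = "\<lambda>u. 1 - f u" and B = 1])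
        show "U (Suc i) \<in> coord_lip (Suc i)" using i that by (intro bounded_lip_coord_lip U_lip) simp
        show "0 \<le> 1 / (a - c)" using c by simp
        show "\<bar>1 - f (U (Suc i) x)\<bar> \<le> 1" for x using f[of "U (Suc i) x"] by simp
      qed (rule f_lip)
      then show "(\<lambda>x. 1 - f (U (Suc i) x)) \<in> bounded_lip k" by (rule bounded_lip_mono[OF _ i])
    qed
    have \<eta>: "0 \<le> \<eta> k x" "\<eta> k x \<le> 1" for k x
      unfolding \<eta>_def using f by (auto intro!: prod_nonneg prod_le_1)
    define R where "R k x = \<eta> k x * U k x" for k x
    have R_lip: "R k \<in> bounded_lip k" if "k \<le> n" for k
      unfolding R_def using that by (intro bounded_lip_mult \<eta>_lip U_lip)
    have R0: "0 \<le> R k x" for k x by (simp add: R_def \<eta> U0)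
    define Z where "Z k x = 1 + (\<Sum>i<k. R i x * (g i (x i) + - 1))" for k x
    have Z_lip: "Z k \<in> bounded_lip k" if "k \<le> n" for k
      unfolding Z_def
    proof (intro bounded_lip_add bounded_lip_const bounded_lip_sum bounded_lip_mult)
      fix i assume "i \<in> {..<k}"
      then have i: "i < k" "i < n" using that by auto
      then show "R i \<in> bounded_lip k" "(\<lambda>x. g i (x i)) \<in> bounded_lip k"
        by (auto intro: bounded_lip_mono[OF R_lip] bounded_lip_mono[OF lip])
    qed
    \<comment> \<open>Each new factor of \<open>\<eta>\<close> moves the weight
      \<open>\<eta> k x * f u\<close> from the value u to the value c. This only lowers the left
      side, because f(u) > 0 forces u > c.\<close>
    have Z_lower: "R k x + c * (1 - \<eta> k x) \<le> Z k x" for k x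
    proof (induction k)
      case 0 then show ?case by (simp add: R_def \<eta>_def U_def Z_def)
    next
      case (Suc k)
      let ?u = "U (Suc k) x"
      have "Z (Suc k) x = Z k x + (\<eta> k x * ?u - R k x)" by (simp add: Z_def R_def U_def algebra_simps)
      moreover have "R (Suc k) x + c * (1 - \<eta> (Suc k) x) = \<eta> k x * ?u + c * (1 - \<eta> k x) - \<eta> k x * (f ?u * (?u - c))"
        by (simp add: R_def \<eta>_def algebra_simps)
      moreover have "0 \<le> \<eta> k x * (f ?u * (?u - c))" using \<eta> fc by simp
      ultimately show ?case using Suc by linarith
    qed
    have ind_A: "c * indicat_real A \<omega> \<le> Z n (v \<omega>)" if "\<omega> \<in> space M" for \<omega>
    proof (cases "\<omega> \<in> A")
      case True
      then obtain k where k: "k \<in> {1..n}" "a \<le> U k (v \<omega>)" by (auto simp: A)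
      then obtain j where j: "k = Suc j" "j < n" by (cases k) auto
      then have "1 - f (U (Suc j) (v \<omega>)) = 0" using k f1 by simp
      then have "\<eta> n (v \<omega>) = 0" unfolding \<eta>_def using j by (intro prod_zero) auto
      then show ?thesis using Z_lower[of n "v \<omega>"] R0[of n "v \<omega>"] True by simp
    next
      case False
      have "0 \<le> R n (v \<omega>) + c * (1 - \<eta> n (v \<omega>))" using R0 \<eta> c by simp
      then show ?thesis using Z_lower[of n "v \<omega>"] False by simp
    qed
    have super: "F (\<lambda>\<omega>. Z k (v \<omega>)) \<le> 1" if "k \<le> n" for k
      using that
    proof (induction k)
      case 0
      have "F (\<lambda>_. 1) = 1" using F by (auto simp: conj_exp_def E_const one_ereal_def)
      then show ?case by (simp add: Z_def)
    next
      case (Suc k)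
      then have k: "k < n" by simp
      define G where "G = real_of_ereal (F (\<lambda>\<omega>. g k (X (Suc k) \<omega>)))"
      have gv: "(\<lambda>\<omega>. g k (X (Suc k) \<omega>)) = (\<lambda>\<omega>. (\<lambda>x. g k (x k)) (v \<omega>))" by (simp add: v_def)
      have gH: "(\<lambda>\<omega>. g k (X (Suc k) \<omega>)) \<in> H" and gfin: "\<bar>F (\<lambda>\<omega>. g k (X (Suc k) \<omega>))\<bar> \<noteq> \<infinity>"
        using Hv[OF lip[OF k]] fin[OF lip[OF k]] k unfolding gv by auto
      have G: "G \<le> 1" using le1[OF k] gfin unfolding G_def
        by (cases "F (\<lambda>\<omega>. g k (X (Suc k) \<omega>))") (auto simp: one_ereal_def)
      have upd: "Z k (x(k := y)) = Z k x" "R k (x(k := y)) = R k x" for x y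
        using k by (auto intro!: coord_lip_cong[OF bounded_lip_coord_lip[OF Z_lip]]
          coord_lip_cong[OF bounded_lip_coord_lip[OF R_lip]])
      \<comment> \<open>The slope \<open>R k x\<close> in front of \<open>g k y\<close> is
        nonnegative, which is what lets the sublinear (or superlinear) \<open>F\<close> be evaluated
        exactly by \<open>affine\<close>. Then G <= 1 gives the supermartingale step.\<close>
      have Zs: "Z (Suc k) (x(k := y)) = (Z k x - R k x) + R k x * g k y" for x y
      proof -
        have "Z (Suc k) (x(k := y)) = Z k (x(k := y)) + R k (x(k := y)) * (g k y + - 1)"
          by (simp add: Z_def)
        then show ?thesis unfolding upd by (simp add: algebra_simps)
      qed
      have "F (\<lambda>\<omega>. Z (Suc k) (v \<omega>)) = F (\<lambda>\<omega>. real_of_ereal (F (\<lambda>\<omega>'. Z (Suc k) ((v \<omega>)(k := X (Suc k) \<omega>')))))"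
        unfolding v_def by (rule indep_seq_bounded_lip[OF F ind k Z_lip[OF Suc.prems]])
      also have "\<dots> = F (\<lambda>\<omega>. (\<lambda>x. Z k x + R k x * (G - 1)) (v \<omega>))"
        unfolding Zs affine[OF gH gfin R0] by (simp add: G_def algebra_simps)
      also have "\<dots> \<le> F (\<lambda>\<omega>. Z k (v \<omega>))"
      proof (rule Fmono)
        show "(\<lambda>\<omega>. (\<lambda>x. Z k x + R k x * (G - 1)) (v \<omega>)) \<in> H"
          using k by (intro Hv[of _ k] bounded_lip_add bounded_lip_mult bounded_lip_const Z_lip R_lip) auto
        show "(\<lambda>\<omega>. Z k (v \<omega>)) \<in> H" using k by (intro Hv[of _ k] Z_lip) auto
        show "Z k (v \<omega>) + R k (v \<omega>) * (G - 1) \<le> Z k (v \<omega>)" for \<omega>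
          using G R0[of k "v \<omega>"] by (simp add: mult_nonneg_nonpos)
      qed
      finally show ?case using Suc.IH k by simp
    qed
    have "ereal (W A) \<le> F (\<lambda>\<omega>. 0 + 1 / c * Z n (v \<omega>))"
    proof (rule W[OF sets])
      show "(\<lambda>\<omega>. 0 + 1 / c * Z n (v \<omega>)) \<in> H" using H_scale[OF Hv[OF Z_lip], of n "1 / c"] by simp
      show "indicat_real A \<omega> \<le> 0 + 1 / c * Z n (v \<omega>)" if "\<omega> \<in> space M" for \<omega>
        using ind_A[OF that] c by (simp add: field_simps)
    qed
    also have "\<dots> = ereal (0 + 1 / c * real_of_ereal (F (\<lambda>\<omega>. Z n (v \<omega>))))"
      using c by (intro affine Hv[OF Z_lip] fin[OF Z_lip]) auto
    also have "\<dots> \<le> ereal (1 / c)"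
    proof -
      have "real_of_ereal (F (\<lambda>\<omega>. Z n (v \<omega>))) \<le> 1"
        using super[of n] fin[OF Z_lip, of n] by (cases "F (\<lambda>\<omega>. Z n (v \<omega>))") (auto simp: one_ereal_def)
      then show ?thesis using c by (simp add: divide_right_mono)
    qed
    finally show ?thesis by simp
  qed
  show "W A \<le> 1 / a"
  proof (rule ccontr)
    assume "\<not> W A \<le> 1 / a"
    then have w: "1 / a < W A" by simp
    then have w0: "0 < W A" using a by (meson divide_pos_pos less_trans zero_less_one)
    have "1 / W A < a" using w w0 a by (simp add: field_simps)
    then obtain c where c: "1 / W A < c" "c < a" using dense by blast
    have c0: "0 < c" using c(1) w0 by (meson divide_pos_pos less_trans zero_less_one)
    have "W A * c \<le> 1" using bound[OF c0 c(2)] c0 by (simp add: field_simps)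
    moreover have "1 < W A * c" using c(1) w0 by (simp add: field_simps)
    ultimately show False by simp
  qed
qed

text \<open>\<open>maximal_inequality\<close> is applied to the truncated exponentials divided by
  their bounds. Since the offsets \<open>c i\<close> are nonnegative, their partial sums may be
  replaced by the full sum, and one level \<open>a\<close> serves all k.\<close>

lemma exponential_tail_bound:
  assumes F: "F = E \<or> F = conj_exp E" and ind: "indep_seq H E n X"
    and W: "\<And>A h. A \<in> sets M \<Longrightarrow> h \<in> H \<Longrightarrow>
      (\<And>\<omega>. \<omega> \<in> space M \<Longrightarrow> indicat_real A \<omega> \<le> h \<omega>) \<Longrightarrow> ereal (W A) \<le> F h"
    and t: "0 < t" and c: "\<And>i. i \<in> {1..n} \<Longrightarrow> 0 \<le> c i"
    and mgf: "\<And>i. i \<in> {1..n} \<Longrightarrow> F (\<lambda>\<omega>. exp (t * min (X i \<omega>) y)) \<le> ereal (exp (t * m i + c i))"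
  obtains A where "A \<in> sets M" "W A \<le> exp (- t * x + (\<Sum>i=1..n. c i))"
    "{\<omega> \<in> space M. \<exists>k\<in>{1..n}. x \<le> (\<Sum>i=1..k. min (X i \<omega>) y - m i)} \<subseteq> A"
proof -
  have X: "X (Suc i) \<in> H" if "i < n" for i using ind that by (simp add: indep_seq_def)
  define g where "g i u = exp (- (t * m (Suc i) + c (Suc i))) * exp (t * min u y)" for i u
  define a where "a = exp (t * x - (\<Sum>i=1..n. c i))"
  define A where "A = {\<omega> \<in> space M. \<exists>k\<in>{1..n}. a \<le> (\<Prod>i<k. g i (X (Suc i) \<omega>))}"
  have eb: "\<bar>exp (t * min u y)\<bar> \<le> exp (t * y)" for u
    using t by (simp add: mult_left_mono)
  have lip: "(\<lambda>x. g i (x i)) \<in> bounded_lip (Suc i)" if "i < n" for i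
    unfolding g_def
  proof (intro bounded_lip_mult bounded_lip_const)
    show "(\<lambda>x. exp (t * min (x i) y)) \<in> bounded_lip (Suc i)"
      by (rule bounded_lip_compose[OF coord_lip_coord, where f = "\<lambda>u. exp (t * min u y)"
            and C = "t * exp (t * y)" and B = "exp (t * y)"])
        (use t eb exp_min_lipschitz[of t _ y] in auto)
  qed
  have le1: "F (\<lambda>\<omega>. g i (X (Suc i) \<omega>)) \<le> 1" if i: "i < n" for i
  proof -
    define Y where "Y \<omega> = exp (t * min (X (Suc i) \<omega>) y)" for \<omega>
    define K where "K = exp (- (t * m (Suc i) + c (Suc i)))"
    have Y: "Y \<in> H" unfolding Y_def using X[OF i] t by (intro H_exp_min) auto
    have fin: "\<bar>F Y\<bar> \<noteq> \<infinity>" using F E_finite_bounded[OF Y, of "exp (t * y)"] eb by (auto simp: Y_def)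
    have "F (\<lambda>\<omega>. 0 + K * Y \<omega>) = ereal (0 + K * real_of_ereal (F Y))"
      using F E_affine[OF Y, of K 0] conj_exp_affine[OF Y, of K 0] fin by (auto simp: K_def)
    also have "\<dots> \<le> 1"
    proof -
      have "real_of_ereal (F Y) \<le> exp (t * m (Suc i) + c (Suc i))"
        using mgf[of "Suc i"] i fin unfolding Y_def[symmetric] by (cases "F Y") auto
      then have "K * real_of_ereal (F Y) \<le> K * exp (t * m (Suc i) + c (Suc i))"
        by (rule mult_left_mono) (simp add: K_def)
      also have "\<dots> = 1" by (simp add: K_def flip: exp_add)
      finally show ?thesis by (simp add: one_ereal_def)
    qed
    finally show ?thesis by (simp add: g_def K_def Y_def)
  qed
  have pos: "0 \<le> g i u" for i u by (simp add: g_def)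
  have a0: "0 < a" by (simp add: a_def)
  have "A \<in> sets M"
    unfolding A_def by (rule maximal_inequality(1)[OF F ind _ lip pos le1 a0, of W]) (rule W)
  moreover have "W A \<le> 1 / a"
    unfolding A_def by (rule maximal_inequality(2)[OF F ind _ lip pos le1 a0]) (rule W)
  moreover have "1 / a = exp (- t * x + (\<Sum>i=1..n. c i))" by (simp add: a_def exp_diff exp_minus exp_add field_simps)
  moreover have "{\<omega> \<in> space M. \<exists>k\<in>{1..n}. x \<le> (\<Sum>i=1..k. min (X i \<omega>) y - m i)} \<subseteq> A"
  proof (safe)
    fix \<omega> k assume \<omega>: "\<omega> \<in> space M" and k: "k \<in> {1..n}" and le: "x \<le> (\<Sum>i=1..k. min (X i \<omega>) y - m i)"
    have "(\<Prod>i<k. g i (X (Suc i) \<omega>)) = exp (\<Sum>i<k. t * (min (X (Suc i) \<omega>) y - m (Suc i)) - c (Suc i))"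
      unfolding exp_sum[OF finite_lessThan] g_def
      by (intro prod.cong refl) (simp add: algebra_simps flip: exp_add)
    also have "(\<Sum>i<k. t * (min (X (Suc i) \<omega>) y - m (Suc i)) - c (Suc i)) =
        (\<Sum>i=1..k. t * (min (X i \<omega>) y - m i) - c i)"
      using sum.atLeast1_atMost_eq[of "\<lambda>i. t * (min (X i \<omega>) y - m i) - c i" k] by simp
    also have "\<dots> = t * (\<Sum>i=1..k. min (X i \<omega>) y - m i) - (\<Sum>i=1..k. c i)"
      by (subst sum_subtractf) (simp only: sum_distrib_left)
    finally have p: "(\<Prod>i<k. g i (X (Suc i) \<omega>)) = exp (t * (\<Sum>i=1..k. min (X i \<omega>) y - m i) - (\<Sum>i=1..k. c i))" .
    have "(\<Sum>i=1..k. c i) \<le> (\<Sum>i=1..n. c i)" using k c by (intro sum_mono2) auto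
    moreover have "t * x \<le> t * (\<Sum>i=1..k. min (X i \<omega>) y - m i)" using t le by (intro mult_left_mono) auto
    ultimately have "a \<le> (\<Prod>i<k. g i (X (Suc i) \<omega>))" unfolding p a_def by simp
    then show "\<omega> \<in> A" using \<omega> k by (auto simp: A_def)
  qed
  ultimately show thesis using that[of A] by simp
qed

section \<open>Means of sums and moment generating functions\<close>

text \<open>Real upper bounds exclude the value \<infinity>, hence the form \<infinity> -
  \<infinity> that \<open>E_subadd\<close> leaves open. Sums are estimated in this shape
  below.\<close>

lemma E_add_le:
  assumes "X \<in> H" "Y \<in> H" "E X \<le> ereal x" "E Y \<le> ereal y"
  shows "E (\<lambda>\<omega>. X \<omega> + Y \<omega>) \<le> ereal (x + y)"
proof -
  have "E (\<lambda>\<omega>. X \<omega> + Y \<omega>) \<le> E X + E Y" using assms by (intro E_subadd) auto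
  also have "\<dots> \<le> ereal x + ereal y" using assms by (intro add_mono)
  finally show ?thesis by simp
qed

lemma E_scale_le:
  assumes "X \<in> H" "0 \<le> c" "E X \<le> ereal x"
  shows "E (\<lambda>\<omega>. c * X \<omega>) \<le> ereal (c * x)"
proof -
  have "ereal c * E X \<le> ereal c * ereal x" using assms by (intro ereal_mult_left_mono) auto
  then show ?thesis using E_pos_homog[OF assms(1,2)] by simp
qed

lemma E_sum_le:
  assumes "finite I" "\<And>i. i \<in> I \<Longrightarrow> X i \<in> H" "\<And>i. i \<in> I \<Longrightarrow> E (X i) \<le> ereal (x i)"
  shows "E (\<lambda>\<omega>. \<Sum>i\<in>I. X i \<omega>) \<le> ereal (\<Sum>i\<in>I. x i)"
  using assms
proof (induction I rule: finite_induct)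
  case empty
  then show ?case using E_const[of 0] by simp
next
  case (insert j I)
  then have "E (\<lambda>\<omega>. X j \<omega> + (\<Sum>i\<in>I. X i \<omega>)) \<le> ereal (x j + (\<Sum>i\<in>I. x i))"
    by (intro E_add_le H_sum) auto
  then show ?case using insert(1,2) by simp
qed

text \<open>Subadditivity alone gives only \<open>\<le>\<close>; the other direction, on which the
  centring rests, comes from integrating out the last summand. The truncated variables need not be
  bounded below, so the version for bounded functions does not apply and integrability of the
  summands supplies the finiteness conditions.\<close>

lemma indep_seq_E_sum_min:
  assumes ind: "indep_seq H E n X" and k: "k \<le> n"
    and int: "\<And>i. i \<in> {1..n} \<Longrightarrow> E (\<lambda>\<omega>. \<bar>min (X i \<omega>) y\<bar>) < \<infinity>"
  shows "E (\<lambda>\<omega>. \<Sum>i=1..k. min (X i \<omega>) y) = ereal (\<Sum>i=1..k. real_of_ereal (E (\<lambda>\<omega>. min (X i \<omega>) y)))"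
proof -
  have X: "X (Suc i) \<in> H" if "i < n" for i using ind that by (simp add: indep_seq_def)
  define e where "e i = real_of_ereal (E (\<lambda>\<omega>. min (X (Suc i) \<omega>) y))" for i
  define d where "d i = real_of_ereal (E (\<lambda>\<omega>. \<bar>min (X (Suc i) \<omega>) y\<bar>))" for i
  have d: "E (\<lambda>\<omega>. \<bar>min (X (Suc i) \<omega>) y\<bar>) = ereal (d i)" if "i < n" for i
  proof -
    have "0 \<le> E (\<lambda>\<omega>. \<bar>min (X (Suc i) \<omega>) y\<bar>)" using X[OF that] by (intro E_nonneg H_abs H_min) auto
    then show ?thesis using int[of "Suc i"] that unfolding d_def
      by (cases "E (\<lambda>\<omega>. \<bar>min (X (Suc i) \<omega>) y\<bar>)") auto
  qed
  have e: "\<bar>E (\<lambda>\<omega>. min (X (Suc i) \<omega>) y)\<bar> \<noteq> \<infinity>" if "i < n" for i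
    using E_finite[OF H_min[OF X[OF that]]] int[of "Suc i"] that by simp
  define \<phi> where "\<phi> k x = (\<Sum>i<k. min (x i) y)" for k and x :: "nat \<Rightarrow> real"
  have \<phi>: "\<phi> k \<in> coord_lip k" for k
    unfolding \<phi>_def
  proof (rule coord_lip_sum)
    fix i assume "i \<in> {..<k}"
    then show "(\<lambda>x. min (x i) y) \<in> coord_lip k"
      by (intro coord_lip_compose[OF coord_lip_coord, where f = "\<lambda>u. min u y" and C = 1]) auto
  qed
  have upd: "\<phi> (Suc k) (x(k := u)) = \<phi> k x + 1 * min u y" for k x u
    by (simp add: \<phi>_def)
  have "E (\<lambda>\<omega>. \<phi> k (\<lambda>i. X (Suc i) \<omega>)) = ereal (\<Sum>i<k. e i)" if "k \<le> n" for k
    using that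
  proof (induction k)
    case 0
    then show ?case using E_const[of 0] by (simp add: \<phi>_def)
  next
    case (Suc k)
    then have k: "k < n" by simp
    let ?Y = "\<lambda>\<omega>. min (X (Suc k) \<omega>) y"
    have le: "E (\<lambda>\<omega>. \<bar>\<phi> (Suc k) (x(k := X (Suc k) \<omega>))\<bar>) \<le> ereal (\<bar>\<phi> k x\<bar> + d k)" for x
    proof -
      have "E (\<lambda>\<omega>. \<bar>\<phi> k x + 1 * ?Y \<omega>\<bar>) \<le> E (\<lambda>\<omega>. \<bar>\<phi> k x\<bar> + \<bar>?Y \<omega>\<bar>)"
        using X[OF k] by (intro E_mono H_abs H_add H_const H_scale H_min) auto
      also have "\<dots> \<le> ereal (\<bar>\<phi> k x\<bar> + d k)"
        using X[OF k] d[OF k] by (intro E_add_le H_abs H_const H_min) (auto simp: E_const)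
      finally show ?thesis unfolding upd .
    qed
    have fin: "E (\<lambda>\<omega>. \<bar>\<phi> (Suc k) (x(k := X (Suc k) \<omega>))\<bar>) < \<infinity>" for x
      by (rule le_less_trans[OF le]) simp
    have fin_abs: "E (\<lambda>\<omega>. \<bar>\<bar>\<phi> (Suc k) (x(k := X (Suc k) \<omega>))\<bar>\<bar>) < \<infinity>" for x
      unfolding abs_abs by (rule fin)
    note sec = E_coord_lip_section[OF coord_lip_abs[OF \<phi>] X[OF k] fin_abs]
    have real_le: "real_of_ereal (E (\<lambda>\<omega>. \<bar>\<phi> (Suc k) (x(k := X (Suc k) \<omega>))\<bar>)) \<le> \<bar>\<phi> k x\<bar> + d k" for x
    proof -
      define r where "r = E (\<lambda>\<omega>. \<bar>\<phi> (Suc k) (x(k := X (Suc k) \<omega>))\<bar>)"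
      have "r \<le> ereal (\<bar>\<phi> k x\<bar> + d k)" "\<bar>r\<bar> \<noteq> \<infinity>" unfolding r_def by (rule le, rule sec(2))
      then show ?thesis unfolding r_def[symmetric] by (cases r) auto
    qed
    let ?h = "\<lambda>\<omega>. real_of_ereal (E (\<lambda>\<omega>'. \<bar>\<phi> (Suc k) ((\<lambda>i. X (Suc i) \<omega>)(k := X (Suc k) \<omega>'))\<bar>))"
    have "?h \<in> H"
      by (rule H_coord_lip[OF sec(3), where Z = "\<lambda>i. X (Suc i)"]) (use X k in auto)
    moreover have "?h \<omega> \<le> (\<Sum>i<k. \<bar>min (X (Suc i) \<omega>) y\<bar>) + d k" for \<omega>
      by (rule order_trans[OF real_le]) (simp add: \<phi>_def)
    ultimately have "E ?h \<le> E (\<lambda>\<omega>. (\<Sum>i<k. \<bar>min (X (Suc i) \<omega>) y\<bar>) + d k)"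
      using X k by (intro E_mono H_add H_const H_sum H_abs H_min) auto
    also have "\<dots> \<le> ereal ((\<Sum>i<k. d i) + d k)"
      using X k d by (intro E_add_le E_sum_le H_const H_sum H_abs H_min) (auto simp: E_const)
    also have "\<dots> < \<infinity>" by simp
    finally have "E ?h < \<infinity>" .
    then have "E (\<lambda>\<omega>. \<phi> (Suc k) (\<lambda>i. X (Suc i) \<omega>)) =
        E (\<lambda>\<omega>. real_of_ereal (E (\<lambda>\<omega>'. \<phi> (Suc k) ((\<lambda>i. X (Suc i) \<omega>)(k := X (Suc k) \<omega>')))))"
      by (rule indep_seq_coord_lip[OF ind k \<phi> fin])
    also have "\<dots> = E (\<lambda>\<omega>. \<phi> k (\<lambda>i. X (Suc i) \<omega>) + e k)"
      unfolding upd E_affine[OF H_min[OF X[OF k]] e[OF k] zero_le_one] by (simp add: e_def)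
    also have "\<dots> = E (\<lambda>\<omega>. \<phi> k (\<lambda>i. X (Suc i) \<omega>)) + ereal (e k)"
      by (rule E_add_const[OF H_coord_lip[OF \<phi>, where Z = "\<lambda>i. X (Suc i)"]]) (use X k in auto)
    finally show ?case using Suc.IH k by simp
  qed
  from this[OF k] show ?thesis
    unfolding One_nat_def sum.atLeast1_atMost_eq by (simp only: \<phi>_def e_def)
qed

text \<open>For the conjugate, the term to be measured by the lower expectation is isolated in the
  majorant inequality, as in - t Y <= - D + 1 + c1 S + c2 Z, and \<open>E\<close> with subadditivity
  is applied. Only one term can stand alone on the left, so the others keep the upper
  expectation.\<close>

lemma mgf_bound:
  assumes X: "X \<in> H" and t: "0 < t" and c: "0 \<le> c1" "0 \<le> c2" and p: "1 \<le> p"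
    and maj: "\<And>u. u \<le> y \<Longrightarrow> exp (t * u) \<le> 1 + t * u + c1 * u\<^sup>2 + c2 * max u 0 powr p"
    and a: "E (\<lambda>\<omega>. max (min (X \<omega>) y) 0 powr p) \<le> ereal a"
  defines "Y \<equiv> \<lambda>\<omega>. min (X \<omega>) y"
  shows "E Y \<le> ereal \<mu> \<Longrightarrow> E (\<lambda>\<omega>. (Y \<omega>)\<^sup>2) \<le> ereal v \<Longrightarrow>
      E (\<lambda>\<omega>. exp (t * Y \<omega>)) \<le> ereal (exp (t * \<mu> + (c1 * v + c2 * a)))"
    and "conj_exp E Y \<le> ereal \<mu> \<Longrightarrow> E (\<lambda>\<omega>. (Y \<omega>)\<^sup>2) \<le> ereal v \<Longrightarrow>
      conj_exp E (\<lambda>\<omega>. exp (t * Y \<omega>)) \<le> ereal (exp (t * \<mu> + (c1 * v + c2 * a)))"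
    and "E Y \<le> ereal \<mu> \<Longrightarrow> conj_exp E (\<lambda>\<omega>. (Y \<omega>)\<^sup>2) \<le> ereal v \<Longrightarrow>
      conj_exp E (\<lambda>\<omega>. exp (t * Y \<omega>)) \<le> ereal (exp (t * \<mu> + (c1 * v + c2 * a)))"
proof -
  define Z where "Z = (\<lambda>\<omega>. max (Y \<omega>) 0 powr p)"
  define D where "D = (\<lambda>\<omega>. exp (t * Y \<omega>))"
  define S where "S = (\<lambda>\<omega>. (Y \<omega>)\<^sup>2)"
  have Y: "Y \<in> H" unfolding Y_def using X by (rule H_min)
  have Z: "Z \<in> H" unfolding Z_def using Y p by (rule H_powr_pos_part)
  have S: "S \<in> H" unfolding S_def using Y by (rule H_square)
  have D: "D \<in> H" unfolding D_def Y_def using X t by (intro H_exp_min) auto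
  have Za: "E Z \<le> ereal a" using a by (simp add: Z_def Y_def)
  have DB: "\<bar>D \<omega>\<bar> \<le> exp (t * y)" for \<omega> using t by (simp add: D_def Y_def mult_left_mono)
  have m: "D \<omega> \<le> 1 + t * Y \<omega> + c1 * S \<omega> + c2 * Z \<omega>" for \<omega>
    using maj[of "Y \<omega>"] by (simp add: D_def S_def Z_def Y_def)
  have one: "1 + w \<le> exp w" for w :: real by (rule exp_ge_add_one_self)
  have *: "E D \<le> ereal (exp (t * \<mu> + (c1 * v + c2 * a)))"
    if \<mu>: "E Y \<le> ereal \<mu>" and v: "E S \<le> ereal v" for \<mu> v
  proof -
    have "E D \<le> E (\<lambda>\<omega>. (1 + t * Y \<omega>) + (c1 * S \<omega> + c2 * Z \<omega>))"
      using m by (intro E_mono H_add H_const H_scale D Y S Z) (auto simp: add_ac)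
    also have "\<dots> \<le> ereal ((1 + t * \<mu>) + (c1 * v + c2 * a))"
      using \<mu> v Za c t by (intro E_add_le E_scale_le H_add H_const H_scale Y S Z) (auto simp: E_const)
    also have "\<dots> \<le> ereal (exp (t * \<mu> + (c1 * v + c2 * a)))"
      using one[of "t * \<mu> + (c1 * v + c2 * a)"] unfolding ereal_less_eq by linarith
    finally show ?thesis .
  qed
  \<comment> \<open>\<open>D\<close> is bounded, so \<open>E\<close> of its negative is a real
    number and the rearranged inequalities can be solved for it.\<close>
  have dfin: "\<bar>E (\<lambda>\<omega>. - D \<omega>)\<bar> \<noteq> \<infinity>"
    using E_finite_bounded(1)[OF H_uminus[OF D], of "exp (t * y)"] DB by simp
  then obtain \<epsilon> where \<epsilon>: "E (\<lambda>\<omega>. - D \<omega>) = ereal \<epsilon>" by (cases "E (\<lambda>\<omega>. - D \<omega>)") auto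
  have conj: "conj_exp E D \<le> ereal (exp (t * \<mu> + (c1 * v + c2 * a)))"
    if "- \<epsilon> \<le> 1 + t * \<mu> + (c1 * v + c2 * a)" for \<mu> v
    unfolding conj_exp_def \<epsilon> uminus_ereal.simps ereal_less_eq
    using that one[of "t * \<mu> + (c1 * v + c2 * a)"] by linarith
  have conj_fst: "conj_exp E D \<le> ereal (exp (t * \<mu> + (c1 * v + c2 * a)))"
    if \<mu>: "conj_exp E Y \<le> ereal \<mu>" and v: "E S \<le> ereal v" for \<mu> v
  proof -
    have "ereal t * ereal (- \<mu>) \<le> ereal t * E (\<lambda>\<omega>. - Y \<omega>)"
      using \<mu> t by (intro ereal_mult_left_mono) (auto simp: conj_exp_def ereal_uminus_le_reorder)
    also have "\<dots> = E (\<lambda>\<omega>. t * - Y \<omega>)" using t by (simp only: E_pos_homog[OF H_uminus[OF Y]] less_imp_le)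
    also have "\<dots> \<le> E (\<lambda>\<omega>. (- D \<omega> + 1) + (c1 * S \<omega> + c2 * Z \<omega>))"
    proof (rule E_mono)
      show "t * - Y \<omega> \<le> (- D \<omega> + 1) + (c1 * S \<omega> + c2 * Z \<omega>)" for \<omega> using m[of \<omega>] by simp
    qed (intro H_add H_const H_scale H_uminus D Y S Z)+
    also have "\<dots> \<le> ereal ((\<epsilon> + 1) + (c1 * v + c2 * a))"
      using v Za c \<epsilon> by (intro E_add_le E_scale_le H_add H_const H_scale H_uminus D Y S Z) (auto simp: E_const)
    finally show ?thesis by (intro conj) simp
  qed
  have conj_snd: "conj_exp E D \<le> ereal (exp (t * \<mu> + (c1 * v + c2 * a)))"
    if \<mu>: "E Y \<le> ereal \<mu>" and v: "conj_exp E S \<le> ereal v" for \<mu> v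
  proof -
    have "ereal c1 * ereal (- v) \<le> ereal c1 * E (\<lambda>\<omega>. - S \<omega>)"
      using v c by (intro ereal_mult_left_mono) (auto simp: conj_exp_def ereal_uminus_le_reorder)
    also have "\<dots> = E (\<lambda>\<omega>. c1 * - S \<omega>)" using c by (simp only: E_pos_homog[OF H_uminus[OF S]])
    also have "\<dots> \<le> E (\<lambda>\<omega>. (- D \<omega> + 1) + (t * Y \<omega> + c2 * Z \<omega>))"
    proof (rule E_mono)
      show "c1 * - S \<omega> \<le> (- D \<omega> + 1) + (t * Y \<omega> + c2 * Z \<omega>)" for \<omega> using m[of \<omega>] by simp
    qed (intro H_add H_const H_scale H_uminus D Y S Z)+
    also have "\<dots> \<le> ereal ((\<epsilon> + 1) + (t * \<mu> + c2 * a))"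
      using \<mu> Za c t \<epsilon> by (intro E_add_le E_scale_le H_add H_const H_scale H_uminus D Y S Z) (auto simp: E_const)
    finally show ?thesis by (intro conj) simp
  qed
  show "E Y \<le> ereal \<mu> \<Longrightarrow> E (\<lambda>\<omega>. (Y \<omega>)\<^sup>2) \<le> ereal v \<Longrightarrow>
      E (\<lambda>\<omega>. exp (t * Y \<omega>)) \<le> ereal (exp (t * \<mu> + (c1 * v + c2 * a)))"
    by (rule *[unfolded D_def S_def])
  show "conj_exp E Y \<le> ereal \<mu> \<Longrightarrow> E (\<lambda>\<omega>. (Y \<omega>)\<^sup>2) \<le> ereal v \<Longrightarrow>
      conj_exp E (\<lambda>\<omega>. exp (t * Y \<omega>)) \<le> ereal (exp (t * \<mu> + (c1 * v + c2 * a)))"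
    by (rule conj_fst[unfolded D_def S_def])
  show "E Y \<le> ereal \<mu> \<Longrightarrow> conj_exp E (\<lambda>\<omega>. (Y \<omega>)\<^sup>2) \<le> ereal v \<Longrightarrow>
      conj_exp E (\<lambda>\<omega>. exp (t * Y \<omega>)) \<le> ereal (exp (t * \<mu> + (c1 * v + c2 * a)))"
    by (rule conj_snd[unfolded D_def S_def])
qed

end

section \<open>Error terms in the extended reals\<close>

lemma sum_ereal_finite_nonneg:
  fixes f :: "nat \<Rightarrow> ereal"
  assumes "finite I" "\<And>i. i \<in> I \<Longrightarrow> 0 \<le> f i" "sum f I = ereal B" "i \<in> I"
  shows "f i = ereal (real_of_ereal (f i))" "0 \<le> real_of_ereal (f i)"
proof -
  have "f i \<noteq> \<infinity>" using sum_Pinfty[of f I] assms by auto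
  then show "f i = ereal (real_of_ereal (f i))" "0 \<le> real_of_ereal (f i)"
    using assms(2)[OF assms(4)] by (cases "f i"; auto)+
qed

lemma bennett_term_simps:
  assumes "0 < x" "0 < y"
  shows "0 < B \<Longrightarrow> bennett_term x y (ereal B) =
      ereal (exp (- (x\<^sup>2 / (2 * (x * y + B)) * (1 + 2 / 3 * ln (1 + x * y / B)))))"
    and "bennett_term x y 0 = 0" and "bennett_term x y \<infinity> = 1"
proof -
  have "0 < x * y" "0 < x\<^sup>2" "0 < x\<^sup>2 * (inverse x * inverse y)" using assms by auto
  then show "bennett_term x y 0 = 0"
    by (simp add: bennett_term_def exp_ereal_def ln_ereal_def divide_ereal_def one_ereal_def)
  show "bennett_term x y \<infinity> = 1"
    by (simp add: bennett_term_def exp_ereal_def ln_ereal_def divide_ereal_def one_ereal_def)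
  assume "0 < B"
  then have "x * y + B \<noteq> 0" using \<open>0 < x * y\<close> by simp
  then show "bennett_term x y (ereal B) =
      ereal (exp (- (x\<^sup>2 / (2 * (x * y + B)) * (1 + 2 / 3 * ln (1 + x * y / B)))))"
    using \<open>0 < B\<close>
    by (simp add: bennett_term_def exp_ereal_def ln_ereal_def one_ereal_def numeral_eq_ereal)
qed

lemma gauss_term_simps:
  assumes "0 < x" "0 < \<delta>"
  shows "0 < B \<Longrightarrow> gauss_term \<delta> x (ereal B) = ereal (exp (- (x\<^sup>2 / (2 * (1 + \<delta>) * B))))"
    and "gauss_term \<delta> x 0 = 0" and "gauss_term \<delta> x \<infinity> = 1"
proof -
  have p: "0 < x\<^sup>2" "0 < 2 * (1 + \<delta>)" using assms by auto
  then show "gauss_term \<delta> x 0 = 0"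
    by (simp add: gauss_term_def exp_ereal_def divide_ereal_def)
  show "gauss_term \<delta> x \<infinity> = 1"
    using p by (simp add: gauss_term_def exp_ereal_def divide_ereal_def one_ereal_def)
  show "0 < B \<Longrightarrow> gauss_term \<delta> x (ereal B) = ereal (exp (- (x\<^sup>2 / (2 * (1 + \<delta>) * B))))"
    using p by (simp add: gauss_term_def exp_ereal_def)
qed

text \<open>Serves to pass from truncated to full second moments in the last bounds of the
  theorem.\<close>

lemma gauss_term_mono:
  assumes "0 < x" "0 < \<delta>" "0 \<le> B" "B \<le> B'"
  shows "gauss_term \<delta> x B \<le> gauss_term \<delta> x B'"
proof (cases B')
  case (real b')
  then obtain b where b: "B = ereal b" "0 \<le> b" "b \<le> b'" using assms by (cases B) auto
  note g = gauss_term_simps[OF assms(1,2)]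
  show ?thesis
  proof (cases "b = 0")
    case True
    have "0 \<le> gauss_term \<delta> x B'"
    proof (cases "b' = 0")
      case False
      then have "0 < b'" using b by simp
      then show ?thesis using g(1)[of b'] real by simp
    qed (use g(2) real in \<open>simp add: zero_ereal_def\<close>)
    then show ?thesis using True g(2) b by (simp add: zero_ereal_def)
  next
    case False
    then have "0 < b" "0 < b'" using b by auto
    moreover from this have "x\<^sup>2 / (2 * (1 + \<delta>) * b') \<le> x\<^sup>2 / (2 * (1 + \<delta>) * b)"
      using b assms by (intro divide_left_mono mult_left_mono mult_pos_pos) auto
    ultimately show ?thesis using g(1)[of b] g(1)[of b'] real b by simp
  qed
next
  case PInf
  note g = gauss_term_simps[OF assms(1,2)]
  have "gauss_term \<delta> x B \<le> 1"
  proof (cases B)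
    case (real b)
    then show ?thesis using g(1)[of b] g(2) assms by (cases "b = 0") (auto simp: zero_ereal_def one_ereal_def)
  qed (use g assms in auto)
  then show ?thesis using PInf g(3) by simp
qed (use assms in auto)

section \<open>Capacities, events and the basic deviation bound\<close>

context sublinear_expectation_space
begin

lemma property_C_upper:
  assumes "property_C M H E V" "A \<in> sets M" "h \<in> H" "\<And>\<omega>. \<omega> \<in> space M \<Longrightarrow> indicat_real A \<omega> \<le> h \<omega>"
  shows "ereal (V A) \<le> E h"
proof -
  have "\<forall>\<omega>\<in>space M. 0 \<le> indicat_real A \<omega> \<and> indicat_real A \<omega> \<le> h \<omega>"
    using assms(4) by simp
  from assms(1)[unfolded property_C_def, THEN bspec, OF H_zero, THEN bspec, OF assms(3),
      THEN bspec, OF assms(2), THEN mp, OF this]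
  show ?thesis by simp
qed

text \<open>This is the lower half of property (C) on the complement: 1 - h lies below the indicator
  of the complement, which lies below 1.\<close>

lemma property_C_conj:
  assumes "property_C M H E V" "A \<in> sets M" "h \<in> H" "\<And>\<omega>. \<omega> \<in> space M \<Longrightarrow> indicat_real A \<omega> \<le> h \<omega>"
  shows "ereal (conj_cap M V A) \<le> conj_exp E h"
proof -
  have "\<forall>\<omega>\<in>space M. - h \<omega> + 1 \<le> indicat_real (space M - A) \<omega> \<and> indicat_real (space M - A) \<omega> \<le> 1"
  proof (intro ballI conjI)
    fix \<omega> assume "\<omega> \<in> space M"
    with assms(4)[OF this] show "- h \<omega> + 1 \<le> indicat_real (space M - A) \<omega>"
      by (cases "\<omega> \<in> A") auto
  qed (simp add: indicator_def)
  moreover have "(\<lambda>\<omega>. - h \<omega> + 1) \<in> H" "(\<lambda>_. 1) \<in> H" by (intro H_add H_uminus H_const assms)+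
  moreover have "space M - A \<in> sets M" using assms(2) by auto
  ultimately have "E (\<lambda>\<omega>. - h \<omega> + 1) \<le> ereal (V (space M - A))"
    using assms(1)[unfolded property_C_def, THEN bspec, THEN bspec, THEN bspec, THEN mp,
        of "\<lambda>\<omega>. - h \<omega> + 1" "\<lambda>_. 1" "space M - A"] by simp
  then have "E (\<lambda>\<omega>. - h \<omega>) + 1 \<le> ereal (V (space M - A))"
    unfolding E_add_const[OF H_uminus[OF assms(3)]] by (simp add: one_ereal_def)
  then show ?thesis
    by (cases "E (\<lambda>\<omega>. - h \<omega>)") (auto simp: conj_exp_def conj_cap_def one_ereal_def)
qed

lemma psum_in_H:
  assumes "indep_seq H E n X" "k \<le> n" shows "psum X k \<in> H"
proof -
  have "psum X k = (\<lambda>\<omega>. \<Sum>i=1..k. X i \<omega>)" by (simp add: psum_def fun_eq_iff)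
  moreover have "(\<lambda>\<omega>. \<Sum>i=1..k. X i \<omega>) \<in> H"
    using assms by (intro H_sum) (auto simp: indep_seq_def)
  ultimately show ?thesis by simp
qed

lemma dev_event_alt:
  assumes "1 \<le> n"
  shows "dev_event M m n X x = (\<Union>k\<in>{1..n}. {\<omega> \<in> space M. ereal x \<le> ereal (psum X k \<omega>) - m (psum X k)})"
  using assms by (auto simp: dev_event_def Max_ge_iff)

lemma large_event_alt:
  assumes "1 \<le> n" shows "large_event M n X y = (\<Union>k\<in>{1..n}. {\<omega> \<in> space M. y < X k \<omega>})"
  using assms by (auto simp: large_event_def Max_gr_iff)

lemma dev_event_sets:
  assumes "1 \<le> n" "indep_seq H E n X" shows "dev_event M m n X x \<in> sets M"
  unfolding dev_event_alt[OF assms(1)]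
proof (intro sets.finite_UN borel_measurable_le borel_measurable_const borel_measurable_ereal_diff borel_measurable_ereal)
  fix k assume "k \<in> {1..n}"
  then show "psum X k \<in> borel_measurable M" using assms by (intro H_measurable psum_in_H) auto
qed simp

lemma large_event_sets:
  assumes "1 \<le> n" "indep_seq H E n X" shows "large_event M n X y \<in> sets M"
  unfolding large_event_alt[OF assms(1)]
  using assms(2) by (intro sets.finite_UN borel_measurable_less borel_measurable_const H_measurable)
    (auto simp: indep_seq_def)

text \<open>For the conjugate capacity the inclusion is read on complements: that of
  \<open>A\<close> lies in the union of \<open>L\<close> with that of \<open>D\<close>.
  Subadditivity of \<open>V\<close> is used there, which is why \<open>L\<close> is measured by
  \<open>V\<close> in both cases.\<close>

lemma capacity_le_union:
  assumes V: "subadditive_capacity M V" and W: "W = V \<or> W = conj_cap M V"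
    and s: "D \<in> sets M" "L \<in> sets M" "A \<in> sets M" and sub: "D \<subseteq> L \<union> A"
  shows "W D \<le> V L + W A"
proof -
  have mono: "V P \<le> V Q" if "P \<in> sets M" "Q \<in> sets M" "P \<subseteq> Q" for P Q
    using V that by (simp add: subadditive_capacity_def capacity_def)
  have un: "V (P \<union> Q) \<le> V P + V Q" if "P \<in> sets M" "Q \<in> sets M" for P Q
    using V that by (simp add: subadditive_capacity_def)
  from W show ?thesis
  proof
    assume "W = V"
    then show ?thesis using mono[OF s(1) _ sub] un[OF s(2,3)] s by force
  next
    assume W: "W = conj_cap M V"
    have "V (space M - A) \<le> V (L \<union> (space M - D))"
      using s sub by (intro mono) auto
    also have "\<dots> \<le> V L + V (space M - D)" using s by (intro un) auto
    finally show ?thesis by (simp add: W conj_cap_def)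
  qed
qed

lemma capacity_le_1:
  assumes V: "subadditive_capacity M V" and W: "W = V \<or> W = conj_cap M V" and D: "D \<in> sets M"
  shows "W D \<le> 1" "0 \<le> V D"
proof -
  have *: "0 \<le> V P \<and> V P \<le> 1" if "P \<in> sets M" for P
    using V that by (simp add: subadditive_capacity_def capacity_def)
  have "space M - D \<in> sets M" using D by auto
  then show "W D \<le> 1" "0 \<le> V D" using W *[OF D] *[of "space M - D"] by (auto simp: conj_cap_def)
qed

text \<open>Off the large event every summand equals its truncation, so the exponential bound
  applies, with t = \<tau> / y. The powers of \<open>y\<close> are then distributed so that x / y, B
  / y^2 and A / y^p become the variables of the calculus part.\<close>

lemma deviation_bound:
  assumes V: "subadditive_capacity M V" and C: "property_C M H E V"
    and n: "1 \<le> n" and ind: "indep_seq H E n X"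
    and W: "(W = V \<and> m = E \<and> F2 = E) \<or> (W = conj_cap M V \<and> m = conj_exp E \<and> F2 = E) \<or>
      (W = conj_cap M V \<and> m = E \<and> F2 = conj_exp E)"
    and y: "0 < y" and p: "1 \<le> p"
    and int: "\<And>i. i \<in> {1..n} \<Longrightarrow> E (\<lambda>\<omega>. \<bar>min (X i \<omega>) y\<bar>) < \<infinity>"
    and v: "\<And>i. i \<in> {1..n} \<Longrightarrow> F2 (\<lambda>\<omega>. (min (X i \<omega>) y)\<^sup>2) = ereal (v i)" "\<And>i. i \<in> {1..n} \<Longrightarrow> 0 \<le> v i"
    and a: "\<And>i. i \<in> {1..n} \<Longrightarrow> E (\<lambda>\<omega>. max (min (X i \<omega>) y) 0 powr p) = ereal (a i)" "\<And>i. i \<in> {1..n} \<Longrightarrow> 0 \<le> a i"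
    and maj: "mgf_majorant p \<tau> d e"
  shows "W (dev_event M m n X x) - V (large_event M n X y) \<le>
    exp (- \<tau> * (x / y) + d * \<tau>\<^sup>2 * ((\<Sum>i=1..n. v i) / y\<^sup>2) + e * \<tau> powr p * ((\<Sum>i=1..n. a i) / y powr p))"
proof -
  have X: "X i \<in> H" if "i \<in> {1..n}" for i using ind that by (simp add: indep_seq_def)
  define t where "t = \<tau> / y"
  define c1 where "c1 = d * t\<^sup>2"
  define c2 where "c2 = e * t powr p"
  have t: "0 < t" using maj y by (simp add: t_def mgf_majorant_def)
  have c: "0 \<le> c1" "0 \<le> c2" using maj by (auto simp: c1_def c2_def mgf_majorant_def)
  have maj': "exp (t * u) \<le> 1 + t * u + c1 * u\<^sup>2 + c2 * max u 0 powr p" if "u \<le> y" for u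
  proof -
    have "t * u \<le> \<tau>" using mult_left_mono[OF that, of t] t y by (simp add: t_def)
    then have "exp (t * u) \<le> 1 + t * u + d * (t * u)\<^sup>2 + e * max (t * u) 0 powr p"
      using maj by (simp add: mgf_majorant_def)
    moreover have "max (t * u) 0 = t * max u 0" using t by (simp add: max_mult_distrib_left)
    ultimately show ?thesis by (simp add: c1_def c2_def power_mult_distrib powr_mult mult.assoc)
  qed
  define \<mu> where "\<mu> i = real_of_ereal (m (\<lambda>\<omega>. min (X i \<omega>) y))" for i
  have fin: "\<bar>E (\<lambda>\<omega>. min (X i \<omega>) y)\<bar> \<noteq> \<infinity>" "\<bar>conj_exp E (\<lambda>\<omega>. min (X i \<omega>) y)\<bar> \<noteq> \<infinity>" if i: "i \<in> {1..n}" for i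
    using E_finite[OF H_min[OF X[OF i]] int[OF i]] E_finite[OF H_uminus[OF H_min[OF X[OF i]]], of y] int[OF i]
    by (auto simp: conj_exp_def)
  have \<mu>: "m (\<lambda>\<omega>. min (X i \<omega>) y) = ereal (\<mu> i)" if i: "i \<in> {1..n}" for i
    unfolding \<mu>_def using fin[OF i] W by (auto simp: ereal_real)
  \<comment> \<open>This makes centring by \<open>m (psum X k)\<close> at least as demanding as
    centring by the truncated means. Truncation only lowers the sum; for \<open>m = E\<close> the
    sum of means is exact by independence, and for the conjugate it is bounded by
    superadditivity.\<close>
  have mean: "ereal (\<Sum>i=1..k. \<mu> i) \<le> m (psum X k)" if k: "k \<in> {1..n}" for k
  proof -
    have k': "k \<le> n" using k by simp
    have Y: "(\<lambda>\<omega>. \<Sum>i=1..k. min (X i \<omega>) y) \<in> H" using X k by (intro H_sum H_min) auto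
    have le: "(\<Sum>i=1..k. min (X i \<omega>) y) \<le> psum X k \<omega>" for \<omega> by (auto simp: psum_def intro: sum_mono)
    consider "m = E" | "m = conj_exp E" using W by blast
    then show ?thesis
    proof cases
      case 1
      have "ereal (\<Sum>i=1..k. \<mu> i) = E (\<lambda>\<omega>. \<Sum>i=1..k. min (X i \<omega>) y)"
        unfolding \<mu>_def 1 by (rule indep_seq_E_sum_min[OF ind k' int, symmetric])
      also have "\<dots> \<le> E (psum X k)" using le by (intro E_mono psum_in_H[OF ind k'] Y)
      finally show ?thesis using 1 by simp
    next
      case 2
      have "E (\<lambda>\<omega>. \<Sum>i=1..k. - min (X i \<omega>) y) \<le> ereal (\<Sum>i=1..k. - \<mu> i)"
      proof (intro E_sum_le)
        fix i assume "i \<in> {1..k}"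
        then have i: "i \<in> {1..n}" using k by simp
        show "(\<lambda>\<omega>. - min (X i \<omega>) y) \<in> H" using X[OF i] by (intro H_uminus H_min)
        show "E (\<lambda>\<omega>. - min (X i \<omega>) y) \<le> ereal (- \<mu> i)"
          using \<mu>[OF i] 2 by (cases "E (\<lambda>\<omega>. - min (X i \<omega>) y)") (auto simp: conj_exp_def)
      qed simp
      then have "ereal (\<Sum>i=1..k. \<mu> i) \<le> conj_exp E (\<lambda>\<omega>. \<Sum>i=1..k. min (X i \<omega>) y)"
        by (cases "E (\<lambda>\<omega>. \<Sum>i=1..k. - min (X i \<omega>) y)") (auto simp: conj_exp_def sum_negf)
      also have "\<dots> \<le> conj_exp E (psum X k)" using le by (intro conj_exp_mono psum_in_H[OF ind k'] Y)
      finally show ?thesis using 2 by simp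
    qed
  qed
  obtain F where F: "F = E \<or> F = conj_exp E"
    and WF: "\<And>A h. A \<in> sets M \<Longrightarrow> h \<in> H \<Longrightarrow>
      (\<And>\<omega>. \<omega> \<in> space M \<Longrightarrow> indicat_real A \<omega> \<le> h \<omega>) \<Longrightarrow> ereal (W A) \<le> F h"
    and mgf: "\<And>i. i \<in> {1..n} \<Longrightarrow> F (\<lambda>\<omega>. exp (t * min (X i \<omega>) y)) \<le> ereal (exp (t * \<mu> i + (c1 * v i + c2 * a i)))"
  proof -
    note mb = mgf_bound[OF X t c p maj' eq_refl[OF a(1)]]
    from W consider (1) "W = V" "m = E" "F2 = E" | (2) "W = conj_cap M V" "m = conj_exp E" "F2 = E"
      | (3) "W = conj_cap M V" "m = E" "F2 = conj_exp E" by blast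
    then show thesis
    proof cases
      case 1
      show thesis
      proof (rule that[of E])
        show "ereal (W A) \<le> E h" if "A \<in> sets M" "h \<in> H" "\<And>\<omega>. \<omega> \<in> space M \<Longrightarrow> indicat_real A \<omega> \<le> h \<omega>" for A h
          unfolding 1 using property_C_upper[OF C that] .
        show "E (\<lambda>\<omega>. exp (t * min (X i \<omega>) y)) \<le> ereal (exp (t * \<mu> i + (c1 * v i + c2 * a i)))" if "i \<in> {1..n}" for i
          using mb(1)[OF that _ that, of "\<mu> i" "v i"] \<mu>[OF that] v(1)[OF that] 1 by simp
      qed simp
    next
      case 2
      show thesis
      proof (rule that[of "conj_exp E"])
        show "ereal (W A) \<le> conj_exp E h" if "A \<in> sets M" "h \<in> H" "\<And>\<omega>. \<omega> \<in> space M \<Longrightarrow> indicat_real A \<omega> \<le> h \<omega>" for A h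
          unfolding 2 using property_C_conj[OF C that] .
        show "conj_exp E (\<lambda>\<omega>. exp (t * min (X i \<omega>) y)) \<le> ereal (exp (t * \<mu> i + (c1 * v i + c2 * a i)))" if "i \<in> {1..n}" for i
          using mb(2)[OF that _ that, of "\<mu> i" "v i"] \<mu>[OF that] v(1)[OF that] 2 by simp
      qed simp
    next
      case 3
      show thesis
      proof (rule that[of "conj_exp E"])
        show "ereal (W A) \<le> conj_exp E h" if "A \<in> sets M" "h \<in> H" "\<And>\<omega>. \<omega> \<in> space M \<Longrightarrow> indicat_real A \<omega> \<le> h \<omega>" for A h
          unfolding 3 using property_C_conj[OF C that] .
        show "conj_exp E (\<lambda>\<omega>. exp (t * min (X i \<omega>) y)) \<le> ereal (exp (t * \<mu> i + (c1 * v i + c2 * a i)))" if "i \<in> {1..n}" for i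
          using mb(3)[OF that _ that, of "\<mu> i" "v i"] \<mu>[OF that] v(1)[OF that] 3 by simp
      qed simp
    qed
  qed
  have nonneg: "0 \<le> c1 * v i + c2 * a i" if "i \<in> {1..n}" for i using c v(2)[OF that] a(2)[OF that] by simp
  obtain A where A: "A \<in> sets M" "W A \<le> exp (- t * x + (\<Sum>i=1..n. c1 * v i + c2 * a i))"
    "{\<omega> \<in> space M. \<exists>k\<in>{1..n}. x \<le> (\<Sum>i=1..k. min (X i \<omega>) y - \<mu> i)} \<subseteq> A"
    using exponential_tail_bound[where W = W and F = F and X = X and n = n and t = t and x = x and y = y and m = \<mu>
      and c = "\<lambda>i. c1 * v i + c2 * a i", OF F ind WF t nonneg mgf] by blast
  have "dev_event M m n X x \<subseteq> large_event M n X y \<union> A"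
  proof
    fix \<omega> assume "\<omega> \<in> dev_event M m n X x"
    then obtain k where k: "k \<in> {1..n}" and \<omega>: "\<omega> \<in> space M" and le: "ereal x \<le> ereal (psum X k \<omega>) - m (psum X k)"
      unfolding dev_event_alt[OF n] by auto
    show "\<omega> \<in> large_event M n X y \<union> A"
    proof (cases "\<exists>i\<in>{1..n}. y < X i \<omega>")
      case True
      then show ?thesis using \<omega> unfolding large_event_alt[OF n] by auto
    next
      case False
      have "ereal x \<le> ereal (psum X k \<omega>) - ereal (\<Sum>i=1..k. \<mu> i)"
        using le mean[OF k] by (meson ereal_minus_mono order_refl order_trans)
      then have "x \<le> psum X k \<omega> - (\<Sum>i=1..k. \<mu> i)" by simp
      also have "\<dots> = (\<Sum>i=1..k. min (X i \<omega>) y - \<mu> i)"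
        unfolding psum_def sum_subtractf using False k by (intro arg_cong2[where f = minus] sum.cong refl) (auto simp: min_def not_less)
      finally show ?thesis using A(3) \<omega> k by blast
    qed
  qed
  then have "W (dev_event M m n X x) \<le> V (large_event M n X y) + W A"
    using W by (intro capacity_le_union V dev_event_sets large_event_sets n ind A) auto
  moreover have "- t * x + (\<Sum>i=1..n. c1 * v i + c2 * a i) =
    - \<tau> * (x / y) + d * \<tau>\<^sup>2 * ((\<Sum>i=1..n. v i) / y\<^sup>2) + e * \<tau> powr p * ((\<Sum>i=1..n. a i) / y powr p)"
    by (simp add: t_def c1_def c2_def sum.distrib power_divide powr_divide sum_distrib_left sum_divide_distrib)
  ultimately show ?thesis using A(2) by simp
qed

end

section \<open>The three bounds for every admissible combination\<close>

text \<open>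
  The admissible triples: \<open>W\<close> is the capacity to be bounded, \<open>m\<close> the centring, and \<open>F\<close> the
  expectation of the squares.
\<close>

definition deviation_setup ::
    "'a measure \<Rightarrow> ('a \<Rightarrow> real) set \<Rightarrow> (('a \<Rightarrow> real) \<Rightarrow> ereal) \<Rightarrow> ('a set \<Rightarrow> real) \<Rightarrow> nat \<Rightarrow>
     (nat \<Rightarrow> 'a \<Rightarrow> real) \<Rightarrow> ('a set \<Rightarrow> real) \<Rightarrow> (('a \<Rightarrow> real) \<Rightarrow> ereal) \<Rightarrow> (('a \<Rightarrow> real) \<Rightarrow> ereal) \<Rightarrow> bool" where
  "deviation_setup M H E V n X W m F \<longleftrightarrow>
     sublinear_expectation_space M H E \<and> subadditive_capacity M V \<and> property_C M H E V \<and>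
     1 \<le> n \<and> indep_seq H E n X \<and>
     (W = V \<and> m = E \<and> F = E \<or> W = conj_cap M V \<and> m = conj_exp E \<and> F = E \<or>
      W = conj_cap M V \<and> m = E \<and> F = conj_exp E \<and> (\<forall>i\<in>{1..n}. E (\<lambda>\<omega>. max (- X i \<omega>) 0) < \<infinity>))"

lemma deviation_setup_nonneg:
  assumes "deviation_setup M H E V n X W m F" "Y \<in> H" "\<And>\<omega>. 0 \<le> Y \<omega>"
  shows "0 \<le> F Y"
proof -
  interpret sublinear_expectation_space M H E using assms(1) by (simp add: deviation_setup_def)
  have "conj_exp E (\<lambda>_. 0) = 0" by (simp add: conj_exp_def E_const zero_ereal_def)
  then have "0 \<le> conj_exp E Y" using conj_exp_mono[OF assms(2) H_zero] assms(3) by metis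
  moreover have "0 \<le> E Y" using assms(2,3) by (intro E_nonneg) auto
  ultimately show ?thesis using assms(1) by (auto simp: deviation_setup_def)
qed

lemma deviation_setup_mono:
  assumes "deviation_setup M H E V n X W m F" "Y \<in> H" "Z \<in> H" "\<And>\<omega>. Y \<omega> \<le> Z \<omega>"
  shows "F Y \<le> F Z"
proof -
  interpret sublinear_expectation_space M H E using assms(1) by (simp add: deviation_setup_def)
  show ?thesis
    using assms(1) E_mono[OF assms(3,2)] conj_exp_mono[OF assms(3,2)] assms(4) by (auto simp: deviation_setup_def)
qed

lemma A_trunc_alt:
  assumes "0 < y" shows "A_trunc E n X p y = (\<Sum>i=1..n. E (\<lambda>\<omega>. max (min (X i \<omega>) y) 0 powr p))"
proof -
  have "min (max u 0) y = max (min u y) 0" for u using assms by (simp add: min_def max_def)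
  then show ?thesis by (simp add: A_trunc_def)
qed

lemma A_trunc_finite:
  assumes s: "deviation_setup M H E V n X W m F" and y: "0 < y" and p: "1 \<le> p"
  shows "A_trunc E n X p y = ereal (real_of_ereal (A_trunc E n X p y))"
    and "i \<in> {1..n} \<Longrightarrow> E (\<lambda>\<omega>. max (min (X i \<omega>) y) 0 powr p) =
      ereal (real_of_ereal (E (\<lambda>\<omega>. max (min (X i \<omega>) y) 0 powr p)))"
    and "i \<in> {1..n} \<Longrightarrow> 0 \<le> real_of_ereal (E (\<lambda>\<omega>. max (min (X i \<omega>) y) 0 powr p))"
    and "0 \<le> real_of_ereal (A_trunc E n X p y)"
    and "real_of_ereal (A_trunc E n X p y) = (\<Sum>i=1..n. real_of_ereal (E (\<lambda>\<omega>. max (min (X i \<omega>) y) 0 powr p)))"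
proof -
  interpret sublinear_expectation_space M H E using s by (simp add: deviation_setup_def)
  let ?Z = "\<lambda>i \<omega>. max (min (X i \<omega>) y) 0 powr p"
  have X: "X i \<in> H" if "i \<in> {1..n}" for i using s that by (simp add: deviation_setup_def indep_seq_def)
  have Z: "?Z i \<in> H" if "i \<in> {1..n}" for i using X[OF that] p by (intro H_powr_pos_part H_min)
  have nn: "0 \<le> E (?Z i)" if "i \<in> {1..n}" for i using Z[OF that] by (intro E_nonneg) auto
  have "\<bar>E (?Z i)\<bar> \<noteq> \<infinity>" if "i \<in> {1..n}" for i
    by (rule E_finite_bounded(1)[OF Z[OF that], of "y powr p"]) (use y p in \<open>auto intro!: powr_mono2\<close>)
  then have eq: "E (?Z i) = ereal (real_of_ereal (E (?Z i)))" if "i \<in> {1..n}" for i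
    using that by (simp add: ereal_real)
  have nn': "0 \<le> real_of_ereal (E (?Z i))" if "i \<in> {1..n}" for i using nn[OF that] by (rule real_of_ereal_pos)
  have A: "A_trunc E n X p y = ereal (\<Sum>i=1..n. real_of_ereal (E (?Z i)))"
    unfolding A_trunc_alt[OF y] sum_ereal[symmetric] by (intro sum.cong refl eq)
  show "i \<in> {1..n} \<Longrightarrow> E (?Z i) = ereal (real_of_ereal (E (?Z i)))" by (rule eq)
  show "i \<in> {1..n} \<Longrightarrow> 0 \<le> real_of_ereal (E (?Z i))" by (rule nn')
  show "A_trunc E n X p y = ereal (real_of_ereal (A_trunc E n X p y))" unfolding A by simp
  show "real_of_ereal (A_trunc E n X p y) = (\<Sum>i=1..n. real_of_ereal (E (?Z i)))" unfolding A by simp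
  then show "0 \<le> real_of_ereal (A_trunc E n X p y)" using nn' by (auto intro: sum_nonneg)
qed

lemma deviation_majorant:
  assumes s: "deviation_setup M H E V n X W m F" and y: "0 < y" and p: "1 \<le> p"
    and B: "sqsum_trunc F n X y = ereal B" and maj: "mgf_majorant p \<tau> d e"
  shows "W (dev_event M m n X x) - V (large_event M n X y) \<le>
    exp (- \<tau> * (x / y) + d * \<tau>\<^sup>2 * (B / y\<^sup>2) + e * \<tau> powr p * (real_of_ereal (A_trunc E n X p y) / y powr p))"
proof -
  interpret sublinear_expectation_space M H E using s by (simp add: deviation_setup_def)
  have X: "X i \<in> H" if "i \<in> {1..n}" for i using s that by (simp add: deviation_setup_def indep_seq_def)
  let ?S = "\<lambda>i \<omega>. (min (X i \<omega>) y)\<^sup>2"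
  have S: "?S i \<in> H" if "i \<in> {1..n}" for i using X[OF that] by (intro H_square H_min)
  have nn: "0 \<le> F (?S i)" if "i \<in> {1..n}" for i by (rule deviation_setup_nonneg[OF s S[OF that]]) simp
  have fin: "F (?S i) = ereal (real_of_ereal (F (?S i)))" "0 \<le> real_of_ereal (F (?S i))" if "i \<in> {1..n}" for i
    by (rule sum_ereal_finite_nonneg[where f = "\<lambda>i. F (?S i)", OF finite_atLeastAtMost nn B[unfolded sqsum_trunc_def] that], assumption)+
  have Bs: "B = (\<Sum>i=1..n. real_of_ereal (F (?S i)))"
  proof -
    have "ereal B = (\<Sum>i=1..n. ereal (real_of_ereal (F (?S i))))"
      unfolding B[unfolded sqsum_trunc_def, symmetric] by (intro sum.cong refl fin(1)) auto
    then show ?thesis by simp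
  qed
  \<comment> \<open>A finite upper second moment gives integrability through |u| <= u^2 + 1. A
    finite lower one does not control the upper expectation, which is why the third case of
    \<open>deviation_setup\<close> carries a condition on the negative parts.\<close>
  have int: "E (\<lambda>\<omega>. \<bar>min (X i \<omega>) y\<bar>) < \<infinity>" if i: "i \<in> {1..n}" for i
  proof -
    consider "F = E" | "E (\<lambda>\<omega>. max (- X i \<omega>) 0) < \<infinity>" using s i by (auto simp: deviation_setup_def)
    then show ?thesis
    proof cases
      case 1
      have "\<bar>u\<bar> \<le> u\<^sup>2 + 1" for u :: real
      proof (cases "\<bar>u\<bar> \<le> 1")
        case False
        then have "\<bar>u\<bar> * 1 \<le> \<bar>u\<bar> * \<bar>u\<bar>" by (intro mult_left_mono) auto
        then show ?thesis by (simp add: power2_eq_square)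
      qed (simp add: add_increasing)
      then have "E (\<lambda>\<omega>. \<bar>min (X i \<omega>) y\<bar>) \<le> E (\<lambda>\<omega>. ?S i \<omega> + 1)"
        using X[OF i] S[OF i] by (intro E_mono H_add H_const H_abs H_min) auto
      also have "\<dots> = E (?S i) + ereal 1" by (rule E_add_const[OF S[OF i]])
      also have "\<dots> = ereal (real_of_ereal (E (?S i)) + 1)"
        using fin(1)[OF i] 1 by (metis plus_ereal.simps(1))
      also have "\<dots> < \<infinity>" by simp
      finally show ?thesis .
    next
      case 2
      have neg: "(\<lambda>\<omega>. max (- X i \<omega>) 0) \<in> H"
        by (rule H_lip[OF X[OF i], of 1 "\<lambda>u. max (- u) 0"]) auto
      have "E (\<lambda>\<omega>. \<bar>min (X i \<omega>) y\<bar>) \<le> E (\<lambda>\<omega>. max (- X i \<omega>) 0 + y)"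
        using X[OF i] neg y by (intro E_mono H_add H_const H_abs H_min) auto
      also have "\<dots> = E (\<lambda>\<omega>. max (- X i \<omega>) 0) + ereal y" by (rule E_add_const[OF neg])
      also have "\<dots> < \<infinity>" using 2 by simp
      finally show ?thesis .
    qed
  qed
  show ?thesis
    unfolding Bs A_trunc_finite(5)[OF s y p]
  proof (rule deviation_bound[where ?F2.0 = F])
    show "W = V \<and> m = E \<and> F = E \<or> W = conj_cap M V \<and> m = conj_exp E \<and> F = E \<or> W = conj_cap M V \<and> m = E \<and> F = conj_exp E"
      using s by (auto simp: deviation_setup_def)
    show "F (?S i) = ereal (real_of_ereal (F (?S i)))" "0 \<le> real_of_ereal (F (?S i))" if "i \<in> {1..n}" for i
      by (rule fin[OF that])+
    show "mgf_majorant p \<tau> d e" by (rule maj)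
  qed (use s y p int A_trunc_finite(2,3)[OF s y p] in \<open>simp_all add: deviation_setup_def\<close>)
qed

text \<open>The cases match the conventions for the exponential terms: at \<infinity> they are 1 and
  the bounds trivial, at 0 they vanish and \<open>degenerate_from_majorant\<close> applies, and in
  between the real formulas hold.\<close>

lemma sqsum_trunc_cases:
  assumes s: "deviation_setup M H E V n X W m F"
  obtains "sqsum_trunc F n X y = \<infinity>" | "sqsum_trunc F n X y = 0"
    | B where "sqsum_trunc F n X y = ereal B" "0 < B"
proof -
  interpret sublinear_expectation_space M H E using s by (simp add: deviation_setup_def)
  have "0 \<le> sqsum_trunc F n X y"
    unfolding sqsum_trunc_def using s
    by (intro sum_nonneg deviation_setup_nonneg[OF s] H_square H_min) (auto simp: deviation_setup_def indep_seq_def)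
  then show thesis using that by (cases "sqsum_trunc F n X y") (auto simp: zero_ereal_def order.order_iff_strict)
qed

lemma deviation_le_1:
  assumes s: "deviation_setup M H E V n X W m F"
  shows "W (dev_event M m n X x) \<le> 1" "0 \<le> V (large_event M n X y)"
proof -
  interpret sublinear_expectation_space M H E using s by (simp add: deviation_setup_def)
  show "W (dev_event M m n X x) \<le> 1" "0 \<le> V (large_event M n X y)"
    using s capacity_le_1[of V W "dev_event M m n X x"] capacity_le_1[of V V "large_event M n X y"]
      dev_event_sets[of n X m x] large_event_sets[of n X y]
    by (auto simp: deviation_setup_def)
qed

lemma deviation_bennett:
  assumes s: "deviation_setup M H E V n X W m F" and x: "0 < x" and y: "0 < y"
  shows "ereal (W (dev_event M m n X x)) \<le> ereal (V (large_event M n X y)) + bennett_term x y (sqsum_trunc F n X y)"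
proof -
  note bt = bennett_term_simps[OF x y]
  have xy: "0 < x / y" using x y by simp
  let ?D = "W (dev_event M m n X x) - V (large_event M n X y)"
  \<comment> \<open>The exponent 2 is a filler: the Bennett choice has \<open>e = 0\<close>, so the
    moment sum drops out.\<close>
  have dm: "?D \<le> exp (- \<tau> * (x / y) + d * \<tau>\<^sup>2 * (B / y\<^sup>2) +
      e * \<tau> powr 2 * (real_of_ereal (A_trunc E n X 2 y) / y powr 2))"
    if "sqsum_trunc F n X y = ereal B" "mgf_majorant 2 \<tau> d e" for B \<tau> d e
    by (rule deviation_majorant[OF s y _ that]) simp
  from s show ?thesis
  proof (rule sqsum_trunc_cases[where y = y])
    assume "sqsum_trunc F n X y = \<infinity>"
    then show ?thesis using deviation_le_1(1)[OF s, of x] deviation_le_1(2)[OF s, of y] bt(3) by (simp add: one_ereal_def)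
  next
    assume B: "sqsum_trunc F n X y = 0"
    have "?D \<le> 0"
    proof (rule degenerate_from_majorant[OF _ xy])
      fix \<tau> d e assume "mgf_majorant 2 \<tau> d e"
      from dm[OF _ this, of 0] B
      show "?D \<le> exp (- \<tau> * (x / y) + d * \<tau>\<^sup>2 * 0 + e * \<tau> powr 2 * (real_of_ereal (A_trunc E n X 2 y) / y powr 2))"
        by (simp add: zero_ereal_def)
    qed
    then show ?thesis using bt(2) B by simp
  next
    fix B assume B: "sqsum_trunc F n X y = ereal B" "0 < B"
    have "?D \<le> exp (- ((x / y)\<^sup>2 / (2 * (x / y + B / y\<^sup>2)) * (1 + 2 / 3 * ln (1 + (x / y) / (B / y\<^sup>2)))))"
    proof (rule bennett_from_majorant[OF _ xy])
      fix \<tau> d e assume "mgf_majorant 2 \<tau> d e"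
      from dm[OF B(1) this]
      show "?D \<le> exp (- \<tau> * (x / y) + d * \<tau>\<^sup>2 * (B / y\<^sup>2) + e * \<tau> powr 2 * (real_of_ereal (A_trunc E n X 2 y) / y powr 2))"
        by simp
    qed (use B y in simp)
    also have "(x / y) / (B / y\<^sup>2) = x * y / B" using y by (simp add: power2_eq_square)
    also have "(x / y)\<^sup>2 / (2 * (x / y + B / y\<^sup>2)) = x\<^sup>2 / (2 * (x * y + B))"
    proof -
      have "x / y + B / y\<^sup>2 = (x * y + B) / y\<^sup>2" using y by (simp add: power2_eq_square add_divide_distrib)
      then show ?thesis using y by (simp add: power_divide)
    qed
    finally show ?thesis unfolding B(1) bt(1)[OF B(2)] by simp
  qed
qed

lemma deviation_moment:
  assumes s: "deviation_setup M H E V n X W m F" and x: "0 < x" and y: "0 < y"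
    and p: "2 \<le> p" and \<delta>: "0 < \<delta>" "\<delta> \<le> 1"
  shows "ereal (W (dev_event M m n X x)) \<le> ereal (V (large_event M n X y)) + ereal (moment_term E n X p \<delta> x y)
    + gauss_term \<delta> x (sqsum_trunc F n X y)"
proof -
  have p1: "1 \<le> p" using p by simp
  note gt = gauss_term_simps[OF x \<delta>(1)]
  have xy: "0 < x / y" using x y by simp
  have mt: "0 \<le> moment_term E n X p \<delta> x y" by (simp add: moment_term_def)
  let ?D = "W (dev_event M m n X x) - V (large_event M n X y)"
  have dm: "?D \<le> exp (- \<tau> * (x / y) + d * \<tau>\<^sup>2 * (B / y\<^sup>2) +
      e * \<tau> powr p * (real_of_ereal (A_trunc E n X p y) / y powr p))"
    if "sqsum_trunc F n X y = ereal B" "mgf_majorant p \<tau> d e" for B \<tau> d e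
    by (rule deviation_majorant[OF s y p1 that])
  from s show ?thesis
  proof (rule sqsum_trunc_cases[where y = y])
    assume "sqsum_trunc F n X y = \<infinity>"
    then show ?thesis using deviation_le_1(1)[OF s, of x] deviation_le_1(2)[OF s, of y] gt(3) mt by (simp add: one_ereal_def)
  next
    assume B: "sqsum_trunc F n X y = 0"
    have "?D \<le> 0"
    proof (rule degenerate_from_majorant[OF _ xy])
      fix \<tau> d e assume "mgf_majorant p \<tau> d e"
      from dm[OF _ this, of 0] B
      show "?D \<le> exp (- \<tau> * (x / y) + d * \<tau>\<^sup>2 * 0 + e * \<tau> powr p * (real_of_ereal (A_trunc E n X p y) / y powr p))"
        by (simp add: zero_ereal_def)
    qed
    then show ?thesis using gt(2) B mt by simp
  next
    fix B assume B: "sqsum_trunc F n X y = ereal B" "0 < B"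
    have "?D \<le> 2 * exp (p powr p) * (real_of_ereal (A_trunc E n X p y) / y powr p) powr (\<delta> * (x / y) / 10)
      + exp (- ((x / y)\<^sup>2 / (2 * (1 + \<delta>) * (B / y\<^sup>2))))"
    proof (rule moment_from_majorant[OF _ _ xy _ _ p \<delta>])
      show "?D \<le> 1" using deviation_le_1(1)[OF s, of x] deviation_le_1(2)[OF s, of y] by simp
      show "0 < B / y\<^sup>2" using B y by simp
      show "0 \<le> real_of_ereal (A_trunc E n X p y) / y powr p" using A_trunc_finite(4)[OF s y p1] by simp
    qed (rule dm[OF B(1)])
    also have "\<delta> * (x / y) / 10 = \<delta> * x / (10 * y)" by simp
    also have "(x / y)\<^sup>2 / (2 * (1 + \<delta>) * (B / y\<^sup>2)) = x\<^sup>2 / (2 * (1 + \<delta>) * B)"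
      using y by (simp add: power_divide)
    finally show ?thesis unfolding B(1) gt(1)[OF B(2)] moment_term_def by simp
  qed
qed

text \<open>Markov's inequality for the capacity: on the event some p-th power of a positive part
  exceeds y^p, so the whole sum over y^p dominates the indicator, and property (C) applies to
  it.\<close>

lemma large_event_le_moment:
  assumes s: "deviation_setup M H E V n X W m F" and y: "0 < y" and p: "1 \<le> p"
    and P: "pos_moment_sum E n X p = ereal P"
  shows "V (large_event M n X y) \<le> P / y powr p"
proof -
  interpret sublinear_expectation_space M H E using s by (simp add: deviation_setup_def)
  have s': "1 \<le> n" "indep_seq H E n X" "property_C M H E V" using s by (auto simp: deviation_setup_def)
  have X: "X i \<in> H" if "i \<in> {1..n}" for i using s' that by (simp add: indep_seq_def)
  let ?Z = "\<lambda>i \<omega>. max (X i \<omega>) 0 powr p"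
  have Z: "?Z i \<in> H" if "i \<in> {1..n}" for i using X[OF that] p by (rule H_powr_pos_part)
  have yp: "0 < y powr p" using y by simp
  have "ereal (V (large_event M n X y)) \<le> E (\<lambda>\<omega>. 1 / y powr p * (\<Sum>i=1..n. ?Z i \<omega>))"
  proof (rule property_C_upper[OF s'(3) large_event_sets[OF s'(1,2)]])
    show "(\<lambda>\<omega>. 1 / y powr p * (\<Sum>i=1..n. ?Z i \<omega>)) \<in> H" using Z by (intro H_scale H_sum)
    fix \<omega> assume "\<omega> \<in> space M"
    have nn: "0 \<le> (\<Sum>i=1..n. ?Z i \<omega>)" by (intro sum_nonneg) auto
    show "indicat_real (large_event M n X y) \<omega> \<le> 1 / y powr p * (\<Sum>i=1..n. ?Z i \<omega>)"
    proof (cases "\<omega> \<in> large_event M n X y")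
      case True
      then obtain k where k: "k \<in> {1..n}" "y < X k \<omega>" unfolding large_event_alt[OF s'(1)] by auto
      have "y powr p \<le> ?Z k \<omega>" using k y p by (intro powr_mono2) auto
      also have "\<dots> \<le> (\<Sum>i=1..n. ?Z i \<omega>)" using k by (intro member_le_sum) auto
      finally show ?thesis using True yp by (simp add: field_simps)
    qed (use nn yp in simp)
  qed
  also have "\<dots> \<le> ereal (1 / y powr p * P)"
  proof (intro E_scale_le H_sum Z)
    have nn: "0 \<le> E (?Z i)" if "i \<in> {1..n}" for i using Z[OF that] by (intro E_nonneg) auto
    have fin: "E (?Z i) = ereal (real_of_ereal (E (?Z i)))" if "i \<in> {1..n}" for i
      by (rule sum_ereal_finite_nonneg(1)[where f = "\<lambda>i. E (?Z i)", OF finite_atLeastAtMost nn P[unfolded pos_moment_sum_def] that])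
    have "E (\<lambda>\<omega>. \<Sum>i=1..n. ?Z i \<omega>) \<le> ereal (\<Sum>i=1..n. real_of_ereal (E (?Z i)))"
      using Z fin by (intro E_sum_le Z eq_refl[OF fin]) auto
    also have "\<dots> = pos_moment_sum E n X p"
      unfolding pos_moment_sum_def sum_ereal[symmetric] by (intro sum.cong refl fin[symmetric]) auto
    finally show "E (\<lambda>\<omega>. \<Sum>i=1..n. ?Z i \<omega>) \<le> ereal P" using P by simp
  qed (use yp in auto)
  finally show ?thesis by simp
qed

text \<open>In the constant, the 1 stems from Markov's inequality for the large event, 2 exp (p^p)
  from the moment term, and the powers of 10, \<delta> and x from 1 / y^p.\<close>

lemma deviation_pos_moment:
  assumes s: "deviation_setup M H E V n X W m F" and x: "0 < x"
    and p: "2 \<le> p" and \<delta>: "0 < \<delta>" "\<delta> \<le> 1"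
  shows "ereal (W (dev_event M m n X x)) \<le>
    ereal (10 powr p * (1 + 2 * exp (p powr p)) * \<delta> powr (- p) * (1 / x powr p)) * pos_moment_sum E n X p
    + gauss_term \<delta> x (sqsum F n X)"
proof -
  interpret sublinear_expectation_space M H E using s by (simp add: deviation_setup_def)
  have p1: "1 \<le> p" using p by simp
  have X: "X i \<in> H" if "i \<in> {1..n}" for i using s that by (simp add: deviation_setup_def indep_seq_def)
  let ?C = "10 powr p * (1 + 2 * exp (p powr p)) * \<delta> powr (- p) * (1 / x powr p)"
  \<comment> \<open>With this \<open>y\<close> the exponent \<delta> x / (10 y) is 1, so the moment
    term becomes linear in the truncated moment sum.\<close>
  define y where "y = \<delta> * x / 10"
  have y: "0 < y" using x \<delta> by (simp add: y_def)
  have C0: "0 < ?C" using x \<delta> by (simp add: add_pos_nonneg)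
  have sq: "sqsum_trunc F n X y \<le> sqsum F n X"
    unfolding sqsum_trunc_def sqsum_def
  proof (rule sum_mono, rule deviation_setup_mono[OF s])
    fix i \<omega> assume i: "i \<in> {1..n}"
    show "(\<lambda>\<omega>. (min (X i \<omega>) y)\<^sup>2) \<in> H" "(\<lambda>\<omega>. (X i \<omega>)\<^sup>2) \<in> H" using X[OF i] by (auto intro: H_square H_min)
    have "\<bar>min (X i \<omega>) y\<bar> \<le> \<bar>X i \<omega>\<bar>" using y by (simp add: min_def)
    then show "(min (X i \<omega>) y)\<^sup>2 \<le> (X i \<omega>)\<^sup>2" by (simp add: abs_le_square_iff)
  qed
  have sq0: "0 \<le> sqsum_trunc F n X y" using s by (rule sqsum_trunc_cases[where y = y]) auto
  have g: "gauss_term \<delta> x (sqsum_trunc F n X y) \<le> gauss_term \<delta> x (sqsum F n X)"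
    by (rule gauss_term_mono[OF x \<delta>(1) sq0 sq])
  have g0: "0 \<le> gauss_term \<delta> x (sqsum F n X)"
    using gauss_term_mono[OF x \<delta>(1) order_refl order_trans[OF sq0 sq]] gauss_term_simps(2)[OF x \<delta>(1)] by simp
  have A_le: "A_trunc E n X p y \<le> pos_moment_sum E n X p"
    unfolding A_trunc_alt[OF y] pos_moment_sum_def
    using X p1 by (intro sum_mono E_mono H_powr_pos_part H_min powr_mono2) auto
  have A_real: "ereal (real_of_ereal (A_trunc E n X p y)) \<le> pos_moment_sum E n X p"
    using A_le A_trunc_finite(1)[OF s y p1] by simp
  then have nn: "0 \<le> pos_moment_sum E n X p" using A_trunc_finite(4)[OF s y p1]
    by (meson ereal_less_eq(5) order_trans)
  show ?thesis
  proof (cases "pos_moment_sum E n X p")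
    case PInf
    have inf: "ereal ?C * pos_moment_sum E n X p = \<infinity>" using C0 PInf by (cases "?C = 0") auto
    show ?thesis unfolding inf using g0 by (cases "gauss_term \<delta> x (sqsum F n X)") auto
  next
    case (real P)
    define A where "A = real_of_ereal (A_trunc E n X p y)"
    have A: "0 \<le> A" "A \<le> P" using A_trunc_finite(4)[OF s y p1] A_real real by (simp_all add: A_def)
    have mt: "moment_term E n X p \<delta> x y = 2 * exp (p powr p) * (A / y powr p)"
    proof -
      have one: "\<delta> * x / (10 * y) = 1" using x \<delta> by (simp add: y_def)
      have "0 \<le> A / y powr p" using A by simp
      then have "(A / y powr p) powr 1 = A / y powr p" by (rule powr_one)
      then show ?thesis unfolding moment_term_def one A_def by simp
    qed
    have "V (large_event M n X y) + moment_term E n X p \<delta> x y \<le> P / y powr p + 2 * exp (p powr p) * (P / y powr p)"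
      unfolding mt using large_event_le_moment[OF s y p1 real] A
      by (intro add_mono mult_left_mono divide_right_mono) auto
    also have "\<dots> = ?C * P"
    proof -
      have "1 / y powr p = 10 powr p * \<delta> powr (- p) * (1 / x powr p)"
        unfolding y_def using x \<delta> by (simp add: powr_mult powr_divide powr_minus_divide)
      moreover have "P / y powr p + 2 * exp (p powr p) * (P / y powr p) = 1 / y powr p * (1 + 2 * exp (p powr p)) * P"
        by (simp add: distrib_right distrib_left add_divide_distrib)
      ultimately show ?thesis by (simp only: mult_ac)
    qed
    finally have "ereal (V (large_event M n X y)) + ereal (moment_term E n X p \<delta> x y) \<le> ereal ?C * pos_moment_sum E n X p"
      by (simp add: real)
    then show ?thesis
      using deviation_moment[OF s x y p \<delta>] g by (meson add_mono order_trans)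
  qed (use nn in auto)
qed

theorem lemma3p1:
  shows "\<exists>C :: real \<Rightarrow> real.
    \<forall>(M :: 'a measure) H E V n X.
      sublinear_expectation_space M H E \<and>
      subadditive_capacity M V \<and> property_C M H E V \<and>
      1 \<le> n \<and> indep_seq H E n X \<longrightarrow>
      \<comment> \<open>(I), with the last bound replacing (1)\<close>
      (\<forall>x>0.
        \<forall>Q \<in> {V (dev_event M E n X x), conj_cap M V (dev_event M (conj_exp E) n X x)}.
          (\<forall>y>0. ereal Q \<le> ereal (V (large_event M n X y))
                            + bennett_term x y (sqsum_trunc E n X y)) \<and>
          (\<forall>p\<ge>2. \<forall>y>0. \<forall>\<delta>. 0 < \<delta> \<and> \<delta> \<le> 1 \<longrightarrow>
             ereal Q \<le> ereal (V (large_event M n X y)) + ereal (moment_term E n X p \<delta> x y)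
                        + gauss_term \<delta> x (sqsum_trunc E n X y)) \<and>
          (\<forall>p\<ge>2. \<forall>\<delta>. 0 < \<delta> \<and> \<delta> \<le> 1 \<longrightarrow>
             ereal Q \<le> ereal (C p * \<delta> powr (- p) * (1 / x powr p)) * pos_moment_sum E n X p
                        + gauss_term \<delta> x (sqsum E n X))) \<and>
      \<comment> \<open>(II), with the last bound replacing (2); the negative parts are assumed integrable\<close>
      ((\<forall>i\<in>{1..n}. E (\<lambda>\<omega>. max (- X i \<omega>) 0) < \<infinity>) \<longrightarrow>
       (\<forall>x>0.
          (\<forall>y>0. ereal (conj_cap M V (dev_event M E n X x))
                  \<le> ereal (V (large_event M n X y))
                     + bennett_term x y (sqsum_trunc (conj_exp E) n X y)) \<and>
          (\<forall>p\<ge>2. \<forall>y>0. \<forall>\<delta>. 0 < \<delta> \<and> \<delta> \<le> 1 \<longrightarrow>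
             ereal (conj_cap M V (dev_event M E n X x))
              \<le> ereal (V (large_event M n X y)) + ereal (moment_term E n X p \<delta> x y)
                 + gauss_term \<delta> x (sqsum_trunc (conj_exp E) n X y)) \<and>
          (\<forall>p\<ge>2. \<forall>\<delta>. 0 < \<delta> \<and> \<delta> \<le> 1 \<longrightarrow>
             ereal (conj_cap M V (dev_event M E n X x))
              \<le> ereal (C p * \<delta> powr (- p) * (1 / x powr p)) * pos_moment_sum E n X p
                 + gauss_term \<delta> x (sqsum (conj_exp E) n X))))"
\<comment> \<open>The constant of \<open>deviation_pos_moment\<close>; depending on \<open>p\<close>
  alone, it can be fixed before the space and the sequence.\<close>
proof (rule exI[of _ "\<lambda>p. 10 powr p * (1 + 2 * exp (p powr p))"], intro allI impI, elim conjE, goal_cases)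
  case (1 M H E V n X)
  have upper: "deviation_setup M H E V n X V E E"
    and lower: "deviation_setup M H E V n X (conj_cap M V) (conj_exp E) E"
    using 1 by (simp_all add: deviation_setup_def)
  have mixed: "deviation_setup M H E V n X (conj_cap M V) E (conj_exp E)"
    if "\<forall>i\<in>{1..n}. E (\<lambda>\<omega>. max (- X i \<omega>) 0) < \<infinity>"
    using 1 that by (simp add: deviation_setup_def)
  note bounds = deviation_bennett deviation_moment deviation_pos_moment
  show ?case
    by (intro conjI allI impI ballI; (elim conjE insertE emptyE)?; hypsubst?;
        (rule bounds[OF upper] bounds[OF lower] bounds[OF mixed]; assumption))
qed

end
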